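(* Let $X$ be a countable set of indeterminates. Suppose $G$ is a group with an exactly computable faithful representation $\varphi : G \to GL_n(\mathbb{Q}(X))$ for some $n$. Then the power orbit problem in $G$ is decidable, and the nonnegative power orbit problem in $G$ is decidable.
   Context: The power orbit problem in a group $G$ is the question: given $x, y \in G$, does there exist $n \in \mathbb{Z}$ such that $x^n = y$? The nonnegative power orbit problem in $G$ is the question: given $x, y \in G$, does there exist $n \in \mathbb{N}$ such that $x^n = y$? Here $\mathbb{N}$ includes $0$. $\mathbb{Q}(X)$ is the field of rational functions over $\mathbb{Q}$ in the indeterminates from $X$; its elements are encoded exactly as quotients of integer polynomials in finitely many indexed indeterminates. Elements of $G$ are given to algorithms through some fixed finite encoding (for example, words in a generating set). A representation $\varphi$ is a group homomorphism; it is faithful if it is injective, and exactly computable if there is an algorithm which, given the encoding of $g \in G$, outputs the exact matrix $\varphi(g)$. "Decidable" means that there is an algorithm (Turing machine) that halts on every input and answers correctly. *)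

theory Defs
  imports
    "HOL-Library.Poly_Mapping"
    "HOL-Library.Nat_Bijection"
    "HOL-Computational_Algebra.Fraction_Field"
    "HOL-Algebra.Group"
    "Jordan_Normal_Form.Matrix"
begin

section \<open>Turing machines\<close>

text \<open>
  Deterministic Turing machines with any fixed number of two-way infinite tapes. Control states and
  tape symbols are initial segments of the natural numbers. Symbol 0 is the blank, 1 and 2 are the
  bits False and True, 3 is a separator; further symbols may be used internally. State 0 is the
  initial state and state 1 the halting state.
\<close>

datatype move = Move_Left | Stay | Move_Right

record machine =
  num_tapes :: nat
  num_symbols :: nat
  num_states :: nat
  trans :: "nat \<Rightarrow> nat list \<Rightarrow> nat \<times> (nat \<times> move) list"

text \<open>
  \<^term>\<open>trans M q rs\<close> only matters for a state q and a list rs of one symbol per tape, so a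
  well-formed machine has a finite transition table.
\<close>

definition turing_machine :: "machine \<Rightarrow> bool" where
  "turing_machine M \<longleftrightarrow>
     num_tapes M \<ge> 1 \<and> num_symbols M \<ge> 4 \<and> num_states M \<ge> 2 \<and>
     (\<forall>q rs. q < num_states M \<and> length rs = num_tapes M \<and> set rs \<subseteq> {..<num_symbols M} \<longrightarrow>
        (case trans M q rs of (q', acts) \<Rightarrow>
           q' < num_states M \<and> length acts = num_tapes M \<and> fst ` set acts \<subseteq> {..<num_symbols M}))"

text \<open>A tape consists of the contents of its cells and the position of the head.\<close>

type_synonym tape = "(int \<Rightarrow> nat) \<times> int"

type_synonym config = "nat \<times> tape list"

fun read_symbol :: "tape \<Rightarrow> nat" where
  "read_symbol (c, h) = c h"

fun offset :: "move \<Rightarrow> int" where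
  "offset Move_Left = - 1"
| "offset Stay = 0"
| "offset Move_Right = 1"

fun act :: "nat \<times> move \<Rightarrow> tape \<Rightarrow> tape" where
  "act (s, m) (c, h) = (c(h := s), h + offset m)"

fun step :: "machine \<Rightarrow> config \<Rightarrow> config" where
  "step M (q, ts) =
     (if q = 1 then (q, ts)
      else case trans M q (map read_symbol ts) of (q', acts) \<Rightarrow> (q', map2 act acts ts))"

definition bit_symbol :: "bool \<Rightarrow> nat" where
  "bit_symbol b = (if b then 2 else 1)"

definition input_symbols :: "bool list list \<Rightarrow> nat list" where
  "input_symbols ws = concat (map (\<lambda>w. map bit_symbol w @ [3]) ws)"

definition blank_tape :: tape where
  "blank_tape = (\<lambda>i. 0, 0)"

definition input_tape :: "nat list \<Rightarrow> tape" where
  "input_tape xs = (\<lambda>i. if 0 \<le> i \<and> i < int (length xs) then xs ! nat i else 0, 0)"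

definition initial_config :: "machine \<Rightarrow> bool list list \<Rightarrow> config" where
  "initial_config M ws =
     (0, input_tape (input_symbols ws) # replicate (num_tapes M - 1) blank_tape)"

text \<open>
  The output is the word on the last tape that starts at cell 0 and ends before the first blank;
  there is no output if a symbol other than a bit occurs there. Halting configurations are fixed
  points of \<^const>\<open>step\<close>, so a machine has at most one output for each input.
\<close>

definition output_on :: "tape \<Rightarrow> bool list \<Rightarrow> bool" where
  "output_on t w \<longleftrightarrow>
     (\<forall>i<length w. fst t (int i) = bit_symbol (w ! i)) \<and> fst t (int (length w)) = 0"

definition halts_with :: "machine \<Rightarrow> bool list list \<Rightarrow> bool list \<Rightarrow> bool" where
  "halts_with M ws w \<longleftrightarrow>
     (\<exists>k ts. (step M ^^ k) (initial_config M ws) = (1, ts) \<and> output_on (last ts) w)"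


section \<open>Encoded groups and the power orbit problems\<close>

text \<open>
  A finite encoding of the elements of G by words: \<open>\<nu> u = Some g\<close> says that the word u encodes g.
  Every element has at least one code, possibly several (as for words in a generating set), and
  words outside the domain of \<open>\<nu>\<close> encode nothing.
\<close>

definition encoding_of :: "('a, 'b) monoid_scheme \<Rightarrow> (bool list \<rightharpoonup> 'a) \<Rightarrow> bool" where
  "encoding_of G \<nu> \<longleftrightarrow> ran \<nu> = carrier G"

text \<open>
  A problem about pairs of group elements. Its inputs are the pairs of codes: the machine has to
  halt with the correct answer on each of them.
\<close>

definition decidable_wrt :: "(bool list \<rightharpoonup> 'a) \<Rightarrow> ('a \<Rightarrow> 'a \<Rightarrow> bool) \<Rightarrow> bool" where
  "decidable_wrt \<nu> P \<longleftrightarrow>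
     (\<exists>M. turing_machine M \<and>
        (\<forall>u v x y. \<nu> u = Some x \<and> \<nu> v = Some y \<longrightarrow> halts_with M [u, v] [P x y]))"

definition power_orbit :: "('a, 'b) monoid_scheme \<Rightarrow> 'a \<Rightarrow> 'a \<Rightarrow> bool" where
  "power_orbit G x y \<longleftrightarrow> (\<exists>n::int. x [^]\<^bsub>G\<^esub> n = y)"

definition nonneg_power_orbit :: "('a, 'b) monoid_scheme \<Rightarrow> 'a \<Rightarrow> 'a \<Rightarrow> bool" where
  "nonneg_power_orbit G x y \<longleftrightarrow> (\<exists>n::nat. x [^]\<^bsub>G\<^esub> n = y)"


section \<open>Rational functions over the rationals\<close>

text \<open>
  A countable set X of indexed indeterminates is given by the set of the indices, a subset of the
  natural numbers. Monomials are exponent vectors \<^typ>\<open>nat \<Rightarrow>\<^sub>0 nat\<close>, and the field of rational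
  functions in X is a subfield of the one in all the indeterminates indexed by natural numbers.
\<close>

type_synonym rat_poly = "(nat \<Rightarrow>\<^sub>0 nat) \<Rightarrow>\<^sub>0 rat"

type_synonym rat_fun = "rat_poly fract"

definition indets :: "rat_poly \<Rightarrow> nat set" where
  "indets p = (\<Union>m\<in>Poly_Mapping.keys p. Poly_Mapping.keys m)"

definition rat_funs :: "nat set \<Rightarrow> rat_fun set" where
  "rat_funs X = {Fraction_Field.Fract p q | p q. q \<noteq> 0 \<and> indets p \<subseteq> X \<and> indets q \<subseteq> X}"

definition mats_over :: "nat \<Rightarrow> nat set \<Rightarrow> rat_fun mat set" where
  "mats_over n X = {A \<in> carrier_mat n n. \<forall>i<n. \<forall>j<n. A $$ (i, j) \<in> rat_funs X}"

definition GL :: "nat \<Rightarrow> nat set \<Rightarrow> rat_fun mat monoid" where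
  "GL n X =
     \<lparr>carrier = {A \<in> mats_over n X. \<exists>B\<in>mats_over n X. A * B = 1\<^sub>m n \<and> B * A = 1\<^sub>m n},
      mult = (*), one = 1\<^sub>m n\<rparr>"


section \<open>Exact codes of matrices of rational functions\<close>

text \<open>
  An integer polynomial is written as a list of terms; a term is an integer coefficient with a list
  of pairs (index of an indeterminate, exponent).
\<close>

type_synonym poly_expr = "(int \<times> (nat \<times> nat) list) list"

definition monom_of :: "(nat \<times> nat) list \<Rightarrow> nat \<Rightarrow>\<^sub>0 nat" where
  "monom_of ies = sum_list (map (\<lambda>(i, e). Poly_Mapping.single i e) ies)"

definition poly_of :: "poly_expr \<Rightarrow> rat_poly" where
  "poly_of ts = sum_list (map (\<lambda>(c, ies). Poly_Mapping.single (monom_of ies) (of_int c)) ts)"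

definition encode_poly :: "poly_expr \<Rightarrow> nat" where
  "encode_poly ts =
     list_encode (map (\<lambda>(c, ies). prod_encode (int_encode c, list_encode (map prod_encode ies))) ts)"

text \<open>
  The entry (i, j) of a matrix is the quotient of the polynomials \<open>p i j\<close> and \<open>q i j\<close>. The code is a
  natural number, written in binary with the least significant bit first. A matrix has many codes,
  since its entries can be written as quotients in many ways.
\<close>

definition encodes_matrix :: "nat \<Rightarrow> nat set \<Rightarrow> bool list \<Rightarrow> rat_fun mat \<Rightarrow> bool" where
  "encodes_matrix n X w A \<longleftrightarrow>
     A \<in> carrier_mat n n \<and>
     (\<exists>p q :: nat \<Rightarrow> nat \<Rightarrow> poly_expr.
        (\<forall>i<n. \<forall>j<n.
           indets (poly_of (p i j)) \<subseteq> X \<and> indets (poly_of (q i j)) \<subseteq> X \<and> poly_of (q i j) \<noteq> 0 \<and>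
           A $$ (i, j) = Fraction_Field.Fract (poly_of (p i j)) (poly_of (q i j))) \<and>
        (horner_sum of_bool 2 w :: nat) =
          list_encode (map (\<lambda>i. list_encode
            (map (\<lambda>j. prod_encode (encode_poly (p i j), encode_poly (q i j))) [0..<n])) [0..<n]))"

definition exactly_computable ::
  "(bool list \<rightharpoonup> 'a) \<Rightarrow> nat \<Rightarrow> nat set \<Rightarrow> ('a \<Rightarrow> rat_fun mat) \<Rightarrow> bool" where
  "exactly_computable \<nu> n X \<phi> \<longleftrightarrow>
     (\<exists>M. turing_machine M \<and>
        (\<forall>u g. \<nu> u = Some g \<longrightarrow> (\<exists>w. halts_with M [u] w \<and> encodes_matrix n X w (\<phi> g))))"

end

theory Submission
  imports
    Defs
    "Jordan_Normal_Form.Schur_Decomposition"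
begin

text \<open>
  Decidability follows from a computable bound for the exponent: x^k = y or x^k y = 1 is an equation A^k L = R
  between the images A, L, R in GL_n, so it is enough to test all k up to the bound.

  Over the rationals, let A be of infinite order (a finite order divides a constant depending only on n) and
  A^k = B. If the characteristic polynomial of A is not integral, the denominators of the powers of A
  grow exponentially: by Gauss' lemma the leading coefficient of the primitive multiple of the characteristic
  polynomial is squared when A is. If it is integral and some eigenvalue exceeds 1 in modulus,
  then that eigenvalue exceeds a constant r > 1 depending only on n, because only finitely many integral monic
  polynomials have all roots in a disc. Otherwise the nonzero eigenvalues are roots of unity by Kronecker, a
  power of A is unipotent on its stable image, and k is read off from a coefficient.

  Over the field of rational functions, one specialises x_i := y^(E^i) for a large base E and some integer y
  that keeps A of infinite order. The same substitution, for all y up to a degree bound, tests polynomial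
  identities, so the decision function works with integers only and is primitive recursive. Primitive recursive
  functions are run by counter programs, whose counters are head positions of a multi-tape machine, on the
  outputs of the machine that computes the representation.
\<close>

section \<open>Structured tape programs\<close>

text \<open>The obstacle is that specialisation loses information. A relation A^k L = R survives it,
  but the converse fails, and the specialised A may be singular or of finite order. So the bound for
  k is proved for arbitrary square rational matrices, with A^(n+g) \<noteq> A^n in place of infinite
  order; here g is the exponent from Kronecker's theorem, uniform in the degree n. If A^g = 1 holds
  before specialisation, k can be reduced modulo g; otherwise a nonzero entry of A^(n+g) - A^n is a
  polynomial condition on y. No good y has to be found: the algorithm adds up the bounds for all y
  up to the degree bound, and one of them is good. The bound is polynomial in the size of the
  entries and not in their length, since the powers of a unipotent matrix grow only polynomially in
  k. The constants g, C, c depend on n alone; they are shown to exist and are built into the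
  machine, so that root gaps and roots of unity are never computed.\<close>

declare step.simps [simp del]

text \<open>Tapes are indexed by all natural numbers, so that programs compose without agreeing on a
  number of tapes; \<open>wf_prog\<close> fixes that number only for the translation into a
  machine.\<close>

datatype prog =
    Act "(nat \<Rightarrow> nat) \<Rightarrow> nat \<Rightarrow> nat \<times> move"
  | Seq prog prog (infixr \<open>;;\<close> 60)
  | While "(nat \<Rightarrow> nat) \<Rightarrow> bool" prog

abbreviation reads :: "(nat \<Rightarrow> tape) \<Rightarrow> nat \<Rightarrow> nat" where
  "reads \<tau> \<equiv> \<lambda>j. read_symbol (\<tau> j)"

text \<open>A big-step semantics: only terminating runs are derivable, so a derivation includes the
  proof of termination.\<close>

inductive exec :: "prog \<Rightarrow> (nat \<Rightarrow> tape) \<Rightarrow> (nat \<Rightarrow> tape) \<Rightarrow> bool" where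
  exec_Act: "exec (Act f) \<tau> (\<lambda>j. act (f (reads \<tau>) j) (\<tau> j))"
| exec_Seq: "exec p \<tau> \<tau>' \<Longrightarrow> exec q \<tau>' \<tau>'' \<Longrightarrow> exec (p ;; q) \<tau> \<tau>''"
| exec_While_end: "\<not> c (reads \<tau>) \<Longrightarrow> exec (While c p) \<tau> \<tau>"
| exec_While_loop: "c (reads \<tau>) \<Longrightarrow> exec p \<tau> \<tau>' \<Longrightarrow> exec (While c p) \<tau>' \<tau>'' \<Longrightarrow> exec (While c p) \<tau> \<tau>''"

lemma exec_Act': "\<tau>' = (\<lambda>j. act (f (reads \<tau>) j) (\<tau> j)) \<Longrightarrow> exec (Act f) \<tau> \<tau>'"
  by (simp add: exec_Act)

lemma act_stay [simp]: "act (read_symbol t, Stay) t = t"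
  by (cases t) simp

text \<open>A machine with \<open>T\<close> tapes sees only the symbols on these tapes; this
  condition lets a function of infinitely many symbols become a finite transition table.\<close>

definition local_on :: "nat \<Rightarrow> ((nat \<Rightarrow> nat) \<Rightarrow> 'a) \<Rightarrow> bool" where
  "local_on T c \<longleftrightarrow> (\<forall>\<rho> \<rho>'. (\<forall>j<T. \<rho> j = \<rho>' j) \<longrightarrow> c \<rho> = c \<rho>')"

fun wf_prog :: "nat \<Rightarrow> nat \<Rightarrow> prog \<Rightarrow> bool" where
  "wf_prog T S (Act f) \<longleftrightarrow> (\<forall>j<T. local_on T (\<lambda>\<rho>. f \<rho> j)) \<and>
     (\<forall>\<rho>. (\<forall>j<T. \<rho> j < S) \<longrightarrow> (\<forall>j<T. fst (f \<rho> j) < S))"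
| "wf_prog T S (p ;; q) \<longleftrightarrow> wf_prog T S p \<and> wf_prog T S q"
| "wf_prog T S (While c p) \<longleftrightarrow> local_on T c \<and> wf_prog T S p"

type_synonym instr = "nat list \<Rightarrow> nat \<times> (nat \<times> move) list"

definition stay :: "nat list \<Rightarrow> (nat \<times> move) list" where
  "stay rs = map (\<lambda>s. (s, Stay)) rs"

definition tape_fun :: "nat list \<Rightarrow> nat \<Rightarrow> nat" where
  "tape_fun rs j = (if j < length rs then rs ! j else 0)"

fun plen :: "prog \<Rightarrow> nat" where
  "plen (Act f) = 1"
| "plen (p ;; q) = plen p + plen q"
| "plen (While c p) = plen p + 2"

text \<open>Addresses are absolute: the block starts at \<open>b\<close> and control leaves it at
  \<open>b + plen p\<close>. A loop has one test before its body and one backward jump after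
  it.\<close>

fun code :: "nat \<Rightarrow> prog \<Rightarrow> instr list" where
  "code b (Act f) = [\<lambda>rs. (Suc b, map (f (tape_fun rs)) [0..<length rs])]"
| "code b (p ;; q) = code b p @ code (b + plen p) q"
| "code b (While c p) =
     (\<lambda>rs. (if c (tape_fun rs) then Suc b else b + plen p + 2, stay rs)) #
     code (Suc b) p @ [\<lambda>rs. (b, stay rs)]"

lemma length_code [simp]: "length (code b p) = plen p"
  by (induction p arbitrary: b) auto

definition machine_of :: "nat \<Rightarrow> nat \<Rightarrow> instr list \<Rightarrow> machine" where
  "machine_of T S ins = \<lparr>num_tapes = T, num_symbols = S, num_states = length ins, trans = (\<lambda>q. ins ! q)\<rparr>"

abbreviation tapes :: "nat \<Rightarrow> (nat \<Rightarrow> tape) \<Rightarrow> tape list" where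
  "tapes T \<tau> \<equiv> map \<tau> [0..<T]"

lemma map2_stay: "map2 act (stay (map read_symbol ts)) ts = ts"
  by (induction ts) (auto simp: stay_def)

lemma step_instr:
  assumes "ins ! q = i" "q \<noteq> 1"
  shows "step (machine_of T S ins) (q, ts) =
    (fst (i (map read_symbol ts)), map2 act (snd (i (map read_symbol ts))) ts)"
  using assms by (simp add: machine_of_def step.simps case_prod_beta)

lemma step_stay:
  assumes "ins ! q = (\<lambda>rs. (g rs, stay rs))" "q \<noteq> 1"
  shows "step (machine_of T S ins) (q, ts) = (g (map read_symbol ts), ts)"
  by (subst step_instr[OF assms]) (simp add: map2_stay)

lemma local_onD: "local_on T c \<Longrightarrow> (\<And>j. j < T \<Longrightarrow> \<rho> j = \<rho>' j) \<Longrightarrow> c \<rho> = c \<rho>'"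
  by (auto simp: local_on_def)

text \<open>States 0 and 1 are reserved for start and halt, hence \<open>b \<ge> 2\<close>: no
  address inside the code is mistaken for the halting state.\<close>

lemma exec_code:
  assumes "exec p \<tau> \<tau>'" "wf_prog T S p" "ins = pre @ code b p @ post" "length pre = b" "b \<ge> 2"
  shows "\<exists>k. (step (machine_of T S ins) ^^ k) (b, tapes T \<tau>) = (b + plen p, tapes T \<tau>')"
  using assms
proof (induction p \<tau> \<tau>' arbitrary: b pre post rule: exec.induct)
  case (exec_Act f \<tau>)
  let ?rs = "map read_symbol (tapes T \<tau>)"
  have i: "ins ! b = (\<lambda>rs. (Suc b, map (f (tape_fun rs)) [0..<length rs]))"
    using exec_Act by (simp add: nth_append)
  have "f (tape_fun ?rs) j = f (reads \<tau>) j" if "j < T" for j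
    using exec_Act.prems(1) that
    by (auto intro!: local_onD[where c = "\<lambda>\<rho>. f \<rho> j"] simp: tape_fun_def)
  then have "map2 act (map (f (tape_fun ?rs)) [0..<length ?rs]) (tapes T \<tau>)
      = tapes T (\<lambda>j. act (f (reads \<tau>) j) (\<tau> j))"
    by (intro nth_equalityI) simp_all
  then have "step (machine_of T S ins) (b, tapes T \<tau>) = (Suc b, tapes T (\<lambda>j. act (f (reads \<tau>) j) (\<tau> j)))"
    using exec_Act.prems by (subst step_instr[OF i]) simp_all
  then show ?case by (intro exI[of _ 1]) simp
next
  case (exec_Seq p \<tau> \<tau>' q \<tau>'')
  obtain k where k: "(step (machine_of T S ins) ^^ k) (b, tapes T \<tau>) = (b + plen p, tapes T \<tau>')"
    using exec_Seq.IH(1)[of pre b "code (b + plen p) q @ post"] exec_Seq.prems by auto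
  obtain l where l: "(step (machine_of T S ins) ^^ l) (b + plen p, tapes T \<tau>') =
      (b + plen p + plen q, tapes T \<tau>'')"
    using exec_Seq.IH(2)[of "pre @ code b p" "b + plen p" post] exec_Seq.prems by auto
  have "(step (machine_of T S ins) ^^ (l + k)) (b, tapes T \<tau>) = (b + plen (p ;; q), tapes T \<tau>'')"
    unfolding funpow_add comp_def k using l by (simp add: ac_simps)
  then show ?case by blast
next
  case (exec_While_end c \<tau> p)
  have i: "ins ! b = (\<lambda>rs. (if c (tape_fun rs) then Suc b else b + plen p + 2, stay rs))"
    using exec_While_end by (simp add: nth_append)
  have "\<not> c (tape_fun (map read_symbol (tapes T \<tau>)))"
    using exec_While_end local_onD[of T c "tape_fun (map read_symbol (tapes T \<tau>))" "reads \<tau>"]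
    by (auto simp: tape_fun_def)
  then have "step (machine_of T S ins) (b, tapes T \<tau>) = (b + plen p + 2, tapes T \<tau>)"
    using step_stay[OF i] exec_While_end.prems by simp
  then show ?case by (intro exI[of _ 1]) simp
next
  case (exec_While_loop c \<tau> p \<tau>' \<tau>'')
  have i: "ins ! b = (\<lambda>rs. (if c (tape_fun rs) then Suc b else b + plen p + 2, stay rs))"
    using exec_While_loop.prems by (simp add: nth_append)
  have i': "ins ! (Suc b + plen p) = (\<lambda>rs. (b, stay rs))"
    using exec_While_loop.prems by (simp add: nth_append)
  have "c (tape_fun (map read_symbol (tapes T \<tau>)))"
    using exec_While_loop.hyps exec_While_loop.prems
      local_onD[of T c "tape_fun (map read_symbol (tapes T \<tau>))" "reads \<tau>"]
    by (auto simp: tape_fun_def)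
  then have 1: "step (machine_of T S ins) (b, tapes T \<tau>) = (Suc b, tapes T \<tau>)"
    using step_stay[OF i] exec_While_loop.prems by simp
  obtain k where k: "(step (machine_of T S ins) ^^ k) (Suc b, tapes T \<tau>) = (Suc b + plen p, tapes T \<tau>')"
    using exec_While_loop.IH(1)[of "pre @ [\<lambda>rs. (if c (tape_fun rs) then Suc b else b + plen p + 2, stay rs)]"
       "Suc b" "(\<lambda>rs. (b, stay rs)) # post"] exec_While_loop.prems by auto
  have 2: "step (machine_of T S ins) (Suc b + plen p, tapes T \<tau>') = (b, tapes T \<tau>')"
    using step_stay[OF i'] exec_While_loop.prems by simp
  obtain l where l: "(step (machine_of T S ins) ^^ l) (b, tapes T \<tau>') =
      (b + plen (While c p), tapes T \<tau>'')"
    using exec_While_loop.IH(2)[OF exec_While_loop.prems] by auto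
  have "(step (machine_of T S ins) ^^ (l + (1 + (k + 1)))) (b, tapes T \<tau>) =
      (b + plen (While c p), tapes T \<tau>'')"
    unfolding funpow_add comp_def using 1 2 k l by simp
  then show ?case by blast
qed

section \<open>From instruction lists to Turing machines\<close>

definition ok_instr :: "nat \<Rightarrow> nat \<Rightarrow> nat \<Rightarrow> instr \<Rightarrow> bool" where
  "ok_instr T S L i \<longleftrightarrow> (\<forall>rs. length rs = T \<and> set rs \<subseteq> {..<S} \<longrightarrow>
     fst (i rs) < L \<and> length (snd (i rs)) = T \<and> fst ` set (snd (i rs)) \<subseteq> {..<S})"

lemma ok_stay: "(\<And>rs. g rs < L) \<Longrightarrow> ok_instr T S L (\<lambda>rs. (g rs, stay rs))"
  by (auto simp: ok_instr_def stay_def)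

lemma ok_code: "wf_prog T S p \<Longrightarrow> b + plen p < L \<Longrightarrow> i \<in> set (code b p) \<Longrightarrow> ok_instr T S L i"
proof (induction p arbitrary: b)
  case (Act f)
  have "fst (f (tape_fun rs) j) < S" if "length rs = T" "set rs \<subseteq> {..<S}" "j < T" for rs j
    proof -
    have "\<forall>j<T. tape_fun rs j < S"
      using that(1,2) nth_mem by (auto simp: tape_fun_def subset_iff)
    then show ?thesis using Act.prems(1) that(3) by simp
  qed
  then show ?case using Act by (auto simp: ok_instr_def)
next
  case (Seq p q)
  show ?case using Seq.prems by (auto intro: Seq.IH(1)[of b] Seq.IH(2)[of "b + plen p"])
next
  case (While c p)
  then show ?case by (auto intro!: ok_stay intro: While.IH[of "Suc b"])
qed

theorem prog_machine:
  assumes "wf_prog T S p" "T \<ge> 1" "S \<ge> 4"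
  obtains M where "turing_machine M" "num_tapes M = T"
    "\<And>\<tau> \<tau>'. exec p \<tau> \<tau>' \<Longrightarrow> \<exists>k. (step M ^^ k) (0, tapes T \<tau>) = (1, tapes T \<tau>')"
proof
  \<comment> \<open>Address 0 jumps over the halting state 1 to the code; the entry at 1 only fills
    the table, and a last instruction leads from the end of the code to state 1.\<close>
  define pre :: "instr list" where "pre = [\<lambda>rs. (2, stay rs), \<lambda>rs. (1, stay rs)]"
  define ins where "ins = pre @ code 2 p @ [\<lambda>rs. (1, stay rs)]"
  define M where "M = machine_of T S ins"
  have len: "length ins = plen p + 3" by (simp add: ins_def pre_def)
  have ok: "\<forall>i\<in>set ins. ok_instr T S (length ins) i"
    using ok_code[OF assms(1), of 2 "length ins"] len
    by (auto simp: ins_def pre_def intro!: ok_stay)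
  show "turing_machine M"
    using ok assms len by (auto simp: turing_machine_def M_def machine_of_def ok_instr_def case_prod_beta)
  show "num_tapes M = T" by (simp add: M_def machine_of_def)
  fix \<tau> \<tau>' assume e: "exec p \<tau> \<tau>'"
  obtain k where k: "(step M ^^ k) (2, tapes T \<tau>) = (2 + plen p, tapes T \<tau>')"
    unfolding M_def using exec_code[OF e assms(1) ins_def] by (auto simp: pre_def)
  have i0: "ins ! 0 = (\<lambda>rs. (2, stay rs))" by (simp add: ins_def pre_def)
  have ie: "ins ! (2 + plen p) = (\<lambda>rs. (1, stay rs))" by (simp add: ins_def pre_def nth_append)
  have 1: "step M (0, tapes T \<tau>) = (2, tapes T \<tau>)"
    unfolding M_def by (rule step_stay[OF i0]) simp
  have 2: "step M (2 + plen p, tapes T \<tau>') = (1, tapes T \<tau>')"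
    unfolding M_def by (rule step_stay[OF ie]) simp
  have "(step M ^^ (1 + (k + 1))) (0, tapes T \<tau>) = (1, tapes T \<tau>')"
    unfolding funpow_add comp_def using 1 2 k by simp
  then show "\<exists>k. (step M ^^ k) (0, tapes T \<tau>) = (1, tapes T \<tau>')" by blast
qed

section \<open>Counter programs and primitive recursion\<close>

datatype cprog = CInc nat | CDec nat | CSeq cprog cprog (infixr \<open>;;;\<close> 60) | CWhile nat cprog

inductive cexec :: "cprog \<Rightarrow> (nat \<Rightarrow> nat) \<Rightarrow> (nat \<Rightarrow> nat) \<Rightarrow> bool" where
  cexec_Inc: "cexec (CInc r) s (s(r := Suc (s r)))"
| cexec_Dec: "cexec (CDec r) s (s(r := s r - 1))"
| cexec_Seq: "cexec p s s' \<Longrightarrow> cexec q s' s'' \<Longrightarrow> cexec (p ;;; q) s s''"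
| cexec_While_end: "s r = 0 \<Longrightarrow> cexec (CWhile r p) s s"
| cexec_While_loop: "s r \<noteq> 0 \<Longrightarrow> cexec p s s' \<Longrightarrow> cexec (CWhile r p) s' s'' \<Longrightarrow> cexec (CWhile r p) s s''"

text \<open>Environments instead of argument tuples avoid arities. Composition is not a clause but
  is derived in \<open>PR_subst\<close>, so the translation into counter programs has only four
  cases.\<close>

inductive PR :: "((nat \<Rightarrow> nat) \<Rightarrow> nat) \<Rightarrow> bool" where
  PR_zero: "PR (\<lambda>\<sigma>. 0)"
| PR_Suc: "PR f \<Longrightarrow> PR (\<lambda>\<sigma>. Suc (f \<sigma>))"
| PR_var: "PR (\<lambda>\<sigma>. \<sigma> i)"
| PR_rec: "PR b \<Longrightarrow> PR f \<Longrightarrow> PR g \<Longrightarrow>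
    PR (\<lambda>\<sigma>. rec_nat (f \<sigma>) (\<lambda>i r. g (case_nat i (case_nat r \<sigma>))) (b \<sigma>))"

text \<open>The rules for loops unfold the first round, so the run along the states \<open>F\<close>
  is assembled downwards from the last state.\<close>

lemma cexec_loop:
  assumes "\<And>i. i < m \<Longrightarrow> F i r \<noteq> 0" "\<And>i. i < m \<Longrightarrow> cexec p (F i) (F (Suc i))" "F m r = 0"
  shows "cexec (CWhile r p) (F 0) (F m)"
proof -
  have "cexec (CWhile r p) (F i) (F m)" if "i \<le> m" for i
    using that
    by (induction i rule: inc_induct) (use assms in \<open>auto intro: cexec_While_end cexec_While_loop\<close>)
  then show ?thesis by blast
qed

definition cclear :: "nat \<Rightarrow> cprog" where "cclear r = CWhile r (CDec r)"

lemma cexec_clear: "cexec (cclear r) s (s(r := 0))"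
proof -
  let ?F = "\<lambda>i. s(r := s r - i)"
  have "cexec (cclear r) (?F 0) (?F (s r))"
    unfolding cclear_def
  proof (rule cexec_loop)
    fix i
    show "cexec (CDec r) (?F i) (?F (Suc i))" using cexec_Dec[of r "?F i"] by simp
  qed auto
  then show ?thesis by simp
qed

definition cmove :: "nat \<Rightarrow> nat \<Rightarrow> cprog" where
  "cmove a b = cclear b ;;; CWhile a (CDec a ;;; CInc b)"

lemma cexec_move:
  assumes "a \<noteq> b"
  shows "cexec (cmove a b) s (s(b := s a, a := 0))"
proof -
  let ?F = "\<lambda>i. s(b := i, a := s a - i)"
  have "cexec (CWhile a (CDec a ;;; CInc b)) (?F 0) (?F (s a))"
  proof (rule cexec_loop)
    fix i
    have "(?F i)(a := ?F i a - 1, b := Suc (?F i b)) = ?F (Suc i)"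
      using assms by (auto simp: fun_eq_iff)
    then show "cexec (CDec a ;;; CInc b) (?F i) (?F (Suc i))"
      using cexec_Seq[OF cexec_Dec[of a "?F i"] cexec_Inc[of b]] assms by simp
  qed auto
  moreover have "?F 0 = s(b := 0)" using assms by auto
  ultimately show ?thesis unfolding cmove_def using cexec_Seq[OF cexec_clear] by simp
qed

text \<open>Reading a counter destroys it; the value is therefore moved into two counters at once
  and restored from one of them.\<close>

definition ccopy :: "nat \<Rightarrow> nat \<Rightarrow> nat \<Rightarrow> cprog" where
  "ccopy a b c = cclear b ;;; cclear c ;;; CWhile a (CDec a ;;; CInc b ;;; CInc c) ;;; cmove c a"

lemma cexec_copy:
  assumes "a \<noteq> b" "a \<noteq> c" "b \<noteq> c"
  shows "cexec (ccopy a b c) s (s(b := s a, c := 0))"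
proof -
  let ?F = "\<lambda>i. s(b := i, c := i, a := s a - i)"
  have "cexec (CWhile a (CDec a ;;; CInc b ;;; CInc c)) (?F 0) (?F (s a))"
  proof (rule cexec_loop)
    fix i
    have "(?F i)(a := ?F i a - 1, b := Suc (?F i b), c := Suc (?F i c)) = ?F (Suc i)"
      using assms by (auto simp: fun_eq_iff)
    then show "cexec (CDec a ;;; CInc b ;;; CInc c) (?F i) (?F (Suc i))"
      using cexec_Seq[OF cexec_Dec[of a "?F i"] cexec_Seq[OF cexec_Inc[of b] cexec_Inc[of c]]] assms by simp
  qed auto
  moreover have "?F 0 = s(b := 0, c := 0)" using assms by auto
  ultimately have loop: "cexec (CWhile a (CDec a ;;; CInc b ;;; CInc c)) (s(b := 0, c := 0)) (?F (s a))"
    by simp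
  have "cexec (ccopy a b c) s ((?F (s a))(a := ?F (s a) c, c := 0))"
    unfolding ccopy_def
    by (intro cexec_Seq[OF cexec_clear] cexec_Seq[OF loop] cexec_move) (use assms in auto)
  moreover have "(?F (s a))(a := ?F (s a) c, c := 0) = s(b := s a, c := 0)"
    using assms by (auto simp: fun_eq_iff)
  ultimately show ?thesis by simp
qed

text \<open>Stack discipline: the result goes to register r, the registers below r are kept, the ones above r
  are scratch space with arbitrary initial contents.\<close>

lemma PR_cprog:
  assumes "PR f" "\<And>i. \<rho> i < r"
  shows "\<exists>p. \<forall>s. \<exists>s'. cexec p s s' \<and> s' r = f (\<lambda>i. s (\<rho> i)) \<and> (\<forall>i<r. s' i = s i)"
  using assms
proof (induction arbitrary: \<rho> r rule: PR.induct)
  case PR_zero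
  show ?case by (intro exI[of _ "cclear r"] allI exI conjI, rule cexec_clear) auto
next
  case (PR_Suc f)
  then obtain p where p: "\<forall>s. \<exists>s'. cexec p s s' \<and> s' r = f (\<lambda>i. s (\<rho> i)) \<and> (\<forall>i<r. s' i = s i)" by blast
  show ?case
  proof (intro exI[of _ "p ;;; CInc r"] allI)
    fix s
    obtain s' where s': "cexec p s s'" "s' r = f (\<lambda>i. s (\<rho> i))" "\<forall>i<r. s' i = s i" using p by blast
    show "\<exists>s'. cexec (p ;;; CInc r) s s' \<and> s' r = Suc (f (\<lambda>i. s (\<rho> i))) \<and> (\<forall>i<r. s' i = s i)"
      by (intro exI conjI, rule cexec_Seq[OF s'(1) cexec_Inc]) (use s' in auto)
  qed
next
  case (PR_var i)
  show ?case
    by (intro exI[of _ "ccopy (\<rho> i) r (Suc r)"] allI exI conjI, rule cexec_copy)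
      (use PR_var[of i] in auto)
next
  case (PR_rec b f g)
  obtain pf where pf: "\<And>s. \<exists>s'. cexec pf s s' \<and> s' r = f (\<lambda>i. s (\<rho> i)) \<and> (\<forall>i<r. s' i = s i)"
    using PR_rec.IH(2)[of \<rho> r] PR_rec.prems by blast
  obtain pb where pb: "\<And>s. \<exists>s'. cexec pb s s' \<and> s' (Suc r) = b (\<lambda>i. s (\<rho> i)) \<and> (\<forall>i<Suc r. s' i = s i)"
    using PR_rec.IH(1)[of \<rho> "Suc r"] less_SucI[OF PR_rec.prems] by blast
  \<comment> \<open>Register \<open>r\<close> holds the current value of the recursion,
    \<open>r + 1\<close> the number of remaining rounds, \<open>r + 2\<close> the index of the
    round, and \<open>r + 3\<close> receives the value of the step function.\<close>
  let ?\<rho> = "case_nat (r + 2) (case_nat r \<rho>)"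
  have \<rho>: "?\<rho> i < r + 3" for i
    using PR_rec.prems by (auto split: nat.split intro!: trans_less_add1)
  obtain pg where pg: "\<And>s. \<exists>s'. cexec pg s s' \<and> s' (r + 3) = g (\<lambda>i. s (?\<rho> i)) \<and> (\<forall>i<r+3. s' i = s i)"
    using PR_rec.IH(3)[of ?\<rho> "r + 3", OF \<rho>] by blast
  define body where "body = CDec (Suc r) ;;; pg ;;; cmove (r + 3) r ;;; CInc (r + 2)"
  define F where "F \<sigma> = rec_nat (f \<sigma>) (\<lambda>i r. g (case_nat i (case_nat r \<sigma>)))" for \<sigma>
  have body: "\<exists>s'. cexec body s s' \<and> s' r = F \<sigma> (Suc i) \<and> s' (Suc r) = n \<and> s' (r + 2) = Suc i \<and>
      (\<forall>j<r. s' j = s j)"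
    if "s r = F \<sigma> i" "s (Suc r) = Suc n" "s (r + 2) = i" "\<sigma> = (\<lambda>i. s (\<rho> i))" for s \<sigma> i n
  proof -
    let ?s1 = "s(Suc r := n)"
    have s1: "cexec (CDec (Suc r)) s ?s1" using cexec_Dec[of "Suc r" s] that by simp
    obtain s2 where s2: "cexec pg ?s1 s2" "s2 (r + 3) = g (\<lambda>i. ?s1 (?\<rho> i))" "\<forall>i<r+3. s2 i = ?s1 i"
      using pg by blast
    have ne: "\<rho> i \<noteq> Suc r" for i using PR_rec.prems[of i] by simp
    have \<sigma>: "s (\<rho> j) = \<sigma> j" for j using that(4) by simp
    have "(\<lambda>i. ?s1 (?\<rho> i)) = case_nat i (case_nat (F \<sigma> i) \<sigma>)"
      using that(1-3) ne \<sigma> by (auto simp: fun_eq_iff split: nat.split)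
    then have r3: "s2 (r + 3) = F \<sigma> (Suc i)" using s2 by (simp add: F_def)
    let ?s3 = "s2(r := s2 (r + 3), r + 3 := 0)"
    have s3: "cexec (cmove (r + 3) r) s2 ?s3" by (rule cexec_move) simp
    show ?thesis unfolding body_def
      by (intro exI conjI, rule cexec_Seq[OF s1 cexec_Seq[OF s2(1) cexec_Seq[OF s3 cexec_Inc]]])
        (use s2 r3 that in auto)
  qed
  \<comment> \<open>Stated for a start in an arbitrary round \<open>i\<close>, as the induction on
    the remaining rounds requires.\<close>
  have loop: "\<exists>s'. cexec (CWhile (Suc r) body) s s' \<and> s' r = F \<sigma> (i + n) \<and> (\<forall>j<r. s' j = s j)"
    if "s r = F \<sigma> i" "s (Suc r) = n" "s (r + 2) = i" "\<sigma> = (\<lambda>i. s (\<rho> i))" for s \<sigma> i n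
    using that
  proof (induction n arbitrary: s i)
    case 0
    then show ?case by (auto intro!: exI[of _ s] cexec_While_end)
  next
    case (Suc n)
    obtain s' where s': "cexec body s s'" "s' r = F \<sigma> (Suc i)" "s' (Suc r) = n" "s' (r + 2) = Suc i"
        "\<forall>j<r. s' j = s j" using body[OF Suc.prems] by blast
    have "\<sigma> = (\<lambda>i. s' (\<rho> i))" using s' Suc.prems PR_rec.prems by simp
    then obtain s'' where "cexec (CWhile (Suc r) body) s' s''" "s'' r = F \<sigma> (Suc i + n)" "\<forall>j<r. s'' j = s' j"
      using Suc.IH[OF s'(2,3,4)] by blast
    then show ?case using s' cexec_While_loop[of s "Suc r" body s' s''] Suc.prems
      by (intro exI[of _ s'']) auto
  qed
  show ?case
  proof (intro exI[of _ "pf ;;; pb ;;; cclear (r + 2) ;;; CWhile (Suc r) body"] allI)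
    fix s
    obtain s1 where s1: "cexec pf s s1" "s1 r = f (\<lambda>i. s (\<rho> i))" "\<forall>i<r. s1 i = s i" using pf by blast
    obtain s2 where s2: "cexec pb s1 s2" "s2 (Suc r) = b (\<lambda>i. s1 (\<rho> i))" "\<forall>i<Suc r. s2 i = s1 i"
      using pb by blast
    let ?s3 = "s2(r + 2 := 0)"
    have eq1: "(\<lambda>i. s1 (\<rho> i)) = (\<lambda>i. s (\<rho> i))" using s1 PR_rec.prems by simp
    have "\<rho> i \<noteq> r + 2" for i using PR_rec.prems[of i] by simp
    moreover have "s2 (\<rho> i) = s (\<rho> i)" for i using s1(3) s2(3) PR_rec.prems[of i] by simp
    ultimately have eq3: "(\<lambda>i. s (\<rho> i)) = (\<lambda>i. ?s3 (\<rho> i))" by (simp add: fun_eq_iff)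
    obtain s4 where s4: "cexec (CWhile (Suc r) body) ?s3 s4"
        "s4 r = F (\<lambda>i. s (\<rho> i)) (0 + b (\<lambda>i. s (\<rho> i)))" "\<forall>j<r. s4 j = ?s3 j"
      using loop[of ?s3 "\<lambda>i. s (\<rho> i)" 0 "b (\<lambda>i. s (\<rho> i))"] s1 s2 eq1 eq3 by (auto simp: F_def)
    show "\<exists>s'. cexec (pf ;;; pb ;;; cclear (r + 2) ;;; CWhile (Suc r) body) s s' \<and>
        s' r = rec_nat (f (\<lambda>i. s (\<rho> i))) (\<lambda>ia r. g (case_nat ia (case_nat r (\<lambda>i. s (\<rho> i))))) (b (\<lambda>i. s (\<rho> i))) \<and>
        (\<forall>i<r. s' i = s i)"
      by (intro exI conjI, rule cexec_Seq[OF s1(1) cexec_Seq[OF s2(1) cexec_Seq[OF cexec_clear s4(1)]]])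
        (use s1 s2 s4 in \<open>auto simp: F_def\<close>)
  qed
qed

section \<open>Counters as tapes\<close>

fun regs :: "cprog \<Rightarrow> nat" where
  "regs (CInc r) = Suc r"
| "regs (CDec r) = Suc r"
| "regs (p ;;; q) = max (regs p) (regs q)"
| "regs (CWhile r p) = max (Suc r) (regs p)"

text \<open>A counter is the head position on a tape whose only nonblank cell is cell 0, which holds the
  symbol 1.\<close>

definition ctape :: "nat \<Rightarrow> tape" where
  "ctape v = (\<lambda>i. if i = 0 then 1 else 0, int v)"

abbreviation stays :: "(nat \<Rightarrow> nat) \<Rightarrow> nat \<Rightarrow> nat \<times> move" where
  "stays \<rho> \<equiv> \<lambda>j. (\<rho> j, Stay)"

lemma read_ctape [simp]: "read_symbol (ctape v) = (if v = 0 then 1 else 0)"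
  by (simp add: ctape_def)

lemma act_ctape_simps [simp]:
  "act (Suc 0, Move_Right) (ctape 0) = ctape (Suc 0)"
  "v > 0 \<Longrightarrow> act (0, Move_Right) (ctape v) = ctape (Suc v)"
  "v > 0 \<Longrightarrow> act (0, Move_Left) (ctape v) = ctape (v - 1)"
  "act (Suc 0, Stay) (ctape 0) = ctape 0"
  "v > 0 \<Longrightarrow> act (0, Stay) (ctape v) = ctape v"
  by (auto simp: ctape_def)

text \<open>The mark on cell 0 is the zero test: a counter is positive iff its tape reads the blank.
  Decrementing at the mark stays put, in line with truncated subtraction.\<close>

fun cprog_tapes :: "nat \<Rightarrow> cprog \<Rightarrow> prog" where
  "cprog_tapes b (CInc r) = Act (\<lambda>\<rho>. (stays \<rho>)(b + r := (\<rho> (b + r), Move_Right)))"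
| "cprog_tapes b (CDec r) = Act (\<lambda>\<rho>. (stays \<rho>)(b + r := (\<rho> (b + r), if \<rho> (b + r) = 0 then Move_Left else Stay)))"
| "cprog_tapes b (p ;;; q) = cprog_tapes b p ;; cprog_tapes b q"
| "cprog_tapes b (CWhile r p) = While (\<lambda>\<rho>. \<rho> (b + r) = 0) (cprog_tapes b p)"

lemma wf_cprog_tapes: "b + regs p \<le> T \<Longrightarrow> wf_prog T S (cprog_tapes b p)"
  by (induction p) (auto simp: local_on_def)

definition counters :: "nat \<Rightarrow> nat \<Rightarrow> (nat \<Rightarrow> nat) \<Rightarrow> (nat \<Rightarrow> tape) \<Rightarrow> (nat \<Rightarrow> tape)" where
  "counters b R s \<tau> = (\<lambda>j. if b \<le> j \<and> j < b + R then ctape (s (j - b)) else \<tau> j)"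

lemma exec_cprog_tapes:
  assumes "cexec p s s'" "regs p \<le> R"
  shows "exec (cprog_tapes b p) (counters b R s \<tau>) (counters b R s' \<tau>)"
  using assms
proof (induction rule: cexec.induct)
  case (cexec_Inc r s)
  then show ?case by (auto intro!: exec_Act' simp: counters_def fun_eq_iff)
next
  case (cexec_Dec r s)
  then show ?case by (auto intro!: exec_Act' simp: counters_def fun_eq_iff)
next
  case (cexec_Seq p s s' q s'')
  then show ?case by (auto intro: exec_Seq)
next
  case (cexec_While_end s r p)
  then show ?case by (auto intro!: exec_While_end simp: counters_def)
next
  case (cexec_While_loop s r p s' s'')
  then have "exec (cprog_tapes b p) (counters b R s \<tau>) (counters b R s' \<tau>)"
    "exec (cprog_tapes b (CWhile r p)) (counters b R s' \<tau>) (counters b R s'' \<tau>)"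
    by auto
  moreover have "reads (counters b R s \<tau>) (b + r) = 0"
    using cexec_While_loop by (simp add: counters_def)
  ultimately show ?case by (auto intro: exec_While_loop)
qed

lemma exec_loop:
  assumes "\<And>i. i < m \<Longrightarrow> c (reads (F i))" "\<And>i. i < m \<Longrightarrow> exec p (F i) (F (Suc i))" "\<not> c (reads (F m))"
  shows "exec (While c p) (F 0) (F m)"
proof -
  have "exec (While c p) (F i) (F m)" if "i \<le> m" for i
    using that
    by (induction i rule: inc_induct) (use assms in \<open>auto intro: exec_While_end exec_While_loop\<close>)
  then show ?thesis by blast
qed

section \<open>Running a machine and reading its output into a counter\<close>

text \<open>A tape of an arbitrary machine has no mark on cell 0, so its head can come back only by
  undoing counted moves; the counter \<open>r\<close> supplies their number.\<close>

definition unwind :: "nat \<Rightarrow> nat \<Rightarrow> move \<Rightarrow> prog" where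
  "unwind r t m = While (\<lambda>\<rho>. \<rho> r = 0)
     (Act (\<lambda>\<rho>. (stays \<rho>)(r := (\<rho> r, Move_Left), t := (\<rho> t, m))))"

lemma exec_unwind:
  assumes "r \<noteq> t" "\<tau> r = ctape k" "\<tau> t = (f, p)"
  shows "exec (unwind r t m) \<tau> (\<tau>(r := ctape 0, t := (f, p + int k * offset m)))"
proof -
  let ?F = "\<lambda>i. \<tau>(r := ctape (k - i), t := (f, p + int i * offset m))"
  have "exec (unwind r t m) (?F 0) (?F k)"
    unfolding unwind_def
    by (rule exec_loop)
      (use assms(1) in \<open>auto intro!: exec_Act' simp: fun_eq_iff algebra_simps\<close>)
  moreover have "?F 0 = \<tau>" using assms by (auto simp: fun_eq_iff)
  ultimately show ?thesis by simp
qed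

text \<open>The counter \<open>r\<close> records the number of copied symbols, for the later
  rewinding of tape \<open>t\<close>.\<close>

definition copy_until_sep :: "nat \<Rightarrow> nat \<Rightarrow> prog" where
  "copy_until_sep t r = While (\<lambda>\<rho>. \<rho> 0 \<noteq> 3)
     (Act (\<lambda>\<rho>. (stays \<rho>)(0 := (\<rho> 0, Move_Right), t := (\<rho> 0, Move_Right), r := (\<rho> r, Move_Right))))"

lemma exec_copy_until_sep:
  assumes "r \<noteq> t" "r \<noteq> 0" "t \<noteq> 0" "\<tau> 0 = (c, h)" "\<tau> t = (\<lambda>_. 0, 0)" "\<tau> r = ctape 0"
    and "\<forall>i<length xs. c (h + int i) = xs ! i" "c (h + int (length xs)) = 3" "3 \<notin> set xs"
  shows "exec (copy_until_sep t r) \<tau> (\<tau>(0 := (c, h + int (length xs)),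
    t := (\<lambda>i. if 0 \<le> i \<and> i < int (length xs) then xs ! nat i else 0, int (length xs)), r := ctape (length xs)))"
proof -
  let ?F = "\<lambda>k. \<tau>(0 := (c, h + int k),
    t := (\<lambda>i. if 0 \<le> i \<and> i < int k then xs ! nat i else 0, int k), r := ctape k)"
  have "exec (copy_until_sep t r) (?F 0) (?F (length xs))"
    unfolding copy_until_sep_def
  proof (rule exec_loop)
    fix k assume k: "k < length xs"
    then have x: "c (h + int k) = xs ! k" "xs ! k \<noteq> 3" using assms(7,9) nth_mem by fastforce+
    show "reads (?F k) 0 \<noteq> 3" using assms(2,3) x by simp
    show "exec (Act (\<lambda>\<rho>. (stays \<rho>)(0 := (\<rho> 0, Move_Right), t := (\<rho> 0, Move_Right), r := (\<rho> r, Move_Right))))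
        (?F k) (?F (Suc k))"
      using assms(1-3) x by (intro exec_Act') (auto simp: fun_eq_iff)
  qed (use assms(2,3,8) in simp)
  moreover have "?F 0 = \<tau>" using assms by (auto simp: fun_eq_iff)
  ultimately show ?thesis by simp
qed

text \<open>Tape b of a block holds the state of M as a symbol, the counters b + 1 and b + 2 count the right
  and left moves on the last tape of M, and the tapes of M start at b + 3.\<close>

definition run_act :: "machine \<Rightarrow> nat \<Rightarrow> (nat \<Rightarrow> nat) \<Rightarrow> nat \<Rightarrow> nat \<times> move" where
  "run_act M b \<rho> j =
    (let S = num_symbols M + num_states M;
         (q, acts) = trans M (\<rho> b) (map (\<lambda>i. \<rho> (b + 3 + i)) [0..<num_tapes M]);
         d = snd (acts ! (num_tapes M - 1))
     in if j = b then (if q < S then q else 0, Stay)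
        else if j = b + 1 then (\<rho> j, if d = Move_Right then Move_Right else Stay)
        else if j = b + 2 then (\<rho> j, if d = Move_Left then Move_Right else Stay)
        else if b + 3 \<le> j \<and> j < b + 3 + num_tapes M then
          (let a = acts ! (j - (b + 3)) in (if fst a < S then fst a else 0, snd a))
        else (\<rho> j, Stay))"

definition run_prog :: "machine \<Rightarrow> nat \<Rightarrow> prog" where
  "run_prog M b = While (\<lambda>\<rho>. \<rho> b \<noteq> 1) (Act (run_act M b))"

definition state_tape :: "nat \<Rightarrow> tape" where
  "state_tape q = (\<lambda>i. if i = 0 then q else 0, 0)"

text \<open>Heads may stand on negative cells, so a position is a difference of two counters. Only
  the last tape is tracked, because only its head has to return to cell 0 for the output.\<close>

definition simulates :: "machine \<Rightarrow> nat \<Rightarrow> (nat \<Rightarrow> tape) \<Rightarrow> nat \<Rightarrow> tape list \<Rightarrow> nat \<Rightarrow> nat \<Rightarrow> bool" where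
  "simulates M b \<tau> q ts r l \<longleftrightarrow>
     \<tau> b = state_tape q \<and> \<tau> (b + 1) = ctape r \<and> \<tau> (b + 2) = ctape l \<and>
     length ts = num_tapes M \<and> (\<forall>i<num_tapes M. \<tau> (b + 3 + i) = ts ! i) \<and>
     int r - int l = snd (ts ! (num_tapes M - 1)) \<and> q < num_states M \<and>
     (\<forall>t\<in>set ts. \<forall>i. fst t i < num_symbols M)"

lemma act_fst_less: "(\<forall>i. fst t i < S) \<Longrightarrow> fst a < S \<Longrightarrow> fst (act a t) i < S"
  by (cases a; cases t) auto

lemma snd_act: "snd (act a t) = snd t + offset (snd a)"
  by (cases a; cases t) auto

lemma read_symbol_fst: "read_symbol t = fst t (snd t)"
  by (cases t) auto

lemma exec_run_act:
  assumes M: "turing_machine M" and sim: "simulates M b \<tau> q ts r l" and q: "q \<noteq> 1"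
  shows "\<exists>\<tau>' r' l'. exec (Act (run_act M b)) \<tau> \<tau>' \<and>
    simulates M b \<tau>' (fst (step M (q, ts))) (snd (step M (q, ts))) r' l' \<and>
    (\<forall>j. j < b \<or> j \<ge> b + 3 + num_tapes M \<longrightarrow> \<tau>' j = \<tau> j)"
proof -
  let ?T = "num_tapes M" and ?S = "num_symbols M + num_states M"
  let ?rs = "map read_symbol ts"
  obtain q' acts where tr: "trans M q ?rs = (q', acts)" by fastforce
  have len: "length ts = ?T" and T: "?T \<ge> 1"
    using sim M by (auto simp: simulates_def turing_machine_def)
  have "set ?rs \<subseteq> {..<num_symbols M}"
    using sim by (auto simp: simulates_def read_symbol_fst)
  moreover have "q < num_states M" using sim by (simp add: simulates_def)
  moreover have "\<forall>q rs. q < num_states M \<and> length rs = ?T \<and> set rs \<subseteq> {..<num_symbols M} \<longrightarrow>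
      (case trans M q rs of (q', acts) \<Rightarrow>
         q' < num_states M \<and> length acts = ?T \<and> fst ` set acts \<subseteq> {..<num_symbols M})"
    using M by (simp add: turing_machine_def)
  ultimately have "case trans M q ?rs of (q', acts) \<Rightarrow>
      q' < num_states M \<and> length acts = ?T \<and> fst ` set acts \<subseteq> {..<num_symbols M}"
    using len by (metis (no_types, lifting) length_map)
  then have q': "q' < num_states M" and acts: "length acts = ?T" "fst ` set acts \<subseteq> {..<num_symbols M}"
    by (simp_all add: tr)
  have acts_less: "fst (acts ! i) < num_symbols M" if "i < ?T" for i
    using acts that by (auto simp: subset_iff)
  have st: "step M (q, ts) = (q', map2 act acts ts)" using tr q by (simp add: step.simps)
  define \<tau>' where "\<tau>' = (\<lambda>j. act (run_act M b (reads \<tau>) j) (\<tau> j))"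
  have rd: "map (\<lambda>i. reads \<tau> (b + 3 + i)) [0..<?T] = ?rs"
    using sim len by (intro nth_equalityI) (auto simp: simulates_def)
  have "reads \<tau> b = q" using sim by (simp add: simulates_def state_tape_def)
  then have tr': "trans M (reads \<tau> b) (map (\<lambda>i. reads \<tau> (b + 3 + i)) [0..<?T]) = (q', acts)"
    unfolding rd using tr by simp
  define d where "d = snd (acts ! (?T - 1))"
  \<comment> \<open>The transition of \<open>M\<close> is well formed on a genuine configuration, so
    the clipping of states and symbols in \<open>run_act\<close> has no effect here.\<close>
  have ra: "run_act M b (reads \<tau>) j =
      (if j = b then (q', Stay)
       else if j = b + 1 then (reads \<tau> j, if d = Move_Right then Move_Right else Stay)
       else if j = b + 2 then (reads \<tau> j, if d = Move_Left then Move_Right else Stay)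
       else if b + 3 \<le> j \<and> j < b + 3 + ?T then acts ! (j - (b + 3)) else (reads \<tau> j, Stay))" for j
  proof (cases "b + 3 \<le> j \<and> j < b + 3 + ?T")
    case True
    then have "fst (acts ! (j - (b + 3))) < num_symbols M" by (intro acts_less) linarith
    then show ?thesis
      unfolding run_act_def tr' Let_def prod.case d_def using q' by simp
  next
    case False
    then show ?thesis
      unfolding run_act_def tr' Let_def prod.case d_def using q' by auto
  qed
  have sims: "\<tau> b = state_tape q" "\<tau> (b + 1) = ctape r" "\<tau> (b + 2) = ctape l"
      "\<And>i. i < ?T \<Longrightarrow> \<tau> (b + 3 + i) = ts ! i"
    using sim by (auto simp: simulates_def)
  have b0: "\<tau>' b = state_tape q'"
    unfolding \<tau>'_def ra by (simp add: sims(1) state_tape_def fun_eq_iff)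
  have b1: "\<tau>' (b + 1) = ctape (if d = Move_Right then Suc r else r)"
    unfolding \<tau>'_def ra sims(2) by simp
  have b2: "\<tau>' (b + 2) = ctape (if d = Move_Left then Suc l else l)"
    unfolding \<tau>'_def ra sims(3) by simp
  have b3: "\<tau>' (b + 3 + i) = map2 act acts ts ! i" if "i < ?T" for i
    unfolding \<tau>'_def ra sims(4)[OF that] using that acts len by simp
  have "snd (map2 act acts ts ! (?T - 1)) = snd (ts ! (?T - 1)) + offset d"
    using T acts len by (simp add: d_def snd_act)
  then have dd: "int (if d = Move_Right then Suc r else r) - int (if d = Move_Left then Suc l else l)
      = snd (map2 act acts ts ! (?T - 1))"
    using sim by (cases d) (auto simp: simulates_def)
  have sym: "\<forall>t\<in>set (map2 act acts ts). \<forall>i. fst t i < num_symbols M"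
  proof (intro ballI allI)
    fix t i assume "t \<in> set (map2 act acts ts)"
    then obtain j where j: "j < ?T" "t = act (acts ! j) (ts ! j)"
      using acts len by (auto simp: in_set_conv_nth)
    then show "fst t i < num_symbols M"
      using sim acts_less[of j] len by (auto simp: simulates_def intro!: act_fst_less)
  qed
  have "simulates M b \<tau>' q' (map2 act acts ts) (if d = Move_Right then Suc r else r) (if d = Move_Left then Suc l else l)"
    unfolding simulates_def using b0 b1 b2 b3 dd sym q' acts len by simp
  moreover have "\<forall>j. j < b \<or> j \<ge> b + 3 + ?T \<longrightarrow> \<tau>' j = \<tau> j"
    by (auto simp: \<tau>'_def ra)
  ultimately show ?thesis unfolding st using exec_Act[of "run_act M b" \<tau>] \<tau>'_def by auto
qed

lemma step_halted: "(step M ^^ k) (1, ts) = (1, ts)"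
  by (induction k) (auto simp: step.simps)

lemma exec_run_prog:
  assumes M: "turing_machine M" and sim: "simulates M b \<tau> q ts r l"
    and "(step M ^^ k) (q, ts) = (1, ts')"
  shows "\<exists>\<tau>' r' l'. exec (run_prog M b) \<tau> \<tau>' \<and> simulates M b \<tau>' 1 ts' r' l' \<and>
    (\<forall>j. j < b \<or> j \<ge> b + 3 + num_tapes M \<longrightarrow> \<tau>' j = \<tau> j)"
  using assms(2,3)
proof (induction k arbitrary: \<tau> q ts r l)
  case 0
  then show ?case
    by (auto intro!: exI[of _ \<tau>] exec_While_end simp: run_prog_def simulates_def state_tape_def)
next
  case (Suc k)
  show ?case
  proof (cases "q = 1")
    \<comment> \<open>A halting configuration is a fixed point of \<open>step\<close>, so the loop
      may end before \<open>k\<close> steps are used up.\<close>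
    case True
    then have "ts' = ts" using Suc.prems step_halted[of "Suc k" M ts] by simp
    then show ?thesis using True Suc.prems
      by (auto intro!: exI[of _ \<tau>] exec_While_end simp: run_prog_def simulates_def state_tape_def)
  next
    case False
    obtain q1 ts1 where st: "step M (q, ts) = (q1, ts1)" by fastforce
    obtain \<tau>1 r1 l1 where 1: "exec (Act (run_act M b)) \<tau> \<tau>1" "simulates M b \<tau>1 q1 ts1 r1 l1"
        "\<forall>j. j < b \<or> j \<ge> b + 3 + num_tapes M \<longrightarrow> \<tau>1 j = \<tau> j"
      using exec_run_act[OF M Suc.prems(1) False] st by auto
    have "(step M ^^ k) (q1, ts1) = (1, ts')"
      using Suc.prems(2) st by (simp add: funpow_Suc_right del: funpow.simps)
    then obtain \<tau>2 r2 l2 where 2: "exec (run_prog M b) \<tau>1 \<tau>2" "simulates M b \<tau>2 1 ts' r2 l2"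
        "\<forall>j. j < b \<or> j \<ge> b + 3 + num_tapes M \<longrightarrow> \<tau>2 j = \<tau>1 j"
      using Suc.IH[OF 1(2)] by blast
    have "reads \<tau> b \<noteq> 1" using Suc.prems(1) False by (simp add: simulates_def state_tape_def)
    then have "exec (run_prog M b) \<tau> \<tau>2"
      using exec_While_loop[of "\<lambda>\<rho>. \<rho> b \<noteq> 1", OF _ 1(1)] 2(1) by (simp add: run_prog_def)
    then show ?thesis using 1(3) 2 by (intro exI[of _ \<tau>2] exI[of _ r2] exI[of _ l2]) auto
  qed
qed

text \<open>The counter a accumulates the value of the bits read so far, and p holds the current power of two.\<close>

definition add_power :: "nat \<Rightarrow> nat \<Rightarrow> nat \<Rightarrow> nat \<Rightarrow> prog" where
  "add_power t a p x = While (\<lambda>\<rho>. \<rho> p = 0) (Act (\<lambda>\<rho>. (stays \<rho>)(p := (\<rho> p, Move_Left), x := (\<rho> x, Move_Right),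
     a := (\<rho> a, if \<rho> t = 2 then Move_Right else Stay))))"

text \<open>The addition has just moved the power of two from \<open>p\<close> to \<open>x\<close>;
  moving it back with two increments per decrement doubles it.\<close>

definition double_power :: "nat \<Rightarrow> nat \<Rightarrow> prog" where
  "double_power p x = While (\<lambda>\<rho>. \<rho> x = 0)
     (Act (\<lambda>\<rho>. (stays \<rho>)(x := (\<rho> x, Move_Left), p := (\<rho> p, Move_Right))) ;;
      Act (\<lambda>\<rho>. (stays \<rho>)(p := (\<rho> p, Move_Right))))"

definition read_bits :: "nat \<Rightarrow> nat \<Rightarrow> nat \<Rightarrow> nat \<Rightarrow> prog" where
  "read_bits t a p x = While (\<lambda>\<rho>. \<rho> t \<noteq> 0)
     (add_power t a p x ;; double_power p x ;; Act (\<lambda>\<rho>. (stays \<rho>)(t := (\<rho> t, Move_Right))))"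

lemma exec_add_power:
  assumes "distinct [t, a, p, x]" "\<tau> p = ctape k" "\<tau> x = ctape 0" "\<tau> a = ctape n"
  shows "exec (add_power t a p x) \<tau>
    (\<tau>(p := ctape 0, x := ctape k, a := ctape (if read_symbol (\<tau> t) = 2 then n + k else n)))"
proof -
  let ?F = "\<lambda>i. \<tau>(p := ctape (k - i), x := ctape i, a := ctape (if read_symbol (\<tau> t) = 2 then n + i else n))"
  have "exec (add_power t a p x) (?F 0) (?F k)"
    unfolding add_power_def
    by (rule exec_loop) (use assms(1) in \<open>auto intro!: exec_Act' simp: fun_eq_iff\<close>)
  moreover have "?F 0 = \<tau>" using assms by (auto simp: fun_eq_iff)
  ultimately show ?thesis by simp
qed

lemma exec_double_power:
  assumes "x \<noteq> p" "\<tau> p = ctape 0" "\<tau> x = ctape m"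
  shows "exec (double_power p x) \<tau> (\<tau>(p := ctape (2 * m), x := ctape 0))"
proof -
  let ?F = "\<lambda>i. \<tau>(p := ctape (2 * i), x := ctape (m - i))"
  have "exec (double_power p x) (?F 0) (?F m)"
    unfolding double_power_def
  proof (rule exec_loop)
    fix i assume "i < m"
    then show "exec (Act (\<lambda>\<rho>. (stays \<rho>)(x := (\<rho> x, Move_Left), p := (\<rho> p, Move_Right))) ;;
        Act (\<lambda>\<rho>. (stays \<rho>)(p := (\<rho> p, Move_Right)))) (?F i) (?F (Suc i))"
      using assms(1)
      by (intro exec_Seq[of _ _ "\<tau>(p := ctape (2 * i + 1), x := ctape (m - Suc i))"] exec_Act')
        (auto simp: fun_eq_iff)
  qed (use assms(1) in auto)
  moreover have "?F 0 = \<tau>" using assms by (auto simp: fun_eq_iff)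
  ultimately show ?thesis by simp
qed

lemma exec_read_bits:
  assumes "distinct [t, a, p, x]" "\<tau> t = (c, h)" "\<tau> a = ctape 0" "\<tau> p = ctape 1" "\<tau> x = ctape 0"
    and "\<forall>i<length w. c (h + int i) = bit_symbol (w ! i)" "c (h + int (length w)) = 0"
  shows "exec (read_bits t a p x) \<tau>
    (\<tau>(t := (c, h + int (length w)), a := ctape (horner_sum of_bool 2 w), p := ctape (2 ^ length w)))"
proof -
  let ?h = "\<lambda>i. horner_sum of_bool 2 (take i w) :: nat"
  let ?F = "\<lambda>i. \<tau>(t := (c, h + int i), a := ctape (?h i), p := ctape (2 ^ i))"
  have "exec (read_bits t a p x) (?F 0) (?F (length w))"
    unfolding read_bits_def
  proof (rule exec_loop)
    fix i assume i: "i < length w"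
    then have y: "c (h + int i) = bit_symbol (w ! i)" using assms(6) by simp
    show "reads (?F i) t \<noteq> 0" using assms(1) y by (simp add: bit_symbol_def)
    let ?G = "(?F i)(p := ctape 0, x := ctape (2 ^ i), a := ctape (?h (Suc i)))"
    \<comment> \<open>The least significant bit comes first, so the bit at position \<open>i\<close>
      contributes \<open>2 ^ i\<close>, the present value of \<open>p\<close>.\<close>
    have "(if read_symbol (?F i t) = 2 then ?h i + 2 ^ i else ?h i) = ?h (Suc i)"
      using assms(1) i y by (simp add: take_Suc_conv_app_nth horner_sum_append bit_symbol_def)
    then have 1: "exec (add_power t a p x) (?F i) ?G"
      using exec_add_power[OF assms(1), of "?F i" "2 ^ i" "?h i"] assms(1,5) by simp
    have 2: "exec (double_power p x) ?G (?G(p := ctape (2 * 2 ^ i), x := ctape 0))"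
      using assms(1) by (intro exec_double_power) auto
    have "exec (Act (\<lambda>\<rho>. (stays \<rho>)(t := (\<rho> t, Move_Right)))) (?G(p := ctape (2 * 2 ^ i), x := ctape 0)) (?F (Suc i))"
      using assms(1,5) by (intro exec_Act') (auto simp: fun_eq_iff)
    then show "exec (add_power t a p x ;; double_power p x ;; Act (\<lambda>\<rho>. (stays \<rho>)(t := (\<rho> t, Move_Right))))
        (?F i) (?F (Suc i))"
      by (rule exec_Seq[OF 1 exec_Seq[OF 2]])
  qed (use assms(1,7) in simp)
  moreover have "?F 0 = \<tau>" using assms by (auto simp: fun_eq_iff)
  ultimately show ?thesis by simp
qed

text \<open>Undoing the right moves and then the left moves of the last tape brings its head to cell
  0, where the output begins. The separator is written behind the copied word because the input
  format of \<open>M\<close> asks for it, and head 0 is left on the next input word.\<close>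

definition block_prog :: "machine \<Rightarrow> nat \<Rightarrow> nat \<Rightarrow> nat \<Rightarrow> nat \<Rightarrow> prog" where
  "block_prog M b a p x =
     copy_until_sep (b + 3) (b + 1) ;;
     Act (\<lambda>\<rho>. (stays \<rho>)(0 := (\<rho> 0, Move_Right), b + 3 := (3, Stay))) ;;
     unwind (b + 1) (b + 3) Move_Left ;;
     run_prog M b ;;
     unwind (b + 1) (b + 2 + num_tapes M) Move_Left ;;
     unwind (b + 2) (b + 2 + num_tapes M) Move_Right ;;
     read_bits (b + 2 + num_tapes M) a p x"

text \<open>The counter \<open>p\<close> ends at some power of two, left unspecified, so it has to
  be reset to 1 before a second block can use it; \<open>x\<close> returns to 0 by itself.\<close>

lemma exec_block_prog:
  assumes M: "turing_machine M" and halts: "halts_with M [u] w"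
    and b: "b > 0" and out: "distinct [a, p, x]" "0 < a" "0 < p" "0 < x"
      "\<And>j. j \<in> {a, p, x} \<Longrightarrow> j < b \<or> j \<ge> b + 3 + num_tapes M"
    and \<tau>: "\<tau> 0 = (c, h)" "\<forall>i<length u. c (h + int i) = bit_symbol (u ! i)" "c (h + int (length u)) = 3"
      "\<tau> b = blank_tape" "\<tau> (b + 1) = ctape 0" "\<tau> (b + 2) = ctape 0"
      "\<forall>i<num_tapes M. \<tau> (b + 3 + i) = blank_tape"
      "\<tau> a = ctape 0" "\<tau> p = ctape 1" "\<tau> x = ctape 0"
  shows "\<exists>\<tau>'. exec (block_prog M b a p x) \<tau> \<tau>' \<and> \<tau>' 0 = (c, h + int (length u) + 1) \<and>
    \<tau>' a = ctape (horner_sum of_bool 2 w) \<and> (\<exists>v. \<tau>' p = ctape v) \<and> \<tau>' x = ctape 0 \<and>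
    (\<forall>j. j \<notin> {0, a, p, x} \<and> (j < b \<or> j \<ge> b + 3 + num_tapes M) \<longrightarrow> \<tau>' j = \<tau> j)"
proof -
  let ?T = "num_tapes M"
  have T: "?T \<ge> 1" and S: "num_symbols M \<ge> 4" and Q: "num_states M \<ge> 2"
    using M by (auto simp: turing_machine_def)
  let ?xs = "map bit_symbol u"
  have xs: "3 \<notin> set ?xs" by (auto simp: bit_symbol_def)
  have b3: "\<tau> (b + 3) = (\<lambda>_. 0, 0)" using \<tau>(7) T by (auto simp: blank_tape_def dest: spec[of _ 0])
  define f where "f = (\<lambda>i::int. if 0 \<le> i \<and> i < int (length ?xs) then ?xs ! nat i else 0)"
  define \<tau>1 where "\<tau>1 = \<tau>(0 := (c, h + int (length u)), b + 3 := (f, int (length u)), b + 1 := ctape (length u))"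
  have 1: "exec (copy_until_sep (b + 3) (b + 1)) \<tau> \<tau>1"
    using exec_copy_until_sep[of "b + 1" "b + 3" \<tau> c h ?xs] \<tau> b b3 xs
    by (simp add: \<tau>1_def f_def)
  define \<tau>2 where "\<tau>2 = \<tau>1(0 := (c, h + int (length u) + 1), b + 3 := (f(int (length u) := 3), int (length u)))"
  have 2: "exec (Act (\<lambda>\<rho>. (stays \<rho>)(0 := (\<rho> 0, Move_Right), b + 3 := (3, Stay)))) \<tau>1 \<tau>2"
    using b by (intro exec_Act') (auto simp: \<tau>1_def \<tau>2_def fun_eq_iff)
  define \<tau>3 where "\<tau>3 = \<tau>2(b + 1 := ctape 0, b + 3 := (f(int (length u) := 3), 0))"
  have 3: "exec (unwind (b + 1) (b + 3) Move_Left) \<tau>2 \<tau>3"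
    using exec_unwind[of "b + 1" "b + 3" \<tau>2 "length u" "f(int (length u) := 3)" "int (length u)" Move_Left]
    by (simp add: \<tau>1_def \<tau>2_def \<tau>3_def)
  have inp: "input_symbols [u] = ?xs @ [3]" by (simp add: input_symbols_def)
  have f3: "f(int (length u) := 3) = (\<lambda>i. if 0 \<le> i \<and> i < int (length (?xs @ [3])) then (?xs @ [3]) ! nat i else 0)"
    by (auto simp: fun_eq_iff f_def nth_append)
  obtain k ts where k: "(step M ^^ k) (initial_config M [u]) = (1, ts)" and o: "output_on (last ts) w"
    using halts by (auto simp: halts_with_def)
  define ts0 where "ts0 = input_tape (?xs @ [3]) # replicate (?T - 1) blank_tape"
  have ts0: "initial_config M [u] = (0, ts0)" by (simp add: initial_config_def inp ts0_def)
  have "simulates M b \<tau>3 0 ts0 0 0"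
    unfolding simulates_def
  proof (intro conjI)
    show "\<tau>3 b = state_tape 0"
      using \<tau>(4) b by (simp add: \<tau>1_def \<tau>2_def \<tau>3_def state_tape_def blank_tape_def)
    show "\<forall>i<?T. \<tau>3 (b + 3 + i) = ts0 ! i"
    proof (intro allI impI)
      fix i assume "i < ?T"
      then show "\<tau>3 (b + 3 + i) = ts0 ! i"
        using \<tau>(7) f3 b by (cases i) (auto simp: \<tau>1_def \<tau>2_def \<tau>3_def ts0_def input_tape_def)
    qed
    show "int 0 - int 0 = snd (ts0 ! (?T - 1))"
      by (cases "?T - 1") (simp_all add: ts0_def input_tape_def blank_tape_def nth_Cons')
    have "\<forall>y\<in>set (?xs @ [3]). y < num_symbols M" using S by (auto simp: bit_symbol_def)
    then have "(?xs @ [3]) ! nat i < num_symbols M" if "0 \<le> i" "i < int (length (?xs @ [3]))" for i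
      using nth_mem[of "nat i" "?xs @ [3]"] that zless_nat_conj nat_less_iff by metis
    then have "fst (input_tape (?xs @ [3])) i < num_symbols M" for i
      using S by (simp add: input_tape_def del: length_append)
    then show "\<forall>t\<in>set ts0. \<forall>i. fst t i < num_symbols M"
      using S by (auto simp: ts0_def blank_tape_def)
  qed (use \<tau> T b Q in \<open>auto simp: \<tau>1_def \<tau>2_def \<tau>3_def ts0_def\<close>)
  from exec_run_prog[OF M this k[unfolded ts0]]
  obtain \<tau>4 r l where 4: "exec (run_prog M b) \<tau>3 \<tau>4" and sim: "simulates M b \<tau>4 1 ts r l"
    and keep: "\<forall>j. j < b \<or> j \<ge> b + 3 + ?T \<longrightarrow> \<tau>4 j = \<tau>3 j" by blast
  have len: "length ts = ?T" using sim by (simp add: simulates_def)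
  define L where "L = b + 2 + ?T"
  obtain g e where ge: "last ts = (g, e)" by fastforce
  have ne: "ts \<noteq> []" using len T by auto
  have "\<tau>4 (b + 3 + (?T - 1)) = ts ! (?T - 1)"
    using T by (intro sim[unfolded simulates_def, THEN conjunct2, THEN conjunct2, THEN conjunct2, THEN conjunct2,
      THEN conjunct1, rule_format]) simp
  moreover have "b + 3 + (?T - 1) = L" using T by (simp add: L_def)
  moreover have "ts ! (?T - 1) = (g, e)" using ge ne len by (simp add: last_conv_nth)
  ultimately have L: "\<tau>4 L = (g, e)" by simp
  have e: "e = int r - int l" using sim ge len ne by (simp add: simulates_def last_conv_nth)
  define \<tau>5 where "\<tau>5 = \<tau>4(b + 1 := ctape 0, L := (g, - int l))"
  have cnt: "\<tau>4 (b + 1) = ctape r" "\<tau>4 (b + 2) = ctape l"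
    using sim by (simp_all add: simulates_def)
  have 5: "exec (unwind (b + 1) L Move_Left) \<tau>4 \<tau>5"
    using exec_unwind[of "b + 1" L \<tau>4 r g e Move_Left] L cnt T by (simp add: \<tau>5_def e L_def)
  define \<tau>6 where "\<tau>6 = \<tau>5(b + 2 := ctape 0, L := (g, 0))"
  have 6: "exec (unwind (b + 2) L Move_Right) \<tau>5 \<tau>6"
    using exec_unwind[of "b + 2" L \<tau>5 l g "- int l" Move_Right] cnt T
    by (simp add: \<tau>5_def \<tau>6_def L_def)
  have outside: "\<tau>6 j = \<tau> j" if "j < b \<or> j \<ge> b + 3 + ?T" "j \<noteq> 0" for j
    using that keep T by (auto simp: \<tau>6_def \<tau>5_def \<tau>3_def \<tau>2_def \<tau>1_def L_def)
  have 60: "\<tau>6 0 = (c, h + int (length u) + 1)"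
    using keep b T by (simp add: \<tau>6_def \<tau>5_def \<tau>3_def \<tau>2_def \<tau>1_def L_def)
  have a6: "\<tau>6 a = ctape 0" "\<tau>6 p = ctape 1" "\<tau>6 x = ctape 0"
    using outside[of a] outside[of p] outside[of x] out \<tau> by auto
  have Lne: "L \<noteq> a" "L \<noteq> p" "L \<noteq> x" "L \<noteq> 0" using out(5)[of a] out(5)[of p] out(5)[of x] T by (auto simp: L_def)
  define \<tau>7 where "\<tau>7 = \<tau>6(L := (g, int (length w)), a := ctape (horner_sum of_bool 2 w), p := ctape (2 ^ length w))"
  have 7: "exec (read_bits L a p x) \<tau>6 \<tau>7"
    using exec_read_bits[of L a p x \<tau>6 g 0 w] Lne out(1) a6 o ge
    by (simp add: \<tau>7_def \<tau>6_def output_on_def)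
  have "exec (block_prog M b a p x) \<tau> \<tau>7"
    unfolding block_prog_def L_def[symmetric]
    by (rule exec_Seq[OF 1 exec_Seq[OF 2 exec_Seq[OF 3 exec_Seq[OF 4 exec_Seq[OF 5 exec_Seq[OF 6 7]]]]]])
  moreover have "\<tau>7 0 = (c, h + int (length u) + 1)" using 60 Lne out by (simp add: \<tau>7_def)
  moreover have "\<tau>7 a = ctape (horner_sum of_bool 2 w)" "\<exists>v. \<tau>7 p = ctape v" "\<tau>7 x = ctape 0"
    using out(1) a6 Lne by (auto simp: \<tau>7_def)
  moreover have "\<forall>j. j \<notin> {0, a, p, x} \<and> (j < b \<or> j \<ge> b + 3 + ?T) \<longrightarrow> \<tau>7 j = \<tau> j"
    using outside T by (auto simp: \<tau>7_def L_def)
  ultimately show ?thesis by blast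
qed

section \<open>The machine that runs \<open>M\<close> twice and then a primitive recursive
  test\<close>

lemma local_onI: "(\<And>\<rho> \<rho>'. (\<And>j. j < T \<Longrightarrow> \<rho> j = \<rho>' j) \<Longrightarrow> c \<rho> = c \<rho>') \<Longrightarrow> local_on T c"
  unfolding local_on_def by blast

lemma wf_unwind: "r < T \<Longrightarrow> t < T \<Longrightarrow> wf_prog T S (unwind r t m)"
  unfolding unwind_def wf_prog.simps by (intro conjI allI impI local_onI) simp_all

lemma wf_copy_until_sep: "0 < T \<Longrightarrow> r < T \<Longrightarrow> t < T \<Longrightarrow> wf_prog T S (copy_until_sep t r)"
  unfolding copy_until_sep_def wf_prog.simps by (intro conjI allI impI local_onI) simp_all

lemma wf_read_bits: "t < T \<Longrightarrow> a < T \<Longrightarrow> p < T \<Longrightarrow> x < T \<Longrightarrow> wf_prog T S (read_bits t a p x)"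
  unfolding read_bits_def add_power_def double_power_def wf_prog.simps
  by (intro conjI allI impI local_onI) simp_all

lemma wf_block_prog:
  assumes "turing_machine M" "b + 3 + num_tapes M \<le> T" "a < T" "p < T" "x < T"
    "num_symbols M + num_states M = S"
  shows "wf_prog T S (block_prog M b a p x)"
proof -
  have S: "S \<ge> 4" and T0: "num_tapes M \<ge> 1" using assms by (auto simp: turing_machine_def)
  have "local_on T (\<lambda>\<rho>. run_act M b \<rho> j)" if "j < T" for j
    unfolding local_on_def
  proof (intro allI impI)
    fix \<rho> \<rho>' :: "nat \<Rightarrow> nat" assume "\<forall>j<T. \<rho> j = \<rho>' j"
    then have "map (\<lambda>i. \<rho> (b + 3 + i)) [0..<num_tapes M] = map (\<lambda>i. \<rho>' (b + 3 + i)) [0..<num_tapes M]"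
      "\<rho> b = \<rho>' b" "\<rho> j = \<rho>' j"
      using assms(2) that by auto
    then show "run_act M b \<rho> j = run_act M b \<rho>' j" unfolding run_act_def by (simp only:)
  qed
  \<comment> \<open>Here the clipping in \<open>run_act\<close> matters: tape \<open>b\<close> may
    show a symbol that is not a state of \<open>M\<close>, and nothing is known about
    \<open>trans M\<close> there.\<close>
  moreover have "fst (run_act M b \<rho> j) < S" if "\<forall>j<T. \<rho> j < S" "j < T" for \<rho> j
    using that S unfolding run_act_def assms(6) by (auto simp: Let_def split: prod.split)
  moreover have "local_on T (\<lambda>\<rho>. \<rho> b \<noteq> 1)" using assms(2) by (intro local_onI) simp
  ultimately have run: "wf_prog T S (run_prog M b)" by (simp add: run_prog_def)
  have sep: "wf_prog T S (Act (\<lambda>\<rho>. (stays \<rho>)(0 := (\<rho> 0, Move_Right), b + 3 := (3, Stay))))"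
    unfolding wf_prog.simps using assms(2) S by (intro conjI allI impI local_onI) simp_all
  show ?thesis
    unfolding block_prog_def wf_prog.simps(2)
    by (intro conjI wf_unwind wf_copy_until_sep wf_read_bits run sep) (use assms(2-5) T0 in linarith)+
qed

text \<open>Each input word gets its own block of tapes with a copy of \<open>M\<close>, since the
  first run leaves its tapes in an unknown state. The two outputs become the first two counters of
  the program that computes \<open>d\<close>.\<close>

theorem machine_for_PR:
  assumes M: "turing_machine M" and d: "PR (\<lambda>\<sigma>. d (\<sigma> 0) (\<sigma> 1))"
  obtains M' where "turing_machine M'"
    "\<And>u v wu wv. halts_with M [u] wu \<Longrightarrow> halts_with M [v] wv \<Longrightarrow>
       halts_with M' [u, v] [d (horner_sum of_bool 2 wu) (horner_sum of_bool 2 wv) \<noteq> 0]"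
proof -
  let ?T = "num_tapes M" and ?S = "num_symbols M + num_states M"
  \<comment> \<open>Environments are infinite, but \<open>d\<close> looks only at components 0 and
    1, so all other variables may share register 0.\<close>
  have "(if i = 1 then 1 else 0 :: nat) < 2" for i :: nat by simp
  from PR_cprog[OF d, of "\<lambda>i. if i = 1 then 1 else 0", OF this]
  have "\<exists>p. \<forall>s. \<exists>s'. cexec p s s' \<and> s' 2 = d (s 0) (s 1) \<and> (\<forall>i<2. s' i = s i)" by simp
  then obtain cp where cp: "\<And>s. \<exists>s'. cexec cp s s' \<and> s' 2 = d (s 0) (s 1)" by blast
  \<comment> \<open>Four counters are needed by the blocks: two outputs, the power of two and its
    scratch counter. The result of \<open>cp\<close> later appears in counter 2.\<close>
  define R where "R = max 4 (regs cp)"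
  define b1 b2 k where "b1 = 1" and "b2 = b1 + 3 + ?T" and "k = b2 + 3 + ?T"
  define T where "T = k + R + 1"
  \<comment> \<open>All tapes that serve as counters, including the move counters of both blocks;
    they are blank at the start and first receive their mark.\<close>
  define K where "K = {b1 + 1, b1 + 2, b2 + 1, b2 + 2} \<union> {k..<k + R}"
  define p where "p =
    Act (\<lambda>\<rho> j. if j \<in> K then (1, Stay) else (\<rho> j, Stay)) ;;
    cprog_tapes k (CInc 2) ;;
    block_prog M b1 k (k + 2) (k + 3) ;;
    cprog_tapes k (cclear 2 ;;; CInc 2) ;;
    block_prog M b2 (k + 1) (k + 2) (k + 3) ;;
    cprog_tapes k cp ;;
    Act (\<lambda>\<rho>. (stays \<rho>)(k + R := (if \<rho> (k + 2) = 0 then 2 else 1, Stay)))"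
  have R: "R \<ge> 4" "regs cp \<le> R" by (auto simp: R_def)
  have S: "?S \<ge> 4" using M by (auto simp: turing_machine_def)
  have wf_c: "wf_prog T ?S (cprog_tapes k c)" if "regs c \<le> R" for c
    using that by (intro wf_cprog_tapes) (simp add: T_def)
  have wf: "wf_prog T ?S p"
    unfolding p_def wf_prog.simps(2)
  proof (intro conjI)
    show "wf_prog T ?S (Act (\<lambda>\<rho> j. if j \<in> K then (1, Stay) else (\<rho> j, Stay)))"
      unfolding wf_prog.simps using S by (intro conjI allI impI local_onI) simp_all
    show "wf_prog T ?S (Act (\<lambda>\<rho>. (stays \<rho>)(k + R := (if \<rho> (k + 2) = 0 then 2 else 1, Stay))))"
      unfolding wf_prog.simps using S R by (intro conjI allI impI local_onI) (simp_all add: T_def)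
    show "wf_prog T ?S (cprog_tapes k (CInc 2))" "wf_prog T ?S (cprog_tapes k (cclear 2 ;;; CInc 2))"
      "wf_prog T ?S (cprog_tapes k cp)"
      using R by (auto intro!: wf_c simp: cclear_def simp del: cprog_tapes.simps)
    show "wf_prog T ?S (block_prog M b1 k (k + 2) (k + 3))"
      "wf_prog T ?S (block_prog M b2 (k + 1) (k + 2) (k + 3))"
      using R by (auto intro!: wf_block_prog M simp: T_def k_def b2_def)
  qed
  obtain M' where M': "turing_machine M'" "num_tapes M' = T"
    "\<And>\<tau> \<tau>'. exec p \<tau> \<tau>' \<Longrightarrow> \<exists>k. (step M' ^^ k) (0, tapes T \<tau>) = (1, tapes T \<tau>')"
    using prog_machine[OF wf] S by (auto simp: T_def)
  have "halts_with M' [u, v] [d (horner_sum of_bool 2 wu) (horner_sum of_bool 2 wv) \<noteq> 0]"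
    if hu: "halts_with M [u] wu" and hv: "halts_with M [v] wv" for u v wu wv
  proof -
    let ?a = "horner_sum of_bool 2 wu :: nat" and ?b = "horner_sum of_bool 2 wv :: nat"
    define xs where "xs = input_symbols [u, v]"
    have xs: "xs = map bit_symbol u @ 3 # map bit_symbol v @ [3]"
      by (simp add: xs_def input_symbols_def)
    define c where "c = (\<lambda>i::int. if 0 \<le> i \<and> i < int (length xs) then xs ! nat i else 0)"
    define \<tau>0 where "\<tau>0 = (\<lambda>j::nat. if j = 0 then (c, 0) else blank_tape)"
    have init: "initial_config M' [u, v] = (0, tapes T \<tau>0)"
      unfolding initial_config_def M'(2) xs_def[symmetric]
      by (auto simp: \<tau>0_def input_tape_def c_def T_def list_eq_iff_nth_eq nth_Cons' simp del: upt_Suc)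
    define \<tau>1 where "\<tau>1 = (\<lambda>j. if j \<in> K then ctape 0 else \<tau>0 j)"
    have 0: "0 \<notin> K" by (auto simp: K_def b1_def b2_def k_def)
    have e1: "exec (Act (\<lambda>\<rho> j. if j \<in> K then (1, Stay) else (\<rho> j, Stay))) \<tau>0 \<tau>1"
      using 0 by (intro exec_Act') (auto simp: fun_eq_iff \<tau>1_def \<tau>0_def ctape_def blank_tape_def)
    have "\<tau>1 = counters k R (\<lambda>_. 0) \<tau>1" by (auto simp: counters_def fun_eq_iff \<tau>1_def K_def)
    then have e2: "exec (cprog_tapes k (CInc 2)) \<tau>1 (counters k R ((\<lambda>_. 0)(2 := 1)) \<tau>1)"
      using exec_cprog_tapes[OF cexec_Inc, of 2 R k "\<lambda>_. 0" \<tau>1] R by simp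
    define \<tau>2 where "\<tau>2 = counters k R ((\<lambda>_. 0)(2 := 1)) \<tau>1"
    have nK: "b1 \<notin> K" "b2 \<notin> K" "\<forall>i<?T. b1 + 3 + i \<notin> K \<and> b2 + 3 + i \<notin> K"
      by (auto simp: K_def b1_def b2_def k_def)
    have pos: "0 < b1" "b1 < b2" "b2 < k" by (auto simp: b1_def b2_def k_def)
    have t2: "\<tau>2 0 = (c, 0)" "\<tau>2 b1 = blank_tape" "\<tau>2 (b1 + 1) = ctape 0" "\<tau>2 (b1 + 2) = ctape 0"
        "\<forall>i<?T. \<tau>2 (b1 + 3 + i) = blank_tape" "\<tau>2 k = ctape 0" "\<tau>2 (k + 2) = ctape 1" "\<tau>2 (k + 3) = ctape 0"
        "\<tau>2 b2 = blank_tape" "\<tau>2 (b2 + 1) = ctape 0" "\<tau>2 (b2 + 2) = ctape 0"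
        "\<forall>i<?T. \<tau>2 (b2 + 3 + i) = blank_tape"
      using 0 nK pos R by (auto simp: \<tau>2_def counters_def \<tau>1_def \<tau>0_def K_def k_def b2_def)
    have cu: "\<forall>i<length u. c (0 + int i) = bit_symbol (u ! i)" "c (0 + int (length u)) = 3"
      by (auto simp: c_def xs nth_append)
    have "\<exists>\<tau>'. exec (block_prog M b1 k (k + 2) (k + 3)) \<tau>2 \<tau>' \<and> \<tau>' 0 = (c, 0 + int (length u) + 1) \<and>
      \<tau>' k = ctape ?a \<and> (\<exists>v. \<tau>' (k + 2) = ctape v) \<and> \<tau>' (k + 3) = ctape 0 \<and>
      (\<forall>j. j \<notin> {0, k, k + 2, k + 3} \<and> (j < b1 \<or> j \<ge> b1 + 3 + ?T) \<longrightarrow> \<tau>' j = \<tau>2 j)"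
      by (rule exec_block_prog[OF M hu]) (use t2 cu pos in \<open>auto simp: k_def b2_def\<close>)
    then obtain \<tau>3 y where e3: "exec (block_prog M b1 k (k + 2) (k + 3)) \<tau>2 \<tau>3"
      and t3: "\<tau>3 0 = (c, int (length u) + 1)" "\<tau>3 k = ctape ?a" "\<tau>3 (k + 2) = ctape y" "\<tau>3 (k + 3) = ctape 0"
      and keep3: "\<And>j. j \<notin> {0, k, k + 2, k + 3} \<Longrightarrow> j \<ge> b2 \<Longrightarrow> \<tau>3 j = \<tau>2 j"
      unfolding b2_def by auto
    \<comment> \<open>Another counter program can run only if every tape in its range is a counter,
      even the ones whose values are unknown.\<close>
    have "\<forall>j. k \<le> j \<and> j < k + R \<longrightarrow> (\<exists>v. \<tau>3 j = ctape v)"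
    proof (intro allI impI)
      fix j assume j: "k \<le> j \<and> j < k + R"
      show "\<exists>v. \<tau>3 j = ctape v"
      proof (cases "j \<in> {k, k + 2, k + 3}")
        case False
        then have "\<tau>3 j = \<tau>2 j" using j keep3 pos by auto
        then show ?thesis using j by (auto simp: \<tau>2_def counters_def)
      qed (use t3 in auto)
    qed
    then obtain s where s: "\<And>j. k \<le> j \<Longrightarrow> j < k + R \<Longrightarrow> \<tau>3 j = ctape (s j)" by metis
    have c3: "\<tau>3 = counters k R (\<lambda>i. s (k + i)) \<tau>3" using s by (auto simp: counters_def fun_eq_iff)
    define \<tau>4 where "\<tau>4 = counters k R ((\<lambda>i. s (k + i))(2 := 1)) \<tau>3"
    have "cexec (cclear 2 ;;; CInc 2) (\<lambda>i. s (k + i)) ((\<lambda>i. s (k + i))(2 := 1))"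
      using cexec_Seq[OF cexec_clear[of 2 "\<lambda>i. s (k + i)"] cexec_Inc[of 2]] by simp
    from exec_cprog_tapes[OF this, of R k \<tau>3]
    have e4: "exec (cprog_tapes k (cclear 2 ;;; CInc 2)) \<tau>3 \<tau>4"
      using R c3 by (simp add: \<tau>4_def cclear_def)
    have t4: "\<tau>4 j = \<tau>3 j" if "j \<noteq> k + 2" for j
      using that s by (auto simp: \<tau>4_def counters_def)
    have t42: "\<tau>4 (k + 2) = ctape 1" using R by (simp add: \<tau>4_def counters_def)
    have t4': "\<tau>4 (k + 1) = ctape 0"
      using t4[of "k + 1"] keep3[of "k + 1"] pos R by (simp add: \<tau>2_def counters_def)
    have t4b: "\<tau>4 j = \<tau>2 j" if "b2 \<le> j" "j < k" for j
      using t4[of j] keep3[of j] that pos by auto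
    have cv: "\<forall>i<length v. c (int (length u) + 1 + int i) = bit_symbol (v ! i)"
        "c (int (length u) + 1 + int (length v)) = 3"
      by (auto simp: c_def xs nth_append nat_add_distrib)
    have "\<exists>\<tau>'. exec (block_prog M b2 (k + 1) (k + 2) (k + 3)) \<tau>4 \<tau>' \<and> \<tau>' 0 = (c, int (length u) + 1 + int (length v) + 1) \<and>
      \<tau>' (k + 1) = ctape ?b \<and> (\<exists>v. \<tau>' (k + 2) = ctape v) \<and> \<tau>' (k + 3) = ctape 0 \<and>
      (\<forall>j. j \<notin> {0, k + 1, k + 2, k + 3} \<and> (j < b2 \<or> j \<ge> b2 + 3 + ?T) \<longrightarrow> \<tau>' j = \<tau>4 j)"
    proof (rule exec_block_prog[OF M hv])
      show "\<tau>4 0 = (c, int (length u) + 1)" using t4[of 0] t3 pos by simp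
      show "\<tau>4 b2 = blank_tape" "\<tau>4 (b2 + 1) = ctape 0" "\<tau>4 (b2 + 2) = ctape 0"
        using t4b t2 by (simp_all add: k_def)
      show "\<forall>i<?T. \<tau>4 (b2 + 3 + i) = blank_tape" using t4b t2 by (simp add: k_def)
      show "\<tau>4 (k + 3) = ctape 0" using t4[of "k + 3"] t3 by simp
    qed (use cv t4' t42 pos in \<open>auto simp: k_def\<close>)
    then obtain \<tau>5 y' where e5: "exec (block_prog M b2 (k + 1) (k + 2) (k + 3)) \<tau>4 \<tau>5"
      and t5: "\<tau>5 (k + 1) = ctape ?b" "\<tau>5 (k + 2) = ctape y'" "\<tau>5 (k + 3) = ctape 0"
      and keep5: "\<And>j. j \<notin> {0, k + 1, k + 2, k + 3} \<Longrightarrow> j \<ge> k \<Longrightarrow> \<tau>5 j = \<tau>4 j"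
      unfolding k_def by auto
    have t5a: "\<tau>5 k = ctape ?a" using keep5[of k] t4[of k] t3 pos by simp
    have "\<forall>j. k \<le> j \<and> j < k + R \<longrightarrow> (\<exists>v. \<tau>5 j = ctape v)"
    proof (intro allI impI)
      fix j assume j: "k \<le> j \<and> j < k + R"
      show "\<exists>v. \<tau>5 j = ctape v"
      proof (cases "j \<in> {k + 1, k + 2, k + 3}")
        case False
        then have "\<tau>5 j = \<tau>4 j" using j keep5 pos by auto
        then show ?thesis using j by (auto simp: \<tau>4_def counters_def)
      qed (use t5 in auto)
    qed
    then obtain s5 where s5: "\<And>j. k \<le> j \<Longrightarrow> j < k + R \<Longrightarrow> \<tau>5 j = ctape (s5 j)" by metis
    have c5: "\<tau>5 = counters k R (\<lambda>i. s5 (k + i)) \<tau>5" using s5 by (auto simp: counters_def fun_eq_iff)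
    have inj: "ctape x = ctape y \<Longrightarrow> x = y" for x y by (simp add: ctape_def)
    have ab: "s5 k = ?a" "s5 (k + 1) = ?b"
      using s5[of k] s5[of "k + 1"] t5a t5(1) R by (auto dest: inj)
    obtain s6 where s6: "cexec cp (\<lambda>i. s5 (k + i)) s6" "s6 2 = d ?a ?b"
      using cp[of "\<lambda>i. s5 (k + i)"] ab by auto
    define \<tau>6 where "\<tau>6 = counters k R s6 \<tau>5"
    have e6: "exec (cprog_tapes k cp) \<tau>5 \<tau>6"
      using exec_cprog_tapes[OF s6(1) R(2), of k \<tau>5] c5 by (simp add: \<tau>6_def)
    have "\<tau>6 (k + R) = blank_tape"
      using keep5[of "k + R"] t4[of "k + R"] keep3[of "k + R"] R pos 0
      by (simp add: \<tau>6_def counters_def \<tau>2_def \<tau>1_def \<tau>0_def K_def b1_def b2_def)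
    moreover have "\<tau>6 (k + 2) = ctape (d ?a ?b)" using R s6 by (simp add: \<tau>6_def counters_def)
    \<comment> \<open>A positive counter reads the blank, so reading 0 on tape \<open>k + 2\<close>
      means the answer True, whose symbol is 2.\<close>
    ultimately have e7: "exec (Act (\<lambda>\<rho>. (stays \<rho>)(k + R := (if \<rho> (k + 2) = 0 then 2 else 1, Stay)))) \<tau>6
        (\<tau>6(k + R := ((\<lambda>i. if i = 0 then bit_symbol (d ?a ?b \<noteq> 0) else 0), 0)))" (is "exec _ _ ?\<tau>7")
      by (intro exec_Act') (auto simp: fun_eq_iff blank_tape_def bit_symbol_def)
    have "exec p \<tau>0 ?\<tau>7"
      unfolding p_def
      by (rule exec_Seq[OF e1 exec_Seq[OF e2[folded \<tau>2_def] exec_Seq[OF e3 exec_Seq[OF e4 exec_Seq[OF e5 exec_Seq[OF e6 e7]]]]]])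
    then obtain n where n: "(step M' ^^ n) (initial_config M' [u, v]) = (1, tapes T ?\<tau>7)"
      using M'(3) init by metis
    have "last (tapes T ?\<tau>7) = ?\<tau>7 (k + R)" by (simp add: T_def)
    then have "output_on (last (tapes T ?\<tau>7)) [d ?a ?b \<noteq> 0]" by (simp add: output_on_def)
    then show ?thesis unfolding halts_with_def using n by blast
  qed
  with M'(1) show ?thesis using that by blast
qed

section \<open>Primitive recursive arithmetic\<close>

lemma PR_rename: "PR h \<Longrightarrow> PR (\<lambda>\<sigma>. h (\<lambda>i. \<sigma> (\<rho> i)))"
proof (induction arbitrary: \<rho> rule: PR.induct)
  case (PR_rec b f g)
  let ?\<rho> = "case_nat 0 (case_nat 1 (\<lambda>j. Suc (Suc (\<rho> j))))"
  have "(\<lambda>i. case_nat x (case_nat y \<sigma>) (?\<rho> i)) = case_nat x (case_nat y (\<lambda>i. \<sigma> (\<rho> i)))"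
    for x y and \<sigma> :: "nat \<Rightarrow> nat"
    by (auto simp: fun_eq_iff split: nat.split)
  then show ?case
    using PR.PR_rec[OF PR_rec.IH(1)[of \<rho>] PR_rec.IH(2)[of \<rho>] PR_rec.IH(3)[of ?\<rho>]] by simp
qed (auto intro: PR_zero PR_Suc PR_var)

text \<open>Below the binder of \<open>PR_rec\<close> the substitution must fix the two bound
  variables and shift the environment of all others, which explains \<open>?g\<close>.\<close>

lemma PR_subst: "PR h \<Longrightarrow> (\<And>i. PR (g i)) \<Longrightarrow> PR (\<lambda>\<sigma>. h (\<lambda>i. g i \<sigma>))"
proof (induction arbitrary: g rule: PR.induct)
  case (PR_rec b f h)
  let ?g = "case_nat (\<lambda>\<tau>. \<tau> 0) (case_nat (\<lambda>\<tau>. \<tau> 1) (\<lambda>j \<tau>. g j (\<lambda>i. \<tau> (Suc (Suc i)))))"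
  have "PR (?g i)" for i
    using PR_rename[OF PR_rec.prems, of _ "\<lambda>i. Suc (Suc i)"] PR_var by (auto split: nat.split)
  from PR_rec.IH(3)[of ?g, OF this]
  have 1: "PR (\<lambda>\<tau>. h (\<lambda>i. ?g i \<tau>))" .
  have "(\<lambda>i. ?g i (case_nat x (case_nat y \<sigma>))) = case_nat x (case_nat y (\<lambda>i. g i \<sigma>))" for x y \<sigma>
    by (auto simp: fun_eq_iff split: nat.split)
  then show ?case
    using PR.PR_rec[OF PR_rec.IH(1)[OF PR_rec.prems] PR_rec.IH(2)[OF PR_rec.prems] 1] by simp
qed (auto intro: PR_zero PR_Suc PR_var)

lemma case_nat_eta [simp]: "case_nat (\<tau> 0) (\<lambda>j. \<tau> (Suc j)) = \<tau>"
  by (auto simp: fun_eq_iff split: nat.split)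

text \<open>Binders are handled by de Bruijn indices: under a binder the bound variable is component 0 of
  the environment and the components of the outer environment are shifted.\<close>

lemma PR_shift: "PR f \<Longrightarrow> PR (\<lambda>\<tau>. f (\<lambda>j. \<tau> (Suc j)))"
  by (rule PR_rename)

lemma PR_shift2: "PR f \<Longrightarrow> PR (\<lambda>\<tau>. f (\<lambda>j. \<tau> (Suc (Suc j))))"
  by (rule PR_rename)

lemma PR_recI:
  assumes "PR f" "PR (\<lambda>\<tau>. g (\<tau> 0) (\<tau> 1) (\<lambda>j. \<tau> (Suc (Suc j))))" "PR b"
  shows "PR (\<lambda>\<sigma>. rec_nat (f \<sigma>) (\<lambda>i r. g i r \<sigma>) (b \<sigma>))"
  using PR_rec[OF assms(3,1,2)] by simp

lemma PR_add: "PR f \<Longrightarrow> PR g \<Longrightarrow> PR (\<lambda>\<sigma>. f \<sigma> + g \<sigma>)"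
proof -
  assume "PR f" "PR g"
  then have "PR (\<lambda>\<sigma>. rec_nat (f \<sigma>) (\<lambda>i r. Suc r) (g \<sigma>))" by (intro PR_recI PR_Suc PR_var)
  moreover have "rec_nat a (\<lambda>i r. Suc r) b = a + b" for a b by (induction b) auto
  ultimately show ?thesis by simp
qed

lemma PR_const: "PR (\<lambda>\<sigma>. c)"
  by (induction c) (simp_all add: PR_zero PR_Suc)

lemma PR_mult: "PR f \<Longrightarrow> PR g \<Longrightarrow> PR (\<lambda>\<sigma>. f \<sigma> * g \<sigma>)"
proof -
  assume "PR f" "PR g"
  then have "PR (\<lambda>\<sigma>. rec_nat 0 (\<lambda>i r. r + f \<sigma>) (g \<sigma>))"
    by (intro PR_recI PR_add PR_shift2[of f] PR_const PR_var)
  moreover have "rec_nat 0 (\<lambda>i r. r + a) b = a * b" for a b :: nat by (induction b) auto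
  ultimately show ?thesis by simp
qed

lemma PR_diff: "PR f \<Longrightarrow> PR g \<Longrightarrow> PR (\<lambda>\<sigma>. f \<sigma> - g \<sigma>)"
proof -
  assume f: "PR f" and g: "PR g"
  \<comment> \<open>The predecessor is the index of the last round of a recursion that ignores its
    own value.\<close>
  have "PR (\<lambda>\<sigma>. rec_nat 0 (\<lambda>i r. i) (h \<sigma>))" if "PR h" for h by (intro PR_recI PR_const PR_var that)
  moreover have "rec_nat 0 (\<lambda>i r. i) b = b - 1" for b :: nat by (cases b) auto
  ultimately have pred: "PR (\<lambda>\<sigma>. h \<sigma> - 1)" if "PR h" for h using that by simp
  have "PR (\<lambda>\<sigma>. rec_nat (f \<sigma>) (\<lambda>i r. r - 1) (g \<sigma>))" by (intro PR_recI pred PR_var f g)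
  moreover have "rec_nat a (\<lambda>i r. r - 1) b = a - b" for a b :: nat by (induction b) auto
  ultimately show ?thesis by simp
qed

section \<open>Predicates, bounded sums and bounded quantifiers\<close>

abbreviation PRP :: "((nat \<Rightarrow> nat) \<Rightarrow> bool) \<Rightarrow> bool" where
  "PRP P \<equiv> PR (\<lambda>\<sigma>. of_bool (P \<sigma>))"

lemma PR_if: "PRP P \<Longrightarrow> PR f \<Longrightarrow> PR g \<Longrightarrow> PR (\<lambda>\<sigma>. if P \<sigma> then f \<sigma> else g \<sigma>)"
proof -
  assume "PRP P" "PR f" "PR g"
  then have "PR (\<lambda>\<sigma>. of_bool (P \<sigma>) * f \<sigma> + (1 - of_bool (P \<sigma>)) * g \<sigma>)"
    by (intro PR_add PR_mult PR_diff PR_const)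
  moreover have "(\<lambda>\<sigma>. of_bool (P \<sigma>) * f \<sigma> + (1 - of_bool (P \<sigma>)) * g \<sigma>) = (\<lambda>\<sigma>. if P \<sigma> then f \<sigma> else g \<sigma>)"
    by auto
  ultimately show ?thesis by simp
qed

lemma PRP_iff: "PR f \<Longrightarrow> (\<And>\<sigma>. P \<sigma> \<longleftrightarrow> f \<sigma> = 0) \<Longrightarrow> PRP P"
proof -
  assume f: "PR f" and P: "\<And>\<sigma>. P \<sigma> \<longleftrightarrow> f \<sigma> = 0"
  have "(\<lambda>\<sigma>. of_bool (P \<sigma>)) = (\<lambda>\<sigma>. 1 - f \<sigma>)" by (auto simp: P)
  then show ?thesis using PR_diff[OF PR_const[of 1] f] by simp
qed

lemma PRP_le: "PR f \<Longrightarrow> PR g \<Longrightarrow> PRP (\<lambda>\<sigma>. f \<sigma> \<le> g \<sigma>)"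
  by (rule PRP_iff[of "\<lambda>\<sigma>. f \<sigma> - g \<sigma>"]) (intro PR_add PR_diff PR_Suc | auto)+

lemma PRP_eq: "PR f \<Longrightarrow> PR g \<Longrightarrow> PRP (\<lambda>\<sigma>. f \<sigma> = g \<sigma>)"
  by (rule PRP_iff[of "\<lambda>\<sigma>. (f \<sigma> - g \<sigma>) + (g \<sigma> - f \<sigma>)"]) (intro PR_add PR_diff PR_Suc | auto)+

lemma PRP_not: "PRP P \<Longrightarrow> PRP (\<lambda>\<sigma>. \<not> P \<sigma>)"
  by (rule PRP_iff[of "\<lambda>\<sigma>. of_bool (P \<sigma>)"]) auto

lemma PRP_conj: "PRP P \<Longrightarrow> PRP Q \<Longrightarrow> PRP (\<lambda>\<sigma>. P \<sigma> \<and> Q \<sigma>)"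
  unfolding of_bool_conj by (rule PR_mult)

lemma PRP_disj: "PRP P \<Longrightarrow> PRP Q \<Longrightarrow> PRP (\<lambda>\<sigma>. P \<sigma> \<or> Q \<sigma>)"
  using PRP_not[OF PRP_conj[OF PRP_not PRP_not]] by fastforce

lemma PRP_const: "PRP (\<lambda>\<sigma>. c)"
  by (rule PR_const)

lemma PR_sum:
  assumes "PR b" "PR (\<lambda>\<tau>. f (\<tau> 0) (\<lambda>j. \<tau> (Suc j)))"
  shows "PR (\<lambda>\<sigma>. \<Sum>i<b \<sigma>. f i \<sigma>)"
proof -
  \<comment> \<open>The recursion binds an index and a value, the sum only an index; the renaming
    skips the value.\<close>
  have "PR (\<lambda>\<tau>. f (\<tau> 0) (\<lambda>j. \<tau> (Suc (Suc j))))"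
    using PR_rename[OF assms(2), of "\<lambda>i. if i = 0 then 0 else Suc i"] by simp
  then have "PR (\<lambda>\<sigma>. rec_nat 0 (\<lambda>i r. r + f i \<sigma>) (b \<sigma>))" 
    using assms(1) by (intro PR_recI PR_add PR_var PR_const)
  moreover have "rec_nat 0 (\<lambda>i r. r + g i) n = (\<Sum>i<n. g i)" for g :: "nat \<Rightarrow> nat" and n
    by (induction n) auto
  ultimately show ?thesis by simp
qed

lemma PRP_bex:
  assumes "PR b" "PRP (\<lambda>\<tau>. P (\<tau> 0) (\<lambda>j. \<tau> (Suc j)))"
  shows "PRP (\<lambda>\<sigma>. \<exists>i\<le>b \<sigma>. P i \<sigma>)"
proof -
  have "PRP (\<lambda>\<sigma>. \<not> ((\<Sum>i<Suc (b \<sigma>). of_bool (P i \<sigma>)) = (0::nat)))" 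
    by (intro PRP_not PRP_eq PR_sum PR_Suc PR_const assms)
  moreover have "(\<not> (\<Sum>i<Suc n. of_bool (Q i)) = (0::nat)) \<longleftrightarrow> (\<exists>i\<le>n. Q i)" for Q n
    by (auto simp: less_Suc_eq_le simp del: sum.lessThan_Suc)
  ultimately show ?thesis by (simp only:)
qed

lemma PRP_ball:
  assumes "PR b" "PRP (\<lambda>\<tau>. P (\<tau> 0) (\<lambda>j. \<tau> (Suc j)))"
  shows "PRP (\<lambda>\<sigma>. \<forall>i\<le>b \<sigma>. P i \<sigma>)"
  using PRP_not[OF PRP_bex[OF assms(1) PRP_not[OF assms(2)]]] by simp

lemma PR_sum_const: "(\<And>x. x \<in> S \<Longrightarrow> PR (f x)) \<Longrightarrow> PR (\<lambda>\<sigma>. \<Sum>x\<in>S. f x \<sigma>)"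
  by (induction S rule: infinite_finite_induct) (simp_all add: PR_const PR_add)

lemma PRP_all_const: "finite S \<Longrightarrow> (\<And>x. x \<in> S \<Longrightarrow> PRP (P x)) \<Longrightarrow> PRP (\<lambda>\<sigma>. \<forall>x\<in>S. P x \<sigma>)"
  by (induction S rule: finite_induct) (simp_all add: PR_const PRP_conj)

lemma PR_power: "PR f \<Longrightarrow> PR g \<Longrightarrow> PR (\<lambda>\<sigma>. f \<sigma> ^ g \<sigma>)"
proof -
  assume "PR f" "PR g"
  then have "PR (\<lambda>\<sigma>. rec_nat 1 (\<lambda>i r. r * f \<sigma>) (g \<sigma>))"
    by (intro PR_recI PR_mult PR_shift2[of f] PR_const PR_var)
  moreover have "rec_nat 1 (\<lambda>i r. r * a) b = a ^ b" for a b :: nat by (induction b) auto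
  ultimately show ?thesis by simp
qed

lemma PR_div: "PR f \<Longrightarrow> PR g \<Longrightarrow> PR (\<lambda>\<sigma>. f \<sigma> div g \<sigma>)"
proof -
  assume fg: "PR f" "PR g"
  \<comment> \<open>The quotient is the number of positive multiples of the divisor up to the
    dividend; division by 0 yields 0 by convention.\<close>
  have "PR (\<lambda>\<sigma>. if g \<sigma> = 0 then 0 else \<Sum>i<f \<sigma>. of_bool (Suc i * g \<sigma> \<le> f \<sigma>))"
    by (intro PR_if PR_sum PRP_le PRP_eq PR_mult PR_Suc PR_var PR_shift[OF fg(1)] PR_shift[OF fg(2)] fg PR_const)
  moreover have "(if b = 0 then 0 else \<Sum>i<a. of_bool (Suc i * b \<le> a)) = a div b" for a b :: nat
  proof (cases "b = 0")
    case False
    then have "{i. i < a \<and> Suc i * b \<le> a} = {..<a div b}"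
      by (auto simp: less_eq_div_iff_mult_less_eq Suc_le_eq[symmetric] simp del: mult_Suc
          dest: less_le_trans[OF _ div_le_dividend])
    moreover have "(\<Sum>i<a. of_bool (Suc i * b \<le> a)) = card {i. i < a \<and> Suc i * b \<le> a}"
      by (simp add: of_bool_def sum.If_cases Collect_conj_eq lessThan_def del: mult_Suc)
    ultimately show ?thesis using False by simp
  qed simp
  ultimately show ?thesis by simp
qed

lemma PRP_even: "PR f \<Longrightarrow> PRP (\<lambda>\<sigma>. even (f \<sigma>))"
proof -
  assume "PR f"
  then have "PRP (\<lambda>\<sigma>. 2 * (f \<sigma> div 2) = f \<sigma>)" by (intro PRP_eq PR_mult PR_div PR_const)
  moreover have "2 * (a div 2) = a \<longleftrightarrow> even a" for a :: nat by (metis dvd_mult_div_cancel dvd_triv_left)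
  ultimately show ?thesis by simp
qed

section \<open>Decoding of pairs and lists\<close>

lemma PR_prod_encode: "PR f \<Longrightarrow> PR g \<Longrightarrow> PR (\<lambda>\<sigma>. prod_encode (f \<sigma>, g \<sigma>))"
  unfolding prod_encode_def triangle_def prod.case by (intro PR_add PR_div PR_mult PR_Suc PR_const)

definition pfst :: "nat \<Rightarrow> nat" where "pfst x = fst (prod_decode x)"
definition psnd :: "nat \<Rightarrow> nat" where "psnd x = snd (prod_decode x)"

lemma prod_encode_eq_iff: "prod_encode (a, b) = x \<longleftrightarrow> a = pfst x \<and> b = psnd x"
  by (metis pfst_def psnd_def prod.collapse prod_decode_inverse prod_encode_inverse fst_conv snd_conv)

lemma pfst_le: "pfst x \<le> x" and psnd_le: "psnd x \<le> x"
  using le_prod_encode_1[of "pfst x" "psnd x"] le_prod_encode_2[of "psnd x" "pfst x"]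
    prod_encode_eq_iff[of "pfst x" "psnd x" x] by simp_all

lemma double_sum_delta:
  fixes g :: "nat \<Rightarrow> nat \<Rightarrow> nat"
  assumes "a \<le> x" "b \<le> x"
  shows "(\<Sum>i<Suc x. \<Sum>j<Suc x. if i = a \<and> j = b then g i j else 0) = g a b"
proof -
  have "(\<Sum>j<Suc x. if i = a \<and> j = b then g i j else 0) = (if i = a then g i b else 0)" for i
    using assms by (cases "i = a") (simp_all add: sum.delta del: sum.lessThan_Suc)
  then show ?thesis using assms by (simp add: sum.delta del: sum.lessThan_Suc)
qed

text \<open>Both components are at most the code, so decoding is a bounded search, written as a
  double sum in which only the right pair counts.\<close>

lemma PR_pfst: "PR f \<Longrightarrow> PR (\<lambda>\<sigma>. pfst (f \<sigma>))"
  and PR_psnd: "PR f \<Longrightarrow> PR (\<lambda>\<sigma>. psnd (f \<sigma>))"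
proof -
  assume f: "PR f"
  have "PR (\<lambda>\<sigma>. \<Sum>i<Suc (f \<sigma>). \<Sum>j<Suc (f \<sigma>). if prod_encode (i, j) = f \<sigma> then i else 0)"
    "PR (\<lambda>\<sigma>. \<Sum>i<Suc (f \<sigma>). \<Sum>j<Suc (f \<sigma>). if prod_encode (i, j) = f \<sigma> then j else 0)"
    by (intro PR_sum PR_if PRP_eq PR_prod_encode PR_var PR_Suc PR_const PR_shift[OF f] f PR_shift2[OF f])+
  then show "PR (\<lambda>\<sigma>. pfst (f \<sigma>))" "PR (\<lambda>\<sigma>. psnd (f \<sigma>))"
    using double_sum_delta[OF pfst_le psnd_le, of _ "\<lambda>i j. i"] double_sum_delta[OF pfst_le psnd_le, of _ "\<lambda>i j. j"]
    by (simp_all only: prod_encode_eq_iff)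
qed

text \<open>A nonempty list has the code \<open>Suc (prod_encode (x, list_encode xs))\<close> and
  the empty one the code 0, hence the subtraction of 1.\<close>

definition ltl :: "nat \<Rightarrow> nat" where "ltl c = psnd (c - 1)"

definition ldrop :: "nat \<Rightarrow> nat \<Rightarrow> nat" where "ldrop t c = (ltl ^^ t) c"

definition lnth :: "nat \<Rightarrow> nat \<Rightarrow> nat" where "lnth c t = pfst (ldrop t c - 1)"

lemma psnd_0 [simp]: "psnd 0 = 0"
  using psnd_le[of 0] by simp

lemma ltl_Cons [simp]: "ltl (list_encode (x # xs)) = list_encode xs"
  by (simp add: ltl_def psnd_def)

lemma ltl_0 [simp]: "ltl 0 = 0"
  by (simp add: ltl_def)

lemma ldrop_encode: "ldrop t (list_encode xs) = list_encode (drop t xs)"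
proof (induction t arbitrary: xs)
  case (Suc t)
  show ?case
  proof (cases xs)
    case Nil
    have "(ltl ^^ t) 0 = 0" for t by (induction t) auto
    then show ?thesis using Nil by (simp add: ldrop_def)
  next
    case (Cons y ys)
    then show ?thesis using Suc[of ys] by (simp add: ldrop_def funpow_swap1 del: list_encode.simps)
  qed
qed (simp add: ldrop_def)

lemma lnth_encode: "t < length xs \<Longrightarrow> lnth (list_encode xs) t = xs ! t"
  by (cases "drop t xs") (auto simp: lnth_def ldrop_encode pfst_def nth_via_drop)

lemma PR_ldrop: "PR f \<Longrightarrow> PR g \<Longrightarrow> PR (\<lambda>\<sigma>. ldrop (f \<sigma>) (g \<sigma>))"
proof -
  assume fg: "PR f" "PR g"
  have "PR (\<lambda>\<sigma>. rec_nat (g \<sigma>) (\<lambda>i r. psnd (r - 1)) (f \<sigma>))"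
    by (intro PR_recI PR_psnd PR_diff PR_var PR_const fg)
  moreover have "rec_nat a (\<lambda>i r. psnd (r - 1)) n = ldrop n a" for a n
    by (induction n) (auto simp: ldrop_def ltl_def)
  ultimately show ?thesis by simp
qed

lemma PR_lnth: "PR f \<Longrightarrow> PR g \<Longrightarrow> PR (\<lambda>\<sigma>. lnth (f \<sigma>) (g \<sigma>))"
  unfolding lnth_def by (intro PR_pfst PR_diff PR_ldrop PR_const)

text \<open>The pairing function is at least its triangular part, and
  \<open>triangle k \<ge> k\<close>. From this a code bounds the length, the entries and the sum of
  its list, and later the degrees of coded polynomials.\<close>

lemma le_list_encode: "x + list_encode xs < list_encode (x # xs)"
proof -
  have "k \<le> triangle k" for k by (induction k) auto
  from this[of "x + list_encode xs"] show ?thesis by (simp add: prod_encode_def)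
qed

lemma length_le_encode: "length xs \<le> list_encode xs"
proof (induction xs)
  case (Cons x xs)
  then show ?case using le_list_encode[of x xs] by simp
qed simp

lemma sum_list_code:
  fixes g :: "nat \<Rightarrow> 'a::comm_monoid_add"
  assumes "length xs \<le> N"
  shows "(\<Sum>t<N. if ldrop t (list_encode xs) = 0 then 0 else g (lnth (list_encode xs) t)) = sum_list (map g xs)"
proof -
  have "(\<Sum>t<N. if ldrop t (list_encode xs) = 0 then 0 else g (lnth (list_encode xs) t)) =
      (\<Sum>t<N. if t < length xs then g (xs ! t) else 0)"
  proof (intro sum.cong refl)
    fix t assume "t \<in> {..<N}"
    have "ldrop t (list_encode xs) = 0 \<longleftrightarrow> drop t xs = []"
      unfolding ldrop_encode by (cases "drop t xs") simp_all
    then show "(if ldrop t (list_encode xs) = 0 then 0 else g (lnth (list_encode xs) t)) =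
        (if t < length xs then g (xs ! t) else 0)"
      using lnth_encode[of t xs] by auto
  qed
  also have "\<dots> = (\<Sum>t<length xs. g (xs ! t))"
    using assms by (intro sum.mono_neutral_cong_right) auto
  also have "\<dots> = sum_list (map g xs)" by (simp add: sum_list_sum_nth atLeast0LessThan)
  finally show ?thesis .
qed

text \<open>The code itself bounds the length, so no length has to be computed; beyond the end
  \<open>ldrop\<close> is 0 and the term is dropped.\<close>

lemma sum_list_decode:
  fixes g :: "nat \<Rightarrow> 'a::comm_monoid_add"
  shows "sum_list (map g (list_decode c)) = (\<Sum>t<c. if ldrop t c = 0 then 0 else g (lnth c t))"
  using sum_list_code[of "list_decode c" c g] length_le_encode[of "list_decode c"]
  unfolding list_decode_inverse by simp

lemma PR_sum_list:
  assumes "PR c" "PR (\<lambda>\<tau>. g (\<tau> 0) (\<lambda>j. \<tau> (Suc j)))"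
  shows "PR (\<lambda>\<sigma>. sum_list (map (\<lambda>t. g t \<sigma>) (list_decode (c \<sigma>))))"
proof -
  let ?h = "case_nat (\<lambda>\<tau>. lnth (c (\<lambda>j. \<tau> (Suc j))) (\<tau> 0)) (\<lambda>j \<tau>. \<tau> (Suc j))"
  have "PR (?h i)" for i
    using PR_lnth[OF PR_shift[OF assms(1)] PR_var] PR_var by (auto split: nat.split)
  from PR_subst[OF assms(2), of ?h, OF this]
  have "PR (\<lambda>\<tau>. g (lnth (c (\<lambda>j. \<tau> (Suc j))) (\<tau> 0)) (\<lambda>j. \<tau> (Suc j)))" by simp
  then show ?thesis unfolding sum_list_decode
    by (intro PR_sum PR_if PRP_eq PR_ldrop PR_shift[OF assms(1)] PR_var PR_const assms(1))
qed

section \<open>Primitive recursive integer arithmetic\<close>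

text \<open>Differences of natural numbers are closed under ring operations without any case
  distinction on signs.\<close>

definition PRI :: "((nat \<Rightarrow> nat) \<Rightarrow> int) \<Rightarrow> bool" where
  "PRI f \<longleftrightarrow> (\<exists>p q. PR p \<and> PR q \<and> f = (\<lambda>\<sigma>. int (p \<sigma>) - int (q \<sigma>)))"

lemma PRI_I: "PR p \<Longrightarrow> PR q \<Longrightarrow> (\<And>\<sigma>. f \<sigma> = int (p \<sigma>) - int (q \<sigma>)) \<Longrightarrow> PRI f"
  unfolding PRI_def by blast

lemma PRI_int: "PR f \<Longrightarrow> PRI (\<lambda>\<sigma>. int (f \<sigma>))"
  by (rule PRI_I[of f "\<lambda>_. 0"]) (simp_all add: PR_const)

lemma PRI_const: "PRI (\<lambda>\<sigma>. c)"
  by (rule PRI_I[of "\<lambda>_. nat c" "\<lambda>_. nat (- c)"]) (auto simp: PR_const)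

lemma PRI_add: assumes "PRI f" "PRI g" shows "PRI (\<lambda>\<sigma>. f \<sigma> + g \<sigma>)"
proof -
  obtain p q p' q' where *: "PR p" "PR q" "PR p'" "PR q'"
    "f = (\<lambda>\<sigma>. int (p \<sigma>) - int (q \<sigma>))" "g = (\<lambda>\<sigma>. int (p' \<sigma>) - int (q' \<sigma>))"
    using assms by (auto simp: PRI_def)
  then show ?thesis by (intro PRI_I[of "\<lambda>\<sigma>. p \<sigma> + p' \<sigma>" "\<lambda>\<sigma>. q \<sigma> + q' \<sigma>"] PR_add) auto
qed

lemma PRI_diff: assumes "PRI f" "PRI g" shows "PRI (\<lambda>\<sigma>. f \<sigma> - g \<sigma>)"
proof -
  obtain p q p' q' where *: "PR p" "PR q" "PR p'" "PR q'"
    "f = (\<lambda>\<sigma>. int (p \<sigma>) - int (q \<sigma>))" "g = (\<lambda>\<sigma>. int (p' \<sigma>) - int (q' \<sigma>))"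
    using assms by (auto simp: PRI_def)
  then show ?thesis by (intro PRI_I[of "\<lambda>\<sigma>. p \<sigma> + q' \<sigma>" "\<lambda>\<sigma>. q \<sigma> + p' \<sigma>"] PR_add) auto
qed

lemma PRI_mult: assumes "PRI f" "PRI g" shows "PRI (\<lambda>\<sigma>. f \<sigma> * g \<sigma>)"
proof -
  obtain p q p' q' where *: "PR p" "PR q" "PR p'" "PR q'"
    "f = (\<lambda>\<sigma>. int (p \<sigma>) - int (q \<sigma>))" "g = (\<lambda>\<sigma>. int (p' \<sigma>) - int (q' \<sigma>))"
    using assms by (auto simp: PRI_def)
  then show ?thesis
    by (intro PRI_I[of "\<lambda>\<sigma>. p \<sigma> * p' \<sigma> + q \<sigma> * q' \<sigma>" "\<lambda>\<sigma>. p \<sigma> * q' \<sigma> + q \<sigma> * p' \<sigma>"] PR_add PR_mult)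
      (auto simp: algebra_simps)
qed

lemma PRI_sum_const: "(\<And>x. x \<in> S \<Longrightarrow> PRI (f x)) \<Longrightarrow> PRI (\<lambda>\<sigma>. \<Sum>x\<in>S. f x \<sigma>)"
  by (induction S rule: infinite_finite_induct) (simp_all add: PRI_const PRI_add)

lemma PRI_prod_const: "(\<And>x. x \<in> S \<Longrightarrow> PRI (f x)) \<Longrightarrow> PRI (\<lambda>\<sigma>. \<Prod>x\<in>S. f x \<sigma>)"
  by (induction S rule: infinite_finite_induct) (simp_all add: PRI_const PRI_mult)

lemma PRI_if_const: "PRI f \<Longrightarrow> PRI g \<Longrightarrow> PRI (\<lambda>\<sigma>. if c then f \<sigma> else g \<sigma>)"
  by (cases c) simp_all

lemma PRI_decode: "PR f \<Longrightarrow> PRI (\<lambda>\<sigma>. int_decode (f \<sigma>))"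
  by (rule PRI_I[of "\<lambda>\<sigma>. if even (f \<sigma>) then f \<sigma> div 2 else 0"
        "\<lambda>\<sigma>. if even (f \<sigma>) then 0 else Suc (f \<sigma> div 2)"])
    (auto simp: int_decode_def sum_decode_def intro!: PR_if PRP_even PR_Suc PR_div PR_const)

lemma PR_encode: assumes "PRI f" shows "PR (\<lambda>\<sigma>. int_encode (f \<sigma>))"
proof -
  obtain p q where *: "PR p" "PR q" "f = (\<lambda>\<sigma>. int (p \<sigma>) - int (q \<sigma>))" using assms by (auto simp: PRI_def)
  have "PR (\<lambda>\<sigma>. if q \<sigma> \<le> p \<sigma> then 2 * (p \<sigma> - q \<sigma>) else Suc (2 * (q \<sigma> - p \<sigma> - 1)))"
    by (intro PR_if PRP_le PR_mult PR_diff PR_Suc PR_const *)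
  moreover have "(if b \<le> a then 2 * (a - b) else Suc (2 * (b - a - 1))) = int_encode (int a - int b)" for a b
    by (auto simp: int_encode_def sum_encode_def nat_diff_distrib of_nat_diff)
  ultimately show ?thesis using * by simp
qed

lemma PRP_eq_int: "PRI f \<Longrightarrow> PRI g \<Longrightarrow> PRP (\<lambda>\<sigma>. f \<sigma> = g \<sigma>)"
  using PRP_eq[OF PR_encode PR_encode, of f g] by (simp add: int_encode_eq)

lemma PR_nat_abs: assumes "PRI f" shows "PR (\<lambda>\<sigma>. nat \<bar>f \<sigma>\<bar>)"
proof -
  obtain p q where *: "PR p" "PR q" "f = (\<lambda>\<sigma>. int (p \<sigma>) - int (q \<sigma>))" using assms by (auto simp: PRI_def)
  then have "PR (\<lambda>\<sigma>. (p \<sigma> - q \<sigma>) + (q \<sigma> - p \<sigma>))" by (intro PR_add PR_diff)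
  moreover have "(a - b) + (b - a) = nat \<bar>int a - int b\<bar>" for a b by auto
  ultimately show ?thesis using * by simp
qed

lemma PRI_sum_list:
  assumes "PR c" "PRI (\<lambda>\<tau>. g (\<tau> 0) (\<lambda>j. \<tau> (Suc j)))"
  shows "PRI (\<lambda>\<sigma>. sum_list (map (\<lambda>t. g t \<sigma>) (list_decode (c \<sigma>))))"
proof -
  obtain p q where *: "PR p" "PR q" "(\<lambda>\<tau>. g (\<tau> 0) (\<lambda>j. \<tau> (Suc j))) = (\<lambda>\<tau>. int (p \<tau>) - int (q \<tau>))"
    using assms by (auto simp: PRI_def)
  have g: "g t \<sigma> = int (p (case_nat t \<sigma>)) - int (q (case_nat t \<sigma>))" for t \<sigma>
    using fun_cong[OF *(3), of "case_nat t \<sigma>"] by simp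
  have "PR (\<lambda>\<sigma>. sum_list (map (\<lambda>t. h (case_nat t \<sigma>)) (list_decode (c \<sigma>))))" if "PR h" for h
    using that by (intro PR_sum_list assms(1)) simp
  then have "PRI (\<lambda>\<sigma>. int (sum_list (map (\<lambda>t. p (case_nat t \<sigma>)) (list_decode (c \<sigma>)))) -
      int (sum_list (map (\<lambda>t. q (case_nat t \<sigma>)) (list_decode (c \<sigma>)))))"
    using *(1,2) by (intro PRI_diff PRI_int) auto
  moreover have "int (sum_list (map a xs)) - int (sum_list (map b xs)) = sum_list (map (\<lambda>t. int (a t) - int (b t)) xs)"
    for a b :: "nat \<Rightarrow> nat" and xs by (induction xs) auto
  ultimately show ?thesis by (simp add: g)
qed

lemma PR_list_encode: "(\<And>j. PR (f j)) \<Longrightarrow> PR (\<lambda>\<sigma>. list_encode (map (\<lambda>j. f j \<sigma>) xs))"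
  by (induction xs) (simp_all add: PR_const PR_Suc PR_prod_encode)

text \<open>Powers of entry functions rather than of \<open>mat\<close>: with \<open>n\<close>
  fixed, the same recursion serves the primitive recursive test on integers and the polynomials
  behind it.\<close>

fun mpow :: "nat \<Rightarrow> (nat \<Rightarrow> nat \<Rightarrow> 'a::comm_semiring_1) \<Rightarrow> nat \<Rightarrow> nat \<Rightarrow> nat \<Rightarrow> 'a" where
  "mpow n A 0 i j = of_bool (i = j)"
| "mpow n A (Suc k) i j = (\<Sum>l<n. mpow n A k i l * A l j)"

text \<open>Row \<open>i\<close> of the next power depends only on row \<open>i\<close> of the
  present one, so one number coding a row is enough as the state of the recursion.\<close>

lemma PRI_mpow:
  fixes A :: "nat \<Rightarrow> nat \<Rightarrow> (nat \<Rightarrow> nat) \<Rightarrow> int"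
  assumes A: "\<And>i j. PRI (A i j)" and k: "PR k" and j: "j < n"
  shows "PRI (\<lambda>\<sigma>. mpow n (\<lambda>i j. A i j \<sigma>) (k \<sigma>) i j)"
proof -
  define st where "st \<sigma> m = rec_nat (list_encode (map (\<lambda>j. int_encode (of_bool (i = j))) [0..<n]))
    (\<lambda>_ s. list_encode (map (\<lambda>j. int_encode (\<Sum>l<n. int_decode (lnth s l) * A l j \<sigma>)) [0..<n])) m" for \<sigma> and m :: nat
  have A2: "PRI (\<lambda>\<tau>. A l j (\<lambda>j. \<tau> (Suc (Suc j))))" for l j
  proof -
    obtain p q where "PR p" "PR q" "A l j = (\<lambda>\<sigma>. int (p \<sigma>) - int (q \<sigma>))" using A[of l j] by (auto simp: PRI_def)
    then show ?thesis using PR_shift2[of p] PR_shift2[of q] by (simp add: PRI_diff PRI_int)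
  qed
  have PR_st: "PR (\<lambda>\<sigma>. st \<sigma> (k \<sigma>))"
    unfolding st_def
    by (intro PR_recI PR_list_encode PR_encode PRI_sum_const PRI_mult PRI_decode PR_lnth PR_var PR_const A2 k)
  have st: "st \<sigma> m = list_encode (map (\<lambda>j. int_encode (mpow n (\<lambda>i j. A i j \<sigma>) m i j)) [0..<n])" for \<sigma> m
  proof (induction m)
    case (Suc m)
    have "int_decode (lnth (st \<sigma> m) l) = mpow n (\<lambda>i j. A i j \<sigma>) m i l" if "l < n" for l
      unfolding Suc using that by (simp add: lnth_encode)
    moreover have "st \<sigma> (Suc m) =
        list_encode (map (\<lambda>j. int_encode (\<Sum>l<n. int_decode (lnth (st \<sigma> m) l) * A l j \<sigma>)) [0..<n])"
      by (simp add: st_def)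
    ultimately show ?case by simp
  qed (simp add: st_def)
  have "PRI (\<lambda>\<sigma>. int_decode (lnth (st \<sigma> (k \<sigma>)) j))" by (intro PRI_decode PR_lnth PR_st PR_const)
  then show ?thesis using j by (simp add: st lnth_encode)
qed

lemma PRI_power: assumes "PRI f" "PR k" shows "PRI (\<lambda>\<sigma>. f \<sigma> ^ k \<sigma>)"
proof -
  \<comment> \<open>A 1 by 1 matrix: \<open>PR_rec\<close> recurses on natural numbers only, and the
    coding of integers has been dealt with for matrices.\<close>
  have "mpow 1 (\<lambda>i j. a) m 0 0 = a ^ m" for a :: int and m by (induction m) (auto simp: mult.commute)
  then show ?thesis using PRI_mpow[of "\<lambda>_ _. f" k 0 1 0] assms by simp
qed

section \<open>Kronecker substitution\<close>

text \<open>The substitution x_i := y^(E^i) is injective on polynomials with all exponents less than E.\<close>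

abbreviation mkeys :: "('a \<Rightarrow>\<^sub>0 'b::zero) \<Rightarrow> 'a set" where "mkeys \<equiv> Poly_Mapping.keys"
abbreviation mlookup :: "('a \<Rightarrow>\<^sub>0 'b::zero) \<Rightarrow> 'a \<Rightarrow> 'b" where "mlookup \<equiv> Poly_Mapping.lookup"

definition wt :: "nat \<Rightarrow> (nat \<Rightarrow>\<^sub>0 nat) \<Rightarrow> nat" where
  "wt E m = (\<Sum>i\<in>mkeys m. mlookup m i * E ^ i)"

lemma wt_superset: "finite S \<Longrightarrow> mkeys m \<subseteq> S \<Longrightarrow> wt E m = (\<Sum>i\<in>S. mlookup m i * E ^ i)"
  unfolding wt_def by (intro sum.mono_neutral_left) (auto simp: in_keys_iff)

lemma wt_add: "wt E (m + m') = wt E m + wt E m'"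
proof -
  let ?S = "mkeys m \<union> mkeys m'"
  have "mkeys (m + m') \<subseteq> ?S" by (rule Poly_Mapping.keys_add)
  then show ?thesis
    using wt_superset[of ?S m E] wt_superset[of ?S m' E] wt_superset[of ?S "m + m'" E]
    by (simp add: lookup_add add_mult_distrib sum.distrib)
qed

lemma wt_single [simp]: "wt E (Poly_Mapping.single i e) = e * E ^ i"
  by (simp add: wt_def)

lemma wt_0 [simp]: "wt E 0 = 0"
  by (simp add: wt_def)

lemma digits_unique:
  fixes f g :: "nat \<Rightarrow> nat"
  assumes "(\<Sum>i<N. f i * E ^ i) = (\<Sum>i<N. g i * E ^ i)" "\<And>i. f i < E" "\<And>i. g i < E" "i < N"
  shows "f i = g i"
  using assms
proof (induction N arbitrary: f g i)
  case (Suc N)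
  have *: "(\<Sum>i<Suc N. h i * E ^ i) = h 0 + E * (\<Sum>i<N. h (Suc i) * E ^ i)" for h :: "nat \<Rightarrow> nat"
    unfolding sum.lessThan_Suc_shift by (simp add: sum_distrib_left ac_simps)
  have eq: "f 0 + E * (\<Sum>i<N. f (Suc i) * E ^ i) = g 0 + E * (\<Sum>i<N. g (Suc i) * E ^ i)"
    using Suc.prems(1) unfolding * .
  have "f 0 = g 0" using arg_cong[OF eq, of "\<lambda>x. x mod E"] Suc.prems(2,3)[of 0] by simp
  moreover have "E > 0" using Suc.prems(2)[of 0] by linarith
  ultimately have "(\<Sum>i<N. f (Suc i) * E ^ i) = (\<Sum>i<N. g (Suc i) * E ^ i)" using eq by simp
  from Suc.IH[OF this] show ?case using \<open>f 0 = g 0\<close> Suc.prems by (cases i) auto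
qed simp

lemma wt_inj:
  assumes "wt E m = wt E m'" "\<And>i. mlookup m i < E" "\<And>i. mlookup m' i < E"
  shows "m = m'"
proof -
  obtain N where N: "mkeys m \<union> mkeys m' \<subseteq> {..<N}"
    using finite_nat_bounded[of "mkeys m \<union> mkeys m'"] by auto
  then have eq: "(\<Sum>i<N. mlookup m i * E ^ i) = (\<Sum>i<N. mlookup m' i * E ^ i)"
    using assms(1) wt_superset[of "{..<N}" m E] wt_superset[of "{..<N}" m' E] by simp
  show ?thesis
  proof (rule poly_mapping_eqI)
    fix i show "mlookup m i = mlookup m' i"
    proof (cases "i < N")
      case True
      then show ?thesis using digits_unique[OF eq assms(2,3)] by blast
    next
      case False
      then have "i \<notin> mkeys m" "i \<notin> mkeys m'" using N by auto
      then show ?thesis by (simp add: in_keys_iff)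
    qed
  qed
qed

section \<open>The substitution as a ring homomorphism\<close>

definition kron :: "nat \<Rightarrow> rat_poly \<Rightarrow> rat poly" where
  "kron E p = (\<Sum>m\<in>mkeys p. monom (mlookup p m) (wt E m))"

lemma kron_superset: "finite S \<Longrightarrow> mkeys p \<subseteq> S \<Longrightarrow> kron E p = (\<Sum>m\<in>S. monom (mlookup p m) (wt E m))"
  unfolding kron_def by (intro sum.mono_neutral_left) (auto simp: in_keys_iff)

lemma kron_add: "kron E (p + q) = kron E p + kron E q"
proof -
  let ?S = "mkeys p \<union> mkeys q"
  have "mkeys (p + q) \<subseteq> ?S" by (rule Poly_Mapping.keys_add)
  then show ?thesis
    using kron_superset[of ?S p E] kron_superset[of ?S q E] kron_superset[of ?S "p + q" E]
    by (simp add: lookup_add add_monom[symmetric] sum.distrib)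
qed

lemma kron_0 [simp]: "kron E 0 = 0"
  by (simp add: kron_def)

lemma kron_single [simp]: "kron E (Poly_Mapping.single m c) = monom c (wt E m)"
  by (simp add: kron_def)

lemma kron_sum: "kron E (\<Sum>x\<in>S. f x) = (\<Sum>x\<in>S. kron E (f x))"
  by (induction S rule: infinite_finite_induct) (auto simp: kron_add)

lemma sum_singles: "p = (\<Sum>m\<in>mkeys p. Poly_Mapping.single m (mlookup p m))"
  by (rule poly_mapping_eqI) (simp add: lookup_sum lookup_single when_def sum.delta in_keys_iff)

lemma kron_mult: "kron E (p * q) = kron E p * kron E q"
proof -
  have "kron E (p * q) = kron E ((\<Sum>m\<in>mkeys p. Poly_Mapping.single m (mlookup p m)) *
      (\<Sum>m\<in>mkeys q. Poly_Mapping.single m (mlookup q m)))"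
    using sum_singles[of p] sum_singles[of q] by simp
  also have "\<dots> = (\<Sum>m\<in>mkeys p. \<Sum>m'\<in>mkeys q. monom (mlookup p m) (wt E m) * monom (mlookup q m') (wt E m'))"
    by (simp add: sum_product kron_sum mult_single wt_add mult_monom)
  also have "\<dots> = kron E p * kron E q" by (simp add: kron_def sum_product)
  finally show ?thesis .
qed

lemma kron_1: "kron E 1 = 1"
  using kron_single[of E 0 1] by (simp add: one_poly_eq_simps flip: single_one)

definition ev :: "nat \<Rightarrow> nat \<Rightarrow> rat_poly \<Rightarrow> rat" where
  "ev E y p = poly (kron E p) (of_nat y)"

interpretation ev: comm_ring_hom "ev E y"
  by unfold_locales (auto simp: ev_def kron_add kron_mult kron_1)

text \<open>One notion for two bounds: with a single exponent as \<open>\<omega>\<close> it controls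
  the choice of the base \<open>E\<close>, with \<open>wt E\<close> it controls the degree in
  \<open>y\<close> after the substitution.\<close>

definition wle :: "((nat \<Rightarrow>\<^sub>0 nat) \<Rightarrow> nat) \<Rightarrow> nat \<Rightarrow> rat_poly \<Rightarrow> bool" where
  "wle \<omega> N p \<longleftrightarrow> (\<forall>m\<in>mkeys p. \<omega> m \<le> N)"

lemma kron_eq_0:
  assumes "kron E p = 0" "\<And>i. wle (\<lambda>m. mlookup m i) N p" "N < E"
  shows "p = 0"
proof (rule ccontr)
  assume "p \<noteq> 0"
  then obtain m where m: "m \<in> mkeys p" by (metis keys_eq_empty equals0I)
  have b: "mlookup m' i < E" if "m' \<in> mkeys p" for m' i
    using assms(2)[of i] assms(3) that by (auto simp: wle_def intro: le_less_trans)
  have "coeff (kron E p) (wt E m) = (\<Sum>m'\<in>mkeys p. if m' = m then mlookup p m' else 0)"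
    unfolding kron_def coeff_sum by (intro sum.cong refl) (use m b wt_inj[of E] in auto)
  also have "\<dots> = mlookup p m" using m by (simp add: sum.delta)
  finally show False using assms(1) m by (simp add: in_keys_iff)
qed

lemma degree_kron_le: "wle (wt E) D p \<Longrightarrow> degree (kron E p) \<le> D"
  unfolding kron_def wle_def by (intro degree_sum_le) (auto intro: order_trans[OF degree_monom_le])

text \<open>The substituted polynomial is nonzero of degree at most \<open>D\<close>, so it cannot
  vanish at all of the \<open>D + 1\<close> points 0, ..., \<open>D\<close>.\<close>

lemma ev_nonzero:
  assumes "p \<noteq> 0" "\<And>i. wle (\<lambda>m. mlookup m i) N p" "N < E" "wle (wt E) D p"
  shows "\<exists>y\<le>D. ev E y p \<noteq> 0"
proof (rule ccontr)
  assume *: "\<not> (\<exists>y\<le>D. ev E y p \<noteq> 0)"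
  have nz: "kron E p \<noteq> 0" using kron_eq_0[OF _ assms(2,3)] assms(1) by blast
  have "of_nat ` {..D} \<subseteq> {x. poly (kron E p) x = 0}" using * by (auto simp: ev_def)
  then have "card (of_nat ` {..D} :: rat set) \<le> card {x. poly (kron E p) x = 0}"
    by (rule card_mono[OF poly_roots_finite[OF nz]])
  also have "\<dots> \<le> degree (kron E p)" by (rule card_poly_roots_bound[OF nz])
  also have "\<dots> \<le> D" by (rule degree_kron_le[OF assms(4)])
  finally show False by (simp add: card_image inj_on_def)
qed

section \<open>Degree bounds read off from codes\<close>

locale weight =
  fixes \<omega> :: "(nat \<Rightarrow>\<^sub>0 nat) \<Rightarrow> nat"
  assumes weight_0: "\<omega> 0 = 0" and weight_add: "\<omega> (m + m') = \<omega> m + \<omega> m'"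
begin

lemma wle_mono: "wle \<omega> N p \<Longrightarrow> N \<le> N' \<Longrightarrow> wle \<omega> N' p"
  by (force simp: wle_def)

lemma wle_0: "wle \<omega> N 0"
  by (simp add: wle_def)

lemma wle_1: "wle \<omega> N 1"
  by (simp add: wle_def weight_0)

lemma wle_add: "wle \<omega> N p \<Longrightarrow> wle \<omega> N q \<Longrightarrow> wle \<omega> N (p + q)"
  using Poly_Mapping.keys_add[of p q] by (auto simp: wle_def)

lemma wle_diff: "wle \<omega> N p \<Longrightarrow> wle \<omega> N q \<Longrightarrow> wle \<omega> N (p - q)"
  using keys_diff[of p q] by (auto simp: wle_def)

lemma wle_uminus: "wle \<omega> N p \<Longrightarrow> wle \<omega> N (- p)"
  by (simp add: wle_def)

lemma wle_mult: "wle \<omega> N p \<Longrightarrow> wle \<omega> N' q \<Longrightarrow> wle \<omega> (N + N') (p * q)"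
  using Poly_Mapping.keys_mult[of p q] by (force simp: wle_def weight_add intro: add_mono)

lemma wle_power: "wle \<omega> N p \<Longrightarrow> wle \<omega> (k * N) (p ^ k)"
  by (induction k) (auto simp: wle_1 intro: wle_mult)

lemma wle_sum: "(\<And>x. x \<in> S \<Longrightarrow> wle \<omega> N (f x)) \<Longrightarrow> wle \<omega> N (\<Sum>x\<in>S. f x)"
  by (induction S rule: infinite_finite_induct) (auto simp: wle_0 intro: wle_add)

lemma wle_prod: "(\<And>x. x \<in> S \<Longrightarrow> wle \<omega> N (f x)) \<Longrightarrow> wle \<omega> (card S * N) (\<Prod>x\<in>S. f x)"
  by (induction S rule: infinite_finite_induct) (auto simp: wle_1 intro: wle_mult)

lemma weight_sum_list: "\<omega> (sum_list ms) = sum_list (map \<omega> ms)"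
  by (induction ms) (auto simp: weight_0 weight_add)

end

lemma sum_list_le_encode: "sum_list xs \<le> list_encode xs"
proof (induction xs)
  case (Cons x xs)
  then show ?case using le_list_encode[of x xs] by simp
qed simp

lemma mem_le_encode: "x \<in> set xs \<Longrightarrow> x \<le> list_encode xs"
  using member_le_sum_list[of x xs] sum_list_le_encode[of xs] by simp

text \<open>A code dominates every index and every sum of exponents inside it, so the code itself is
  a degree bound. \<open>K\<close> is the weight of a variable: 1 for exponents,
  \<open>E ^ c\<close> for the degree in \<open>y\<close>.\<close>

lemma (in weight) wle_poly_of:
  assumes single: "\<And>i e. i \<le> c \<Longrightarrow> \<omega> (Poly_Mapping.single i e) \<le> e * K" and c: "encode_poly ts \<le> c"
  shows "wle \<omega> (c * K) (poly_of ts)"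
proof -
  have mono: "\<omega> (monom_of ies) \<le> c * K" if "(z, ies) \<in> set ts" for z ies
  proof -
    let ?m = "list_encode (map prod_encode ies)"
    have "prod_encode (int_encode z, ?m) \<le> encode_poly ts"
      unfolding encode_poly_def using that by (intro mem_le_encode) force
    then have mc: "?m \<le> c" using le_prod_encode_2[of ?m "int_encode z"] c by linarith
    have ie: "i \<le> c" if "(i, e) \<in> set ies" for i e
      using mem_le_encode[of "prod_encode (i, e)" "map prod_encode ies"] that le_prod_encode_1[of i e] mc by force
    have "\<omega> (monom_of ies) = (\<Sum>(i, e)\<leftarrow>ies. \<omega> (Poly_Mapping.single i e))"
      by (simp add: monom_of_def weight_sum_list comp_def split_def)
    also have "\<dots> \<le> (\<Sum>(i, e)\<leftarrow>ies. e * K)"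
      using ie single by (intro sum_list_mono) auto
    also have "\<dots> = (\<Sum>(i, e)\<leftarrow>ies. e) * K"
      using sum_list_mult_const[of "\<lambda>(i, e). e" K ies] by (simp add: split_def)
    also have "(\<Sum>(i, e)\<leftarrow>ies. e) \<le> sum_list (map prod_encode ies)"
      by (intro sum_list_mono) (auto simp: le_prod_encode_2)
    also have "sum_list (map prod_encode ies) \<le> c" using sum_list_le_encode mc order_trans by blast
    finally show ?thesis by simp
  qed
  have "wle \<omega> (c * K) (sum_list (map (\<lambda>(z, ies). Poly_Mapping.single (monom_of ies) (of_int z)) us))"
    if "set us \<subseteq> set ts" for us
    using that mono by (induction us) (auto simp: wle_0 wle_def[of _ _ "Poly_Mapping.single _ _"] intro!: wle_add split: if_splits)
  then show ?thesis by (simp add: poly_of_def)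
qed

interpretation wt: weight "wt E"
  by unfold_locales (auto simp: wt_add)

interpretation lookup_weight: weight "\<lambda>m. mlookup m i"
  by unfold_locales (auto simp: lookup_add)

lemma wle_wt_poly_of: "E > 0 \<Longrightarrow> encode_poly ts \<le> c \<Longrightarrow> wle (wt E) (c * E ^ c) (poly_of ts)"
  by (rule wt.wle_poly_of) (auto intro: power_increasing)

lemma wle_lookup_poly_of: "encode_poly ts \<le> c \<Longrightarrow> wle (\<lambda>m. mlookup m i) (c * 1) (poly_of ts)"
  by (rule lookup_weight.wle_poly_of) (auto simp: lookup_single when_def)

lemma ev_poly_of: "ev E y (poly_of ts) = of_int (\<Sum>(z, ies)\<leftarrow>ts. z * int (y ^ (\<Sum>(i, e)\<leftarrow>ies. e * E ^ i)))"
proof -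
  have "wt E (monom_of ies) = (\<Sum>(i, e)\<leftarrow>ies. e * E ^ i)" for ies
    by (simp add: monom_of_def wt.weight_sum_list comp_def split_def)
  then have "poly (kron E (Poly_Mapping.single (monom_of ies) (of_int z))) (of_nat y) =
      of_int (z * int (y ^ (\<Sum>(i, e)\<leftarrow>ies. e * E ^ i)))" for z ies
    by (simp add: poly_monom)
  then show ?thesis
    by (induction ts) (auto simp: ev_def poly_of_def kron_add)
qed

section \<open>Integer polynomials and the squares of their roots\<close>

definition lin_prod :: "complex list \<Rightarrow> complex poly" where
  "lin_prod as = (\<Prod>a\<leftarrow>as. [:- a, 1:])"

lemma lin_prod_simps [simp]: "lin_prod [] = 1" "lin_prod (a # as) = [:- a, 1:] * lin_prod as"
  by (simp_all add: lin_prod_def)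

lemma degree_lin_prod: "degree (lin_prod as) = length as" and lead_coeff_lin_prod: "lead_coeff (lin_prod as) = 1"
proof (induction as)
  case (Cons a as)
  {
    case 1
    have "lin_prod as \<noteq> 0" using Cons by force
    then show ?case using Cons by (simp add: degree_mult_eq del: mult_pCons_left)
  next
    case 2
    show ?case using Cons by (simp add: lead_coeff_mult del: mult_pCons_left)
  }
qed simp_all

lemma poly_lin_prod: "poly (lin_prod as) z = 0 \<longleftrightarrow> z \<in> set as"
  by (induction as) (auto simp del: mult_pCons_left)

lemma coeff_lin_prod_le:
  assumes "\<forall>a\<in>set as. cmod a \<le> R"
  shows "cmod (coeff (lin_prod as) i) \<le> (R + 1) ^ length as"
  using assms
proof (induction as arbitrary: i)
  case Nil
  then show ?case by (cases i) auto
next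
  case (Cons a as)
  let ?b = "(R + 1) ^ length as"
  have R: "cmod a \<le> R" using Cons.prems by auto
  have "0 \<le> R" using R norm_ge_zero[of a] by linarith
  then have b: "0 \<le> ?b" by simp
  have "cmod (a * coeff (lin_prod as) i) \<le> R * ?b"
    unfolding norm_mult using Cons R by (intro mult_mono) (auto intro: order_trans[OF norm_ge_zero R])
  moreover have "cmod (coeff (pCons 0 (lin_prod as)) i) \<le> ?b"
    using Cons b by (cases i) auto
  ultimately have "cmod (coeff (pCons 0 (lin_prod as)) i - a * coeff (lin_prod as) i) \<le> ?b + R * ?b"
    using norm_triangle_ineq4[of "coeff (pCons 0 (lin_prod as)) i" "a * coeff (lin_prod as) i"] by linarith
  then show ?case by (simp add: algebra_simps)
qed

text \<open>Factor by factor, (x - a)(-x - a) = -(x^2 - a^2).\<close>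

lemma lin_prod_squares:
  "lin_prod as * (lin_prod as \<circ>\<^sub>p [:0, - 1:]) =
     smult ((- 1) ^ length as) (lin_prod (map (\<lambda>a. a ^ 2) as) \<circ>\<^sub>p [:0, 0, 1:])"
proof (induction as)
  case (Cons a as)
  have 1: "[:- a, 1:] * ([:- a, 1:] \<circ>\<^sub>p [:0, - 1:]) = smult (- 1) ([:- (a ^ 2), 1:] \<circ>\<^sub>p [:0, 0, 1:])"
    by (simp add: pcompose_pCons power2_eq_square)
  have "lin_prod (a # as) * (lin_prod (a # as) \<circ>\<^sub>p [:0, - 1:]) =
      ([:- a, 1:] * ([:- a, 1:] \<circ>\<^sub>p [:0, - 1:])) * (lin_prod as * (lin_prod as \<circ>\<^sub>p [:0, - 1:]))"
    unfolding lin_prod_simps pcompose_mult by (simp only: ac_simps)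
  also have "\<dots> = smult ((- 1) ^ length (a # as)) (([:- (a ^ 2), 1:] \<circ>\<^sub>p [:0, 0, 1:]) *
      (lin_prod (map (\<lambda>a. a ^ 2) as) \<circ>\<^sub>p [:0, 0, 1:]))"
    unfolding 1 Cons.IH by (simp only: mult_smult_left mult_smult_right smult_smult length_Cons power_Suc mult.commute)
  also have "\<dots> = smult ((- 1) ^ length (a # as)) (lin_prod (map (\<lambda>a. a ^ 2) (a # as)) \<circ>\<^sub>p [:0, 0, 1:])"
    unfolding list.map lin_prod_simps pcompose_mult ..
  finally show ?case .
qed (simp add: pcompose_1)

section \<open>Graeffe's transform and Gauss' lemma\<close>

lemma even_odd_parts: "\<exists>e d. f = e \<circ>\<^sub>p [:0, 0, 1:] + [:0, 1:] * (d \<circ>\<^sub>p [:0, 0, 1:])"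
  for f :: "'a::comm_ring_1 poly"
proof (induction f)
  case 0
  show ?case by (intro exI[of _ 0]) simp
next
  case (pCons a f)
  then obtain e d where f: "f = e \<circ>\<^sub>p [:0, 0, 1:] + [:0, 1:] * (d \<circ>\<^sub>p [:0, 0, 1:])" by blast
  show ?case
    by (intro exI[of _ "pCons a d"] exI[of _ e]) (subst f, simp add: pcompose_pCons)
qed

text \<open>For f = e(x^2) + x d(x^2) the product f(x) f(-x) is e(x^2)^2 - x^2 d(x^2)^2, a
  polynomial in x^2. The split needs no division, so an integer polynomial has an integer
  transform.\<close>

lemma graeffe: "\<exists>g. g \<circ>\<^sub>p [:0, 0, 1:] = f * (f \<circ>\<^sub>p [:0, - 1:])"
  for f :: "'a::comm_ring_1 poly"
proof -
  obtain e d where f: "f = e \<circ>\<^sub>p [:0, 0, 1:] + [:0, 1:] * (d \<circ>\<^sub>p [:0, 0, 1:])"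
    using even_odd_parts by blast
  have sq: "[:0, 0, 1:] \<circ>\<^sub>p [:0, - 1:] = ([:0, 0, 1:] :: 'a poly)" by (simp add: pcompose_pCons)
  have m: "f \<circ>\<^sub>p [:0, - 1:] = e \<circ>\<^sub>p [:0, 0, 1:] - [:0, 1:] * (d \<circ>\<^sub>p [:0, 0, 1:])"
    by (subst f) (simp add: pcompose_add pcompose_pCons pcompose_assoc[symmetric] sq)
  have "(e * e - [:0, 1:] * (d * d)) \<circ>\<^sub>p [:0, 0, 1:] = f * (f \<circ>\<^sub>p [:0, - 1:])"
    by (subst m, subst f) (simp add: pcompose_diff pcompose_mult pcompose_pCons algebra_simps)
  then show ?thesis by blast
qed

lemma pcompose_square_inj:
  assumes "p \<circ>\<^sub>p [:0, 0, 1:] = q \<circ>\<^sub>p [:0, 0, 1:]"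
  shows "p = (q :: 'a::idom poly)"
proof -
  have "(p - q) \<circ>\<^sub>p [:0, 0, 1:] = 0" using assms by (simp add: pcompose_diff)
  then show ?thesis using pcompose_eq_0[of "p - q" "[:0, 0, 1:]"] by simp
qed

lemma pcompose_dvd: "p dvd q \<Longrightarrow> p \<circ>\<^sub>p r dvd q \<circ>\<^sub>p (r :: 'a::comm_ring_1 poly)"
  by (metis dvd_def pcompose_mult)

text \<open>With f(x) also f(-x) is primitive, hence by Gauss so is their product, and a common
  divisor of the coefficients of g would divide g(x^2). So squaring the roots really squares the
  leading coefficient, without cancellation.\<close>

lemma primitive_squares:
  assumes "content f = 1" "of_int_poly f = smult (of_int c) (lin_prod as)"
  shows "\<exists>g c'. content g = 1 \<and> \<bar>c'\<bar> = \<bar>c\<bar> ^ 2 \<and> of_int_poly g = smult (of_int c') (lin_prod (map (\<lambda>a. a ^ 2) as))"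
proof -
  obtain g where g: "g \<circ>\<^sub>p [:0, 0, 1:] = f * (f \<circ>\<^sub>p [:0, - 1:])" using graeffe by blast
  define c' where "c' = (- 1) ^ length as * c ^ 2"
  have "of_int_poly g \<circ>\<^sub>p [:0, 0, 1:] = of_int_poly f * (of_int_poly f \<circ>\<^sub>p [:0, - 1 :: complex:])"
    using arg_cong[OF g, of "of_int_poly :: int poly \<Rightarrow> complex poly"]
    by (simp add: of_int_hom.map_poly_pcompose of_int_poly_hom.hom_mult)
  also have "\<dots> = smult (of_int c ^ 2) (lin_prod as * (lin_prod as \<circ>\<^sub>p [:0, - 1:]))"
    unfolding assms(2) by (simp add: pcompose_smult power2_eq_square)
  also have "\<dots> = smult (of_int c') (lin_prod (map (\<lambda>a. a ^ 2) as)) \<circ>\<^sub>p [:0, 0, 1:]"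
    unfolding lin_prod_squares by (simp add: c'_def pcompose_smult mult.commute)
  finally have "of_int_poly g = smult (of_int c') (lin_prod (map (\<lambda>a. a ^ 2) as))"
    by (rule pcompose_square_inj)
  moreover have "\<bar>c'\<bar> = \<bar>c\<bar> ^ 2" by (simp add: c'_def abs_mult power_abs)
  moreover have "content g = 1"
  proof -
    let ?m = "f \<circ>\<^sub>p [:0, - 1:]"
    have "[:content ?m:] dvd ?m" by simp
    then have "[:content ?m:] \<circ>\<^sub>p [:0, - 1:] dvd ?m \<circ>\<^sub>p [:0, - 1:]" by (rule pcompose_dvd)
    moreover have "?m \<circ>\<^sub>p [:0, - 1:] = f"
      by (simp add: pcompose_assoc[symmetric] pcompose_pCons)
    ultimately have "content ?m dvd content f" by (simp add: const_poly_dvd_iff_dvd_content)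
    then have "content ?m = 1" using assms(1) is_unit_content_iff by metis
    have "[:content g:] dvd g" by simp
    then have "[:content g:] \<circ>\<^sub>p [:0, 0, 1:] dvd g \<circ>\<^sub>p [:0, 0, 1:]" by (rule pcompose_dvd)
    then have "content g dvd content (f * ?m)" unfolding g by (simp add: const_poly_dvd_iff_dvd_content)
    then show ?thesis
      using assms(1) \<open>content ?m = 1\<close> is_unit_content_iff by (metis content_mult mult_1)
  qed
  ultimately show ?thesis by blast
qed

lemma primitive_power_two:
  assumes "content f = 1" "of_int_poly f = smult (of_int c) (lin_prod as)"
  shows "\<exists>g c'. content g = 1 \<and> \<bar>c'\<bar> = \<bar>c\<bar> ^ 2 ^ j \<and>
    of_int_poly g = smult (of_int c') (lin_prod (map (\<lambda>a. a ^ 2 ^ j) as))"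
proof (induction j)
  case 0
  show ?case using assms by (intro exI[of _ f] exI[of _ c]) simp
next
  case (Suc j)
  then obtain g c' where g: "content g = 1" "\<bar>c'\<bar> = \<bar>c\<bar> ^ 2 ^ j"
    "of_int_poly g = smult (of_int c') (lin_prod (map (\<lambda>a. a ^ 2 ^ j) as))" by blast
  have "map (\<lambda>a. a ^ 2) (map (\<lambda>a. a ^ 2 ^ j) as) = map (\<lambda>a. a ^ 2 ^ Suc j) as"
    by (simp add: power_mult[symmetric] mult.commute)
  moreover have "\<bar>c'\<bar> ^ 2 = \<bar>c\<bar> ^ 2 ^ Suc j" unfolding g(2) by (simp add: power_mult[symmetric] mult.commute)
  ultimately show ?case using primitive_squares[OF g(1,3)] by metis
qed

text \<open>Comparing contents in e f = c h gives |e| = |c| content(h): the leading coefficient of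
  the primitive multiple is the least possible denominator.\<close>

lemma denominator_ge:
  assumes "content f = 1" "of_int_poly f = smult (of_int c) p"
    and "of_int_poly h = smult (of_int e) p" "e \<noteq> 0" "p \<noteq> (0 :: complex poly)"
  shows "\<bar>c\<bar> \<le> \<bar>e\<bar>"
proof -
  have "of_int_poly (smult e f) = (of_int_poly (smult c h) :: complex poly)"
    using assms(2,3) by (simp add: mult.commute of_int_hom.map_poly_hom_smult)
  then have "smult e f = smult c h" by (simp add: of_int_poly_hom.eq_iff)
  then have "\<bar>e\<bar> * content f = \<bar>c\<bar> * content h" using content_smult by (metis normalize_int_def abs_mult normalize_mult mult.commute)
  moreover have "h \<noteq> 0" using assms(3-5) by auto
  then have "content h \<noteq> 0" by simp
  moreover have "content h \<ge> 0" using normalize_content[of h] by (metis abs_ge_zero normalize_int_def)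
  ultimately have "\<bar>e\<bar> = \<bar>c\<bar> * content h" "1 \<le> content h"
    using assms(1) by (simp, linarith)
  then show ?thesis using mult_left_mono[of 1 "content h" "\<bar>c\<bar>"] by simp
qed

lemma monic_power_two:
  assumes "of_int_poly f = lin_prod as"
  shows "\<exists>g. of_int_poly g = lin_prod (map (\<lambda>a. a ^ 2 ^ j) as)"
proof -
  have "of_int (lead_coeff f) = lead_coeff (lin_prod as)" by (simp flip: assms)
  then have "lead_coeff f = 1" by (simp add: lead_coeff_lin_prod)
  then have "content f = 1" using content_dvd_coeff[of f "degree f"] is_unit_content_iff by metis
  from primitive_power_two[OF this, of 1 as j] assms
  obtain g c where g: "\<bar>c\<bar> = 1" "of_int_poly g = smult (of_int c) (lin_prod (map (\<lambda>a. a ^ 2 ^ j) as))" by auto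
  then have "c * c = 1" by (cases "c \<ge> 0") auto
  then have "of_int_poly (smult c g) = lin_prod (map (\<lambda>a. a ^ 2 ^ j) as)"
    using g(2) by (simp add: of_int_hom.map_poly_hom_smult flip: of_int_mult)
  then show ?thesis by blast
qed

section \<open>Finitely many integer polynomials have bounded roots\<close>

definition integral_roots :: "nat \<Rightarrow> real \<Rightarrow> complex set" where
  "integral_roots n R = {a. \<exists>f as. of_int_poly f = lin_prod as \<and> length as = n \<and>
     (\<forall>b\<in>set as. cmod b \<le> R) \<and> a \<in> set as}"

lemma finite_bounded_polys: "finite {f :: int poly. degree f \<le> n \<and> (\<forall>i. \<bar>coeff f i\<bar> \<le> K)}" (is "finite ?S")
proof -
  have "finite {xs. set xs \<subseteq> {- K..K} \<and> length xs = Suc n}" by (rule finite_lists_length_eq) simp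
  moreover have "inj_on (\<lambda>f. map (coeff f) [0..<Suc n]) ?S"
  proof (rule inj_onI)
    fix f g assume *: "f \<in> ?S" "g \<in> ?S" "map (coeff f) [0..<Suc n] = map (coeff g) [0..<Suc n]"
    show "f = g"
    proof (rule poly_eqI)
      fix i show "coeff f i = coeff g i"
      proof (cases "i \<le> n")
        case True
        then show ?thesis using *(3) by (auto simp: map_eq_conv simp del: upt_Suc)
      next
        case False
        then show ?thesis using *(1,2) by (simp add: coeff_eq_0)
      qed
    qed
  qed
  moreover have "(\<lambda>f. map (coeff f) [0..<Suc n]) ` ?S \<subseteq> {xs. set xs \<subseteq> {- K..K} \<and> length xs = Suc n}"
    by (auto simp: abs_le_iff) (metis minus_le_iff)+
  ultimately show ?thesis using finite_imageD finite_subset by blast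
qed

text \<open>A bound for the roots bounds the integer coefficients, so finitely many polynomials
  remain, each with finitely many roots.\<close>

lemma finite_integral_roots: "finite (integral_roots n R)"
proof -
  define K where "K = \<lfloor>(R + 1) ^ n\<rfloor>"
  let ?S = "{f :: int poly. degree f \<le> n \<and> (\<forall>i. \<bar>coeff f i\<bar> \<le> K)}"
  have "integral_roots n R \<subseteq> (\<Union>f\<in>{f \<in> ?S. f \<noteq> 0}. {z. poly (of_int_poly f) z = 0})"
  proof
    fix a assume "a \<in> integral_roots n R"
    then obtain f as where f: "of_int_poly f = lin_prod as" "length as = n" "\<forall>b\<in>set as. cmod b \<le> R" "a \<in> set as"
      by (auto simp: integral_roots_def)
    have "\<bar>coeff f i\<bar> \<le> K" for i
    proof -
      have "cmod (of_int (coeff f i)) \<le> (R + 1) ^ n"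
        using coeff_lin_prod_le[OF f(3), of i] f(1,2) by (metis coeff_map_poly of_int_0)
      then show ?thesis by (simp add: K_def le_floor_iff)
    qed
    moreover have "degree f = n"
      using arg_cong[OF f(1), of degree] f(2) by (simp add: degree_lin_prod)
    moreover have "f \<noteq> 0" using f(1) lead_coeff_lin_prod[of as] by auto
    ultimately show "a \<in> (\<Union>f\<in>{f \<in> ?S. f \<noteq> 0}. {z. poly (of_int_poly f) z = 0})"
      using f poly_lin_prod[of as a] by auto
  qed
  moreover have "finite {f \<in> ?S. f \<noteq> 0}" using finite_bounded_polys[of n K] by (rule rev_finite_subset) auto
  then have "finite (\<Union>f\<in>{f \<in> ?S. f \<noteq> 0}. {z. poly (of_int_poly f) z = (0 :: complex)})"
    by (rule finite_UN_I) (auto intro: poly_roots_finite)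
  ultimately show ?thesis by (rule finite_subset)
qed

lemma root_gap:
  obtains r :: real where "r > 1"
    "\<And>f as. of_int_poly f = lin_prod as \<Longrightarrow> length as = n \<Longrightarrow> \<exists>a\<in>set as. cmod a > 1 \<Longrightarrow> \<exists>a\<in>set as. cmod a \<ge> r"
proof
  \<comment> \<open>The element 2 settles the polynomials with a root beyond the disc of radius 2
    and makes \<open>Z\<close> nonempty; for all others only the finitely many roots inside the disc
    matter.\<close>
  define Z where "Z = insert 2 {x \<in> cmod ` integral_roots n 2. x > 1}"
  have Z: "finite Z" "Z \<noteq> {}" using finite_integral_roots by (auto simp: Z_def)
  show "Min Z > 1" using Z by (auto simp: Z_def)
  fix f as assume f: "of_int_poly f = lin_prod as" "length as = n" "\<exists>a\<in>set as. cmod a > 1"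
  show "\<exists>a\<in>set as. cmod a \<ge> Min Z"
  proof (cases "\<forall>b\<in>set as. cmod b \<le> 2")
    case True
    obtain a where a: "a \<in> set as" "cmod a > 1" using f by blast
    then have "cmod a \<in> Z" using f True by (auto simp: Z_def integral_roots_def)
    then show ?thesis using Z a by (auto intro: Min_le)
  next
    case False
    moreover have "Min Z \<le> 2" using Z by (intro Min_le) (auto simp: Z_def)
    ultimately show ?thesis by force
  qed
qed

text \<open>Kronecker's theorem, with one exponent for all polynomials of degree n. The iterated squares of a
  root stay in a finite set, since they are roots of the iterated Graeffe transforms.\<close>

lemma kronecker:
  obtains g :: nat where "g > 0"
    "\<And>f as a. of_int_poly f = lin_prod as \<Longrightarrow> length as = n \<Longrightarrow> \<forall>b\<in>set as. cmod b \<le> 1 \<Longrightarrow> a \<in> set as \<Longrightarrow> a ^ Suc g = a"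
proof
  define F where "F = integral_roots n 1"
  define N where "N = card F"
  have fin: "finite F" by (simp add: F_def finite_integral_roots)
  \<comment> \<open>Among the exponents \<open>2 ^ i\<close> with \<open>i \<le> N\<close> two give
    the same power, so the order of a nonzero root divides a positive number up to
    \<open>2 ^ N\<close>; the factorial is a common multiple of these. The form a^(g+1) = a includes
    the root 0.\<close>
  show "(fact (2 ^ N) :: nat) > 0" by simp
  fix f as a assume f: "of_int_poly f = lin_prod as" "length as = n" "\<forall>b\<in>set as. cmod b \<le> 1" "a \<in> set as"
  have "a ^ 2 ^ j \<in> F" for j
  proof -
    obtain g where g: "of_int_poly g = lin_prod (map (\<lambda>a. a ^ 2 ^ j) as)" using monic_power_two[OF f(1)] by blast
    show ?thesis unfolding F_def integral_roots_def
      using f g by (intro CollectI exI[of _ g] exI[of _ "map (\<lambda>a. a ^ 2 ^ j) as"]) (auto simp: norm_power power_le_one)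
  qed
  then have "(\<lambda>j. a ^ 2 ^ j) ` {..N} \<subseteq> F" by auto
  then have "card ((\<lambda>j. a ^ 2 ^ j) ` {..N}) < card {..N}" using card_mono[OF fin] by (simp add: N_def less_Suc_eq_le)
  then have "\<not> inj_on (\<lambda>j. a ^ 2 ^ j) {..N}" using pigeonhole by blast
  then obtain i j where ij: "i < j" "j \<le> N" "a ^ 2 ^ i = a ^ 2 ^ j"
    unfolding inj_on_def by (metis atMost_iff linorder_neqE_nat)
  show "a ^ Suc (fact (2 ^ N)) = a"
  proof (cases "a = 0")
    case False
    have "a ^ 2 ^ j = a ^ 2 ^ i * a ^ (2 ^ j - 2 ^ i)" using ij(1) by (simp flip: power_add)
    then have 1: "a ^ (2 ^ j - 2 ^ i) = 1" using ij(3) False by simp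
    have "(2::nat) ^ j \<le> 2 ^ N" using ij by simp
    then have "(2::nat) ^ j - 2 ^ i \<le> 2 ^ N" by linarith
    moreover have "1 \<le> (2::nat) ^ j - 2 ^ i" using ij(1) by (simp add: Suc_le_eq)
    ultimately have "(2::nat) ^ j - 2 ^ i dvd fact (2 ^ N)" by (intro dvd_fact) auto
    then obtain m where "fact (2 ^ N) = ((2::nat) ^ j - 2 ^ i) * m" by (auto elim: dvdE)
    then show ?thesis using 1 by (simp add: power_mult)
  qed simp
qed

section \<open>Powers of complex matrices\<close>

lemma smult_smult_mat: "c \<cdot>\<^sub>m (d \<cdot>\<^sub>m A) = (c * d :: 'a::comm_ring_1) \<cdot>\<^sub>m A"
  by (intro eq_matI) (auto simp: mult.assoc)

lemma one_smult_mat [simp]: "(1 :: 'a::comm_ring_1) \<cdot>\<^sub>m A = A"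
  by (intro eq_matI) auto

lemma pow_mat_add:
  assumes "A \<in> carrier_mat n n"
  shows "A ^\<^sub>m (k + l) = A ^\<^sub>m k * A ^\<^sub>m l"
proof (induction l)
  case (Suc l)
  then show ?case
    using assms assoc_mult_mat[OF pow_carrier_mat[OF assms, of k] pow_carrier_mat[OF assms, of l] assms] by simp
qed (use assms in simp)

lemma pow_mat_mult:
  assumes "A \<in> carrier_mat n n"
  shows "A ^\<^sub>m (k * l) = (A ^\<^sub>m k) ^\<^sub>m l"
proof (induction l)
  case (Suc l)
  have "A ^\<^sub>m (k * Suc l) = A ^\<^sub>m (k * l + k)" by (simp add: add.commute)
  then show ?case unfolding pow_mat_add[OF assms] using Suc by simp
qed simp

section \<open>Triangular form and eigenvalues\<close>

lemma upper_triangular_mult: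
  assumes "A \<in> carrier_mat n n" "B \<in> carrier_mat n n" "upper_triangular A" "upper_triangular B"
  shows "upper_triangular (A * B)" "\<And>i. i < n \<Longrightarrow> (A * B) $$ (i, i) = A $$ (i, i) * B $$ (i, i)"
proof -
  have *: "(A * B) $$ (i, j) = (\<Sum>l<n. A $$ (i, l) * B $$ (l, j))" if "i < n" "j < n" for i j
    using assms that by (simp add: scalar_prod_def atLeast0LessThan)
  have z: "A $$ (i, l) * B $$ (l, j) = 0" if "i < n" "l < n" "j \<le> i" "l \<noteq> i \<or> j < i" for i j l
    using assms that upper_triangularD[OF assms(3), of l i] upper_triangularD[OF assms(4), of j l]
    by (cases "l < i") auto
  show "upper_triangular (A * B)"
  proof (rule upper_triangularI)
    fix i j assume "j < i" "i < dim_row (A * B)"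
    then show "(A * B) $$ (i, j) = 0" using *[of i j] z assms by (auto intro!: sum.neutral)
  qed
  show "(A * B) $$ (i, i) = A $$ (i, i) * B $$ (i, i)" if "i < n" for i
  proof -
    have "(\<Sum>l<n. A $$ (i, l) * B $$ (l, i)) = (\<Sum>l\<in>{i}. A $$ (i, l) * B $$ (l, i))"
      using that z[of i _ i] by (intro sum.mono_neutral_right) auto
    then show ?thesis using *[OF that that] by simp
  qed
qed

lemma upper_triangular_pow:
  assumes "A \<in> carrier_mat n n" "upper_triangular A"
  shows "upper_triangular (A ^\<^sub>m k) \<and> (\<forall>i<n. (A ^\<^sub>m k) $$ (i, i) = (A $$ (i, i)) ^ k)"
proof (induction k)
  case (Suc k)
  then show ?case
    using upper_triangular_mult[OF pow_carrier_mat[OF assms(1), of k] assms(1) _ assms(2)] assms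
    by (simp add: power_commutes)
qed (use assms in auto)

text \<open>Each factor moves the zero pattern one diagonal further up, and after \<open>n\<close>
  factors nothing is left.\<close>

lemma nilpotent_upper_triangular:
  assumes A: "A \<in> carrier_mat n n" and z: "\<And>i j. i < n \<Longrightarrow> j \<le> i \<Longrightarrow> A $$ (i, j) = 0"
  shows "A ^\<^sub>m n = 0\<^sub>m n n"
proof -
  have "(A ^\<^sub>m k) $$ (i, j) = 0" if "i < n" "j < n" "j < i + k" for i j k
    using that
  proof (induction k arbitrary: i j)
    case (Suc k)
    have "(A ^\<^sub>m Suc k) $$ (i, j) = (\<Sum>l<n. (A ^\<^sub>m k) $$ (i, l) * A $$ (l, j))"
      using A Suc.prems by (simp add: scalar_prod_def atLeast0LessThan)
    also have "\<dots> = 0"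
    proof (intro sum.neutral ballI)
      fix l assume "l \<in> {..<n}"
      then show "(A ^\<^sub>m k) $$ (i, l) * A $$ (l, j) = 0"
        using Suc z[of l j] by (cases "l < i + k") auto
    qed
    finally show ?case .
  qed (use A in auto)
  then show ?thesis using A by (intro eq_matI) auto
qed

text \<open>Everything is read off a Schur form, whose diagonal lists the eigenvalues with
  multiplicity. The scalar \<open>c\<close> is there for clearing denominators before integer
  characteristic polynomials are formed. In the last claim the triangular form of A^(g+1) - A has
  diagonal 0.\<close>

lemma eigenvalue_list:
  fixes A :: "complex mat"
  assumes A: "A \<in> carrier_mat n n"
  obtains as where "length as = n" "\<And>c k. char_poly (c \<cdot>\<^sub>m (A ^\<^sub>m k)) = lin_prod (map (\<lambda>a. c * a ^ k) as)"
    "\<And>a. a \<in> set as \<Longrightarrow> eigenvalue A a"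
    "\<And>g. \<forall>a\<in>set as. a ^ Suc g = a \<Longrightarrow> (A ^\<^sub>m Suc g - A) ^\<^sub>m n = 0\<^sub>m n n"
proof -
  obtain bs where bs: "char_poly A = (\<Prod>a\<leftarrow>bs. [:- a, 1:])" using char_poly_factorized[OF A] by blast
  then obtain B where B: "B \<in> carrier_mat n n" "upper_triangular B" "similar_mat A B"
    using schur_decomposition_exists[OF A] by blast
  then obtain P Q where w: "similar_mat_wit A B P Q" by (auto simp: similar_mat_def)
  note w' = similar_mat_witD2[OF A w]
  define as where "as = diag_mat B"
  have len: "length as = n" using B by (simp add: as_def diag_mat_def)
  have cp: "char_poly (c \<cdot>\<^sub>m (A ^\<^sub>m k)) = lin_prod (map (\<lambda>a. c * a ^ k) as)" for c k
  proof -
    have "similar_mat (A ^\<^sub>m k) (B ^\<^sub>m k)" using similar_mat_wit_pow[OF w] by (auto simp: similar_mat_def)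
    then have "similar_mat (c \<cdot>\<^sub>m (A ^\<^sub>m k)) (c \<cdot>\<^sub>m (B ^\<^sub>m k))" by (rule similar_mat_smult)
    then have "char_poly (c \<cdot>\<^sub>m (A ^\<^sub>m k)) = char_poly (c \<cdot>\<^sub>m (B ^\<^sub>m k))" by (rule char_poly_similar)
    also have "\<dots> = lin_prod (diag_mat (c \<cdot>\<^sub>m (B ^\<^sub>m k)))"
      unfolding lin_prod_def
      by (rule char_poly_upper_triangular[of _ n])
        (use B upper_triangular_pow[OF B(1,2), of k] in
          \<open>auto intro!: upper_triangularI simp: upper_triangularD[of "B ^\<^sub>m k"]\<close>)
    also have "diag_mat (c \<cdot>\<^sub>m (B ^\<^sub>m k)) = map (\<lambda>a. c * a ^ k) as"
      using B upper_triangular_pow[OF B(1,2), of k]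
      by (intro nth_equalityI) (auto simp: as_def diag_mat_def)
    finally show ?thesis .
  qed
  have "char_poly A = lin_prod as" using cp[of 1 1] A by simp
  then have ev: "eigenvalue A a" if "a \<in> set as" for a
    using that eigenvalue_root_char_poly[OF A] poly_lin_prod by metis
  have nil: "(A ^\<^sub>m Suc g - A) ^\<^sub>m n = 0\<^sub>m n n" if g: "\<forall>a\<in>set as. a ^ Suc g = a" for g
  proof -
    let ?C = "B ^\<^sub>m Suc g - B"
    have C: "?C \<in> carrier_mat n n" using B by auto
    have "B $$ (i, i) \<in> set as" if "i < n" for i using that B by (auto simp: as_def diag_mat_def)
    then have "?C ^\<^sub>m n = 0\<^sub>m n n"
      using upper_triangular_pow[OF B(1,2), of "Suc g"] B g
      by (intro nilpotent_upper_triangular[OF C]) 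
        (auto simp: le_less upper_triangularD[of "B ^\<^sub>m Suc g"] upper_triangularD[of B] simp del: pow_mat.simps)
    moreover have "similar_mat_wit (A ^\<^sub>m Suc g - A) ?C P Q"
    proof (rule similar_mat_witI[of _ _ n])
      have e1: "A ^\<^sub>m Suc g = P * B ^\<^sub>m Suc g * Q" by (rule similar_mat_wit_pow_id[OF w])
      have e2: "P * ?C * Q = P * B ^\<^sub>m Suc g * Q - P * B * Q"
        using mult_minus_distrib_mat[OF w'(6) pow_carrier_mat[OF B(1)] B(1), of "Suc g"]
          minus_mult_distrib_mat[OF mult_carrier_mat[OF w'(6) pow_carrier_mat[OF B(1)]] mult_carrier_mat[OF w'(6) B(1)] w'(7), of "Suc g"]
        by (simp only:)
      show "A ^\<^sub>m Suc g - A = P * ?C * Q" unfolding e1 e2 w'(3)[symmetric] ..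
    qed (use w'(1,2,6,7) A C in auto)
    then have "(A ^\<^sub>m Suc g - A) ^\<^sub>m n = P * ?C ^\<^sub>m n * Q" by (rule similar_mat_wit_pow_id)
    ultimately show ?thesis using w'(6,7) by simp
  qed
  show ?thesis using that[OF len cp ev nil] .
qed

section \<open>Integral matrices and denominators\<close>

definition integral_mat :: "complex mat \<Rightarrow> bool" where
  "integral_mat M \<longleftrightarrow> (\<exists>N :: int mat. N \<in> carrier_mat (dim_row M) (dim_col M) \<and> M = of_int_hom.mat_hom N)"

lemma integral_mat_mult:
  "M \<in> carrier_mat n n \<Longrightarrow> M' \<in> carrier_mat n n \<Longrightarrow> integral_mat M \<Longrightarrow> integral_mat M' \<Longrightarrow> integral_mat (M * M')"
  unfolding integral_mat_def
proof (elim exE conjE)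
  fix N N' :: "int mat"
  assume "M \<in> carrier_mat n n" "M' \<in> carrier_mat n n" "N \<in> carrier_mat (dim_row M) (dim_col M)"
    "M = of_int_hom.mat_hom N" "N' \<in> carrier_mat (dim_row M') (dim_col M')" "M' = of_int_hom.mat_hom N'"
  then show "\<exists>N. N \<in> carrier_mat (dim_row (M * M')) (dim_col (M * M')) \<and> M * M' = of_int_hom.mat_hom N"
    by (intro exI[of _ "N * N'"]) (auto simp: of_int_hom.mat_hom_mult[of N n n N' n])
qed

lemma integral_mat_one: "integral_mat (1\<^sub>m n)"
  unfolding integral_mat_def by (intro exI[of _ "1\<^sub>m n"]) (simp add: of_int_hom.mat_hom_one)

lemma integral_mat_minus:
  "M \<in> carrier_mat n n \<Longrightarrow> M' \<in> carrier_mat n n \<Longrightarrow> integral_mat M \<Longrightarrow> integral_mat M' \<Longrightarrow> integral_mat (M - M')"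
  unfolding integral_mat_def
proof (elim exE conjE)
  fix N N' :: "int mat"
  assume "M \<in> carrier_mat n n" "M' \<in> carrier_mat n n" "N \<in> carrier_mat (dim_row M) (dim_col M)"
    "M = of_int_hom.mat_hom N" "N' \<in> carrier_mat (dim_row M') (dim_col M')" "M' = of_int_hom.mat_hom N'"
  then show "\<exists>N. N \<in> carrier_mat (dim_row (M - M')) (dim_col (M - M')) \<and> M - M' = of_int_hom.mat_hom N"
    by (intro exI[of _ "N - N'"]) auto
qed

lemma integral_mat_smult: "integral_mat M \<Longrightarrow> integral_mat (of_int c \<cdot>\<^sub>m M)"
  unfolding integral_mat_def
proof (elim exE conjE)
  fix N :: "int mat"
  assume "N \<in> carrier_mat (dim_row M) (dim_col M)" "M = of_int_hom.mat_hom N"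
  then show "\<exists>N. N \<in> carrier_mat (dim_row (of_int c \<cdot>\<^sub>m M)) (dim_col (of_int c \<cdot>\<^sub>m M)) \<and> of_int c \<cdot>\<^sub>m M = of_int_hom.mat_hom N"
    by (intro exI[of _ "c \<cdot>\<^sub>m N"]) auto
qed

lemma integral_mat_smult_mult:
  assumes "M \<in> carrier_mat n n" "M' \<in> carrier_mat n n" "integral_mat (of_int c \<cdot>\<^sub>m M)" "integral_mat (of_int c' \<cdot>\<^sub>m M')"
  shows "integral_mat (of_int (c * c') \<cdot>\<^sub>m (M * M'))"
proof -
  have "of_int (c * c') \<cdot>\<^sub>m (M * M') = (of_int c \<cdot>\<^sub>m M) * (of_int c' \<cdot>\<^sub>m M')"
    using assms(1,2) by (simp add: mult_smult_assoc_mat[of _ n n] mult_smult_distrib[of _ n n]) (simp add: smult_smult_mat mult.commute)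
  then show ?thesis using integral_mat_mult[OF _ _ assms(3,4), of n] assms(1,2) by simp
qed

lemma integral_mat_pow:
  assumes "M \<in> carrier_mat n n" "integral_mat (of_int c \<cdot>\<^sub>m M)"
  shows "integral_mat (of_int (c ^ k) \<cdot>\<^sub>m (M ^\<^sub>m k))"
proof (induction k)
  case (Suc k)
  show ?case using integral_mat_smult_mult[OF pow_carrier_mat[OF assms(1)] assms(1) Suc assms(2)]
    by (simp add: mult.commute)
qed (use assms integral_mat_one in simp)

text \<open>The characteristic polynomial of the integer matrix e M has the roots e a; substituting
  e x for x turns it into e^n times the monic polynomial with the roots a.\<close>

lemma smult_lin_prod_integral:
  assumes M: "M \<in> carrier_mat n n" and int: "integral_mat (of_int e \<cdot>\<^sub>m M)"
    and as: "char_poly (of_int e \<cdot>\<^sub>m M) = lin_prod (map (\<lambda>a. of_int e * a) as)" and len: "length as = n"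
  shows "\<exists>h. of_int_poly h = smult (of_int (e ^ n)) (lin_prod as)"
proof -
  obtain N :: "int mat" where N: "N \<in> carrier_mat n n" "of_int e \<cdot>\<^sub>m M = of_int_hom.mat_hom N"
    using int M by (auto simp: integral_mat_def)
  have cp: "of_int_poly (char_poly N) = lin_prod (map (\<lambda>a. of_int e * a) as)"
    unfolding as[symmetric] N(2) by (rule of_int_hom.char_poly_hom[OF N(1), symmetric])
  have "lin_prod (map (\<lambda>a. of_int e * a) as) \<circ>\<^sub>p [:0, of_int e:] = smult (of_int e ^ length as) (lin_prod as)"
  proof (induction as)
    case (Cons a as)
    have "[:- (of_int e * a), 1:] \<circ>\<^sub>p [:0, of_int e:] = smult (of_int e) [:- a, 1:]"
      by (simp add: pcompose_pCons)
    then show ?case unfolding list.map lin_prod_simps pcompose_mult Cons.IH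
      by (simp only: mult_smult_left mult_smult_right smult_smult length_Cons power_Suc mult.commute)
  qed (simp add: pcompose_1)
  then have "of_int_poly (char_poly N \<circ>\<^sub>p [:0, e:]) = smult (of_int (e ^ n)) (lin_prod as)"
    using len by (simp add: of_int_hom.map_poly_pcompose cp of_int_hom.map_poly_pCons_hom)
  then show ?thesis by blast
qed

text \<open>Let c be the leading coefficient of the primitive integer multiple of the characteristic polynomial, so
  c is at least 2 in modulus. By repeated squaring, c^(2^j) divides the n-th power of any denominator of
  A^(2^j), but these denominators are at most a constant times D^(2^j / k).\<close>

lemma nonintegral_exponent_bound:
  fixes A :: "complex mat" and D :: nat
  assumes A: "A \<in> carrier_mat n n" and dA: "integral_mat (of_int d \<cdot>\<^sub>m A)" "d \<noteq> 0"
    and as: "length as = n" "\<And>c k. char_poly (c \<cdot>\<^sub>m (A ^\<^sub>m k)) = lin_prod (map (\<lambda>a. c * a ^ k) as)"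
    and non: "\<nexists>f. of_int_poly f = lin_prod as"
    and B: "A ^\<^sub>m k = B" "integral_mat (of_int (int D) \<cdot>\<^sub>m B)" "D > 0"
  shows "2 ^ k < 2 * D ^ n"
proof (rule ccontr)
  assume "\<not> 2 ^ k < 2 * D ^ n"
  then have big: "2 * D ^ n \<le> 2 ^ k" by simp
  have "D ^ n \<ge> 1" using B(3) by simp
  then have k: "k > 0" using big by (cases k) auto
  obtain h where h: "of_int_poly h = smult (of_int (d ^ n)) (lin_prod as)"
    using smult_lin_prod_integral[OF A dA(1) _ as(1)] as(2)[of "of_int d" 1] A by auto
  have h0: "h \<noteq> 0" using h dA(2) lead_coeff_lin_prod[of as] by auto
  define f where "f = primitive_part h"
  have f1: "content f = 1" using h0 by (simp add: f_def)
  have hf: "smult (content h) f = h" by (simp add: f_def)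
  define c where "c = lead_coeff f"
  have fc: "of_int_poly f = smult (of_int c) (lin_prod as)"
  proof -
    have "smult (of_int (content h)) (of_int_poly f) = (of_int_poly h :: complex poly)"
      unfolding of_int_hom.map_poly_hom_smult[symmetric] hf ..
    then have eq: "smult (of_int (content h)) (of_int_poly f) = smult (of_int (d ^ n)) (lin_prod as)"
      using h by simp
    have "of_int_poly f = smult (inverse (of_int (content h))) (smult (of_int (content h)) (of_int_poly f :: complex poly))"
      using h0 by simp
    then have *: "of_int_poly f = smult (of_int (d ^ n) / of_int (content h)) (lin_prod as)"
      unfolding eq by (simp add: field_simps)
    have "of_int c = (of_int (d ^ n) / of_int (content h) :: complex)"
      using arg_cong[OF *, of lead_coeff] by (simp add: c_def lead_coeff_lin_prod)
    then show ?thesis using * by simp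
  qed
  \<comment> \<open>A leading coefficient 1 or -1 would make \<open>f\<close> or \<open>- f\<close>
    a monic integer polynomial with the roots \<open>as\<close>.\<close>
  have "\<bar>c\<bar> \<noteq> 1"
  proof
    assume "\<bar>c\<bar> = 1"
    then have "c * c = 1" by (cases "c \<ge> 0") auto
    then have "of_int_poly (smult c f) = lin_prod as"
      using fc by (simp add: of_int_hom.map_poly_hom_smult flip: of_int_mult)
    then show False using non by blast
  qed
  moreover have "c \<noteq> 0" using f1 by (auto simp: c_def)
  ultimately have c2: "\<bar>c\<bar> \<ge> 2" by linarith
  \<comment> \<open>The share of the remainder A^r, r < k, in the denominator of A^(2^j), raised to
    the power \<open>n\<close> and independent of \<open>j\<close>.\<close>
  define C where "C = nat \<bar>d\<bar> ^ (k * n)"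
  have main: "2 ^ (2 ^ j) \<le> (D ^ n) ^ (2 ^ j div k) * C" for j
  proof -
    let ?q = "2 ^ j div k" and ?r = "2 ^ j mod k"
    define e where "e = int D ^ ?q * d ^ k"
    have r: "?r \<le> k" using k by (simp add: less_imp_le)
    have Apow: "A ^\<^sub>m (2 ^ j) = B ^\<^sub>m ?q * A ^\<^sub>m ?r"
    proof -
      have "A ^\<^sub>m (k * m) = B ^\<^sub>m m" for m
        using pow_mat_mult[OF A] B(1) by simp
      then show ?thesis using pow_mat_add[OF A, of "k * ?q" ?r] by simp
    qed
    have "integral_mat (of_int (d ^ (k - ?r)) \<cdot>\<^sub>m (of_int (d ^ ?r) \<cdot>\<^sub>m (A ^\<^sub>m ?r)))"
      by (intro integral_mat_smult integral_mat_pow[OF A dA(1)])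
    moreover have "d ^ (k - ?r) * d ^ ?r = d ^ k" using r by (simp flip: power_add)
    ultimately have iA: "integral_mat (of_int (d ^ k) \<cdot>\<^sub>m (A ^\<^sub>m ?r))"
      by (simp only: smult_smult_mat of_int_mult[symmetric])
    have Bc: "B \<in> carrier_mat n n" using B(1) A by auto
    have "integral_mat (of_int e \<cdot>\<^sub>m (A ^\<^sub>m (2 ^ j)))"
      unfolding Apow e_def
      by (rule integral_mat_smult_mult[OF _ _ integral_mat_pow[OF Bc B(2)] iA]) (use A Bc in auto)
    then obtain h' where h': "of_int_poly h' = smult (of_int (e ^ n)) (lin_prod (map (\<lambda>a. a ^ (2 ^ j)) as))"
      using smult_lin_prod_integral[OF pow_carrier_mat[OF A], of e "2 ^ j" "map (\<lambda>a. a ^ (2 ^ j)) as"] as by (auto simp: comp_def)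
    obtain g c' where g: "content g = 1" "\<bar>c'\<bar> = \<bar>c\<bar> ^ 2 ^ j" "of_int_poly g = smult (of_int c') (lin_prod (map (\<lambda>a. a ^ 2 ^ j) as))"
      using primitive_power_two[OF f1 fc] by blast
    have "e ^ n \<noteq> 0" using B(3) dA(2) by (simp add: e_def)
    moreover have "lin_prod (map (\<lambda>a. a ^ 2 ^ j) as) \<noteq> 0" using lead_coeff_lin_prod[of "map (\<lambda>a. a ^ 2 ^ j) as"] by auto
    ultimately have "\<bar>c'\<bar> \<le> \<bar>e ^ n\<bar>" using denominator_ge[OF g(1,3) h'] by simp
    moreover have "(2::int) ^ 2 ^ j \<le> \<bar>c\<bar> ^ 2 ^ j" using c2 by (rule power_mono) simp
    ultimately have "(2::int) ^ 2 ^ j \<le> \<bar>e ^ n\<bar>" using g(2) by linarith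
    also have "\<bar>e ^ n\<bar> = int ((D ^ n) ^ ?q * C)"
      by (simp add: e_def C_def abs_mult power_abs power_mult_distrib flip: power_mult) (simp add: mult.commute)
    finally have "int (2 ^ 2 ^ j) \<le> int ((D ^ n) ^ ?q * C)" by simp
    then show ?thesis by (simp only: of_nat_le_iff)
  qed
  \<comment> \<open>Chosen so large that \<open>C \<le> ?q\<close>. Multiplying \<open>main\<close>
    by \<open>2 ^ ?q\<close> and using \<open>big\<close> then leads to
    \<open>2 ^ ?q \<le> C\<close>, which is absurd.\<close>
  define j where "j = k + C"
  let ?q = "2 ^ j div k"
  have "k * C \<le> 2 ^ k * 2 ^ C" by (intro mult_le_mono) (simp_all add: less_imp_le)
  then have "C \<le> ?q" using k by (simp add: j_def power_add less_eq_div_iff_mult_less_eq mult.commute)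
  have "2 ^ ?q * 2 ^ 2 ^ j \<le> 2 ^ ?q * ((D ^ n) ^ ?q * C)" using main[of j] by simp
  also have "\<dots> = (2 * D ^ n) ^ ?q * C" by (simp add: power_mult_distrib)
  also have "\<dots> \<le> (2 ^ k) ^ ?q * C" using big by (intro mult_le_mono power_mono) auto
  also have "(2 ^ k) ^ ?q = (2::nat) ^ (k * ?q)" by (simp add: power_mult)
  also have "(2::nat) ^ (k * ?q) * C \<le> 2 ^ 2 ^ j * C" by (intro mult_le_mono power_increasing) auto
  finally have "2 ^ ?q \<le> C" by (simp add: mult.commute)
  moreover have "?q < 2 ^ ?q" by simp
  ultimately show False using \<open>C \<le> ?q\<close> by linarith
qed

text \<open>Read at a coordinate of largest modulus, the equation M v = a v bounds |a| by the sum of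
  the moduli in a row.\<close>

lemma eigenvalue_norm_le:
  fixes M :: "complex mat"
  assumes M: "M \<in> carrier_mat n n" and v: "eigenvector M v a" and K: "\<And>i j. i < n \<Longrightarrow> j < n \<Longrightarrow> cmod (M $$ (i, j)) \<le> K"
  shows "cmod a \<le> n * K"
proof -
  have vc: "v \<in> carrier_vec n" "v \<noteq> 0\<^sub>v n" "M *\<^sub>v v = a \<cdot>\<^sub>v v"
    using v M by (auto simp: eigenvector_def)
  have n: "n > 0" using vc by (cases n) auto
  define x where "x = Max ((\<lambda>i. cmod (v $ i)) ` {..<n})"
  have "x \<in> (\<lambda>i. cmod (v $ i)) ` {..<n}" unfolding x_def using n by (intro Max_in) auto
  then obtain i where i: "i < n" "x = cmod (v $ i)" by auto
  have le: "cmod (v $ j) \<le> x" if "j < n" for j using that by (auto simp: x_def intro: Max_ge)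
  have "x > 0"
  proof (rule ccontr)
    assume "\<not> x > 0"
    then have "v $ j = 0" if "j < n" for j using le[OF that] norm_ge_zero[of "v $ j"] by (smt (verit) norm_eq_zero)
    then show False using vc by (auto intro!: eq_vecI)
  qed
  have "K \<ge> 0" using K[OF n n] norm_ge_zero order_trans by blast
  have "a * v $ i = (\<Sum>j<n. M $$ (i, j) * v $ j)"
    using arg_cong[OF vc(3), of "\<lambda>w. w $ i"] i M vc(1) by (simp add: scalar_prod_def atLeast0LessThan)
  then have "cmod a * x = cmod (\<Sum>j<n. M $$ (i, j) * v $ j)" using i by (metis norm_mult)
  also have "\<dots> \<le> (\<Sum>j<n. K * x)"
    using K[OF i(1)] le \<open>K \<ge> 0\<close> by (intro sum_norm_le) (auto simp: norm_mult intro!: mult_mono)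
  finally show ?thesis using \<open>x > 0\<close> by simp
qed

section \<open>An explicit bound for the exponent\<close>

text \<open>With \<open>T \<ge> n\<close> a matrix product costs one extra factor \<open>T\<close>,
  and with \<open>T \<ge> 2\<close> so does a difference; estimates become a count of
  exponents.\<close>

locale entry_bounds =
  fixes n :: nat and T :: real
  assumes T2: "T \<ge> 2" and Tn: "T \<ge> real n"
begin

definition small :: "nat \<Rightarrow> complex mat \<Rightarrow> bool" where
  "small c M \<longleftrightarrow> M \<in> carrier_mat n n \<and> (\<forall>i<n. \<forall>j<n. cmod (M $$ (i, j)) \<le> T ^ c)"

lemma small_mono: "small c M \<Longrightarrow> c \<le> c' \<Longrightarrow> small c' M"
  using T2 power_increasing[of c c' T] unfolding small_def by (meson order_trans one_le_numeral)

lemma small_one: "small 0 (1\<^sub>m n)"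
  by (auto simp: small_def)

lemma small_mult:
  assumes "small c M" "small c' M'"
  shows "small (c + c' + 1) (M * M')"
proof -
  have "cmod ((M * M') $$ (i, j)) \<le> T ^ (c + c' + 1)" if "i < n" "j < n" for i j
  proof -
    have "(M * M') $$ (i, j) = (\<Sum>l<n. M $$ (i, l) * M' $$ (l, j))"
      using assms that by (auto simp: small_def scalar_prod_def atLeast0LessThan)
    also have "cmod \<dots> \<le> (\<Sum>l<n. T ^ c * T ^ c')"
      using assms that T2 by (intro sum_norm_le) (auto simp: small_def norm_mult intro!: mult_mono)
    also have "\<dots> = real n * T ^ (c + c')" by (simp add: power_add)
    also have "\<dots> \<le> T * T ^ (c + c')" using Tn T2 by (intro mult_right_mono) auto
    finally show ?thesis by simp
  qed
  then show ?thesis using assms by (auto simp: small_def)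
qed

lemma small_minus:
  assumes "small c M" "small c M'"
  shows "small (c + 1) (M - M')"
proof -
  have "cmod ((M - M') $$ (i, j)) \<le> T ^ (c + 1)" if "i < n" "j < n" for i j
  proof -
    have "cmod ((M - M') $$ (i, j)) \<le> cmod (M $$ (i, j)) + cmod (M' $$ (i, j))"
      using assms that norm_triangle_ineq4 by (auto simp: small_def)
    also have "\<dots> \<le> T ^ c + T ^ c" using assms that by (intro add_mono) (auto simp: small_def)
    also have "\<dots> \<le> T * T ^ c" using T2 mult_right_mono[of 2 T "T ^ c"] by simp
    finally show ?thesis by simp
  qed
  then show ?thesis using assms by (auto simp: small_def)
qed

lemma small_pow:
  assumes "small c M"
  shows "small ((c + 1) * k) (M ^\<^sub>m k)"
proof (induction k)
  case 0
  then show ?case using small_one assms by (auto simp: small_def)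
next
  case (Suc k)
  from small_mult[OF this assms] show ?case by (simp add: algebra_simps)
qed

end

lemma integral_entry_ge_1:
  assumes "integral_mat M" "i < dim_row M" "j < dim_col M" "M $$ (i, j) \<noteq> 0"
  shows "cmod (M $$ (i, j)) \<ge> 1"
proof -
  obtain N :: "int mat" where N: "N \<in> carrier_mat (dim_row M) (dim_col M)" "M = of_int_hom.mat_hom N"
    using assms by (auto simp: integral_mat_def)
  then have "M $$ (i, j) = of_int (N $$ (i, j))" using assms(2,3) by (subst N(2)) auto
  then show ?thesis using assms(4) by simp
qed

text \<open>Here all eigenvalues are 0 or g-th roots of unity. For N = A^g - 1 and s maximal with
  A^n N^s nonzero, multiplying B^g = (1 + N)^k by A^n N^(s-1) leaves only the terms of degree at most 1
  in N, and k can be read off.\<close>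

lemma unipotent_exponent_bound:
  fixes A B :: "complex mat" and H :: real
  assumes A: "A \<in> carrier_mat n n" and B: "A ^\<^sub>m k = B"
    and nil: "(A ^\<^sub>m Suc g - A) ^\<^sub>m n = 0\<^sub>m n n" and ne: "A ^\<^sub>m (n + g) \<noteq> A ^\<^sub>m n"
    and dA: "integral_mat (of_int d \<cdot>\<^sub>m A)" "d \<noteq> 0" "\<bar>of_int d\<bar> \<le> H"
    and H: "H \<ge> 1" "\<And>i j. i < n \<Longrightarrow> j < n \<Longrightarrow> cmod (A $$ (i, j)) \<le> H"
      "\<And>i j. i < n \<Longrightarrow> j < n \<Longrightarrow> cmod (B $$ (i, j)) \<le> H"
  shows "real k \<le> (H + real n + 1) ^ (n + g * n + (2 * n + (2 * g + 2) * n + 1 + 2 * g + 2))"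
proof -
  define T where "T = H + real n + 1"
  interpret entry_bounds n T by unfold_locales (use H in \<open>auto simp: T_def\<close>)
  define N where "N = A ^\<^sub>m g - 1\<^sub>m n"
  have Nc: "N \<in> carrier_mat n n" unfolding N_def by (rule minus_carrier_mat) simp
  have Bc: "B \<in> carrier_mat n n" using A B by auto
  define P where "P s = A ^\<^sub>m n * N ^\<^sub>m s" for s
  have Pc: "P s \<in> carrier_mat n n" for s using A Nc by (auto simp: P_def)
  have AN: "A * N = A ^\<^sub>m Suc g - A" "N * A = A ^\<^sub>m Suc g - A"
  proof -
    have "A * A ^\<^sub>m g = A ^\<^sub>m Suc g" using pow_mat_add[OF A, of 1 g] A by simp
    then show "A * N = A ^\<^sub>m Suc g - A"
      using mult_minus_distrib_mat[OF A pow_carrier_mat[OF A, of g], of "1\<^sub>m n"] A by (simp add: N_def)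
    show "N * A = A ^\<^sub>m Suc g - A"
      using minus_mult_distrib_mat[OF pow_carrier_mat[OF A, of g] _ A, of "1\<^sub>m n"] A by (simp add: N_def)
  qed
  have comm: "N ^\<^sub>m m * A = A * N ^\<^sub>m m" for m
  proof (induction m)
    case (Suc m)
    have "N ^\<^sub>m Suc m * A = N ^\<^sub>m m * (N * A)" using assoc_mult_mat[OF pow_carrier_mat[OF Nc] Nc A] by simp
    also have "\<dots> = N ^\<^sub>m m * A * N" using assoc_mult_mat[OF pow_carrier_mat[OF Nc] A Nc] AN by simp
    also have "\<dots> = A * N ^\<^sub>m Suc m" using Suc assoc_mult_mat[OF A pow_carrier_mat[OF Nc] Nc] by simp
    finally show ?case .
  qed (use A Nc in auto)
  \<comment> \<open>A and N commute, so the nilpotency of A N says \<open>P n = 0\<close>. The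
    factor A^n in \<open>P\<close> removes the generalised kernel of A, on which N is
    invertible.\<close>
  have "(A * N) ^\<^sub>m m = A ^\<^sub>m m * N ^\<^sub>m m" for m
  proof (induction m)
    case (Suc m)
    let ?a = "A ^\<^sub>m m" and ?b = "N ^\<^sub>m m"
    have c: "?a \<in> carrier_mat n n" "?b \<in> carrier_mat n n" using A Nc by auto
    have "(A * N) ^\<^sub>m Suc m = ?a * ?b * (A * N)" using Suc by simp
    also have "\<dots> = ?a * (?b * A * N)"
      using c A Nc assoc_mult_mat[OF c(1) c(2), of "A * N" n] assoc_mult_mat[OF c(2) A Nc] by simp
    also have "\<dots> = ?a * (A * (?b * N))" unfolding comm using assoc_mult_mat[OF A c(2) Nc] by simp
    also have "\<dots> = A ^\<^sub>m Suc m * N ^\<^sub>m Suc m"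
      using assoc_mult_mat[OF c(1) A, of "?b * N" n] c Nc by simp
    finally show ?case .
  qed (use A Nc in auto)
  from this[of n] have Pn: "P n = 0\<^sub>m n n" using nil AN by (simp add: P_def)
  have P1: "P 1 \<noteq> 0\<^sub>m n n"
  proof
    assume "P 1 = 0\<^sub>m n n"
    moreover have "P 1 = A ^\<^sub>m (n + g) - A ^\<^sub>m n"
      using mult_minus_distrib_mat[OF pow_carrier_mat[OF A, of n] pow_carrier_mat[OF A, of g], of "1\<^sub>m n"]
        pow_mat_add[OF A, of n g] A Nc by (simp add: P_def N_def)
    ultimately have z: "A ^\<^sub>m (n + g) - A ^\<^sub>m n = 0\<^sub>m n n" by simp
    have "A ^\<^sub>m (n + g) = A ^\<^sub>m n"
    proof (rule eq_matI)
      fix i j assume "i < dim_row (A ^\<^sub>m n)" "j < dim_col (A ^\<^sub>m n)"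
      then have "i < n" "j < n" using A by auto
      then show "(A ^\<^sub>m (n + g)) $$ (i, j) = (A ^\<^sub>m n) $$ (i, j)"
        using arg_cong[OF z, of "\<lambda>M. M $$ (i, j)"] A by simp
    qed (use A in auto)
    with ne show False ..
  qed
  have P0: "P 0 \<noteq> 0\<^sub>m n n"
  proof
    assume "P 0 = 0\<^sub>m n n"
    then have "A ^\<^sub>m n = 0\<^sub>m n n" using A Nc by (simp add: P_def)
    then show False using P1 Nc by (simp add: P_def)
  qed
  define t where "t = (LEAST t. P t = 0\<^sub>m n n)"
  have t: "P t = 0\<^sub>m n n" "t \<le> n"
    unfolding t_def by (rule LeastI[where P = "\<lambda>t. P t = 0\<^sub>m n n", OF Pn], rule Least_le, rule Pn)
  have t_min: "P s \<noteq> 0\<^sub>m n n" if "s < t" for s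
    using not_less_Least[of s "\<lambda>t. P t = 0\<^sub>m n n"] that unfolding t_def by blast
  \<comment> \<open>\<open>P 1\<close> is A^(n+g) - A^n, nonzero by \<open>ne\<close>. So
    \<open>P (t - 2)\<close> exists and can serve as \<open>X\<close>: then X N is nonzero and X N N
    is 0, which makes the binomial expansion linear in the exponent.\<close>
  have "t \<noteq> 0" "t \<noteq> 1" using t(1) P0 P1 by auto
  then obtain s where s: "t = Suc (Suc s)" by (metis One_nat_def not0_implies_Suc)
  define X where "X = P s"
  have Xc: "X \<in> carrier_mat n n" by (simp add: X_def Pc)
  have PN: "P m * N = P (Suc m)" for m
    unfolding P_def using assoc_mult_mat[OF pow_carrier_mat[OF A, of n] pow_carrier_mat[OF Nc, of m] Nc] by simp
  have XN: "X * N = P (Suc s)" "X * N \<noteq> 0\<^sub>m n n" "X * N * N = 0\<^sub>m n n"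
    using PN[of s] PN[of "Suc s"] t t_min[of "Suc s"] s by (auto simp: X_def)
  have XNc: "X * N \<in> carrier_mat n n" using Xc Nc by auto
  have Ag: "A ^\<^sub>m g = 1\<^sub>m n + N" using A by (intro eq_matI) (auto simp: N_def)
  have lin: "X * (A ^\<^sub>m g) ^\<^sub>m m = X + of_nat m \<cdot>\<^sub>m (X * N)" for m
  proof (induction m)
    case 0
    then show ?case using Xc XNc A by (intro eq_matI) auto
  next
    case (Suc m)
    let ?Y = "X + of_nat m \<cdot>\<^sub>m (X * N)"
    have Yc: "?Y \<in> carrier_mat n n" using XNc Xc by simp
    have gc: "A ^\<^sub>m g \<in> carrier_mat n n" using A by simp
    have "X * (A ^\<^sub>m g) ^\<^sub>m Suc m = ?Y * (1\<^sub>m n + N)"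
      using assoc_mult_mat[OF Xc pow_carrier_mat[OF gc, of m] gc] Suc Ag by simp
    also have "\<dots> = ?Y + ?Y * N"
      using mult_add_distrib_mat[OF Yc one_carrier_mat Nc] right_mult_one_mat[OF Yc] by simp
    also have "?Y * N = X * N"
      using add_mult_distrib_mat[OF Xc smult_carrier_mat[OF XNc] Nc, of "of_nat m"]
        mult_smult_assoc_mat[OF XNc Nc, of "of_nat m"] XN XNc by simp
    also have "?Y + X * N = X + of_nat (Suc m) \<cdot>\<^sub>m (X * N)"
      using Xc XNc by (intro eq_matI) (auto simp: algebra_simps)
    finally show ?case .
  qed
  have "(A ^\<^sub>m g) ^\<^sub>m k = B ^\<^sub>m g"
    unfolding B[symmetric] pow_mat_mult[OF A, symmetric] by (simp add: mult.commute)
  then have key: "X * B ^\<^sub>m g = X + of_nat k \<cdot>\<^sub>m (X * N)" using lin[of k] by simp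
  obtain i j where ij: "i < n" "j < n" "(X * N) $$ (i, j) \<noteq> 0"
    using XN(2) XNc by (metis eq_matI carrier_matD index_zero_mat)
  \<comment> \<open>A denominator of X N. A nonzero entry of X N thus has modulus at least 1/|e|,
    and dividing the entry of X B^g - X by it bounds k.\<close>
  define e where "e = d ^ n * (d ^ g) ^ (Suc s)"
  have "integral_mat (of_int (d ^ g) \<cdot>\<^sub>m N)"
  proof -
    have "of_int (d ^ g) \<cdot>\<^sub>m N = of_int (d ^ g) \<cdot>\<^sub>m (A ^\<^sub>m g) - of_int (d ^ g) \<cdot>\<^sub>m 1\<^sub>m n"
      using A by (intro eq_matI) (auto simp: N_def algebra_simps)
    then show ?thesis
      using integral_mat_minus[OF _ _ integral_mat_pow[OF A dA(1), of g] integral_mat_smult[OF integral_mat_one[of n]], of n "d ^ g"] A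
      by simp
  qed
  then have "integral_mat (of_int e \<cdot>\<^sub>m P (Suc s))"
    unfolding P_def e_def
    by (intro integral_mat_smult_mult[OF _ _ integral_mat_pow[OF A dA(1)] integral_mat_pow[OF Nc]]) (use A Nc in auto)
  then have "cmod (of_int e * (X * N) $$ (i, j)) \<ge> 1"
    using integral_entry_ge_1[of "of_int e \<cdot>\<^sub>m (X * N)" i j] ij XNc dA(2) XN(1) by (simp add: e_def)
  then have e1: "1 \<le> \<bar>of_int e\<bar> * cmod ((X * N) $$ (i, j))" by (simp add: norm_mult)
  have dT: "\<bar>of_int d :: real\<bar> \<le> T" using dA by (simp add: T_def)
  have eT: "\<bar>of_int e\<bar> \<le> T ^ (n + g * n)"
  proof -
    have "\<bar>of_int e :: real\<bar> = \<bar>of_int d\<bar> ^ (n + g * Suc s)"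
      by (simp add: e_def abs_mult power_abs power_add power_mult)
    also have "\<dots> \<le> T ^ (n + g * Suc s)" using dT by (intro power_mono) auto
    also have "\<dots> \<le> T ^ (n + g * n)" using T2 t(2) s by (intro power_increasing add_left_mono mult_le_mono) auto
    finally show ?thesis .
  qed
  have "H \<le> T ^ 1" by (simp add: T_def)
  then have sA: "small 1 A" "small 1 B"
    unfolding small_def using A Bc order_trans[OF H(2)] order_trans[OF H(3)] by blast+
  have "small (2 * g) (A ^\<^sub>m g)" "small (2 * n) (A ^\<^sub>m n)" "small (2 * g) (B ^\<^sub>m g)"
    using small_pow[OF sA(1), of g] small_pow[OF sA(1), of n] small_pow[OF sA(2), of g] by (simp_all add: numeral_2_eq_2)
  note sp = this
  have "small (2 * g + 1) N" unfolding N_def by (intro small_minus sp small_mono[OF small_one]) simp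
  then have "small ((2 * g + 2) * s) (N ^\<^sub>m s)" using small_pow by fastforce
  then have "small ((2 * g + 2) * n) (N ^\<^sub>m s)" 
    by (rule small_mono) (use t(2) s in \<open>intro mult_le_mono2, linarith\<close>)
  then have sX: "small (2 * n + (2 * g + 2) * n + 1) X" unfolding X_def P_def by (intro small_mult sp)
  have "small (2 * n + (2 * g + 2) * n + 1 + 2 * g + 1) (X * B ^\<^sub>m g)" by (intro small_mult sX sp)
  moreover have "small (2 * n + (2 * g + 2) * n + 1 + 2 * g + 1) X" by (rule small_mono[OF sX]) simp
  ultimately have "small (2 * n + (2 * g + 2) * n + 1 + 2 * g + 1 + 1) (X * B ^\<^sub>m g - X)" by (rule small_minus)
  then have "cmod ((X * B ^\<^sub>m g - X) $$ (i, j)) \<le> T ^ (2 * n + (2 * g + 2) * n + 1 + 2 * g + 2)"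
    using ij by (simp add: small_def)
  moreover have "(X * B ^\<^sub>m g - X) $$ (i, j) = of_nat k * (X * N) $$ (i, j)"
    unfolding key using ij carrier_matD[OF Xc] carrier_matD[OF XNc] by (simp del: index_mult_mat)
  ultimately have kT: "real k * cmod ((X * N) $$ (i, j)) \<le> T ^ (2 * n + (2 * g + 2) * n + 1 + 2 * g + 2)"
    by (simp add: norm_mult)
  have "real k \<le> real k * (\<bar>of_int e\<bar> * cmod ((X * N) $$ (i, j)))"
    using e1 mult_left_mono[of 1 _ "real k"] by simp
  also have "\<dots> = \<bar>of_int e\<bar> * (real k * cmod ((X * N) $$ (i, j)))" by simp
  also have "\<dots> \<le> T ^ (n + g * n) * T ^ (2 * n + (2 * g + 2) * n + 1 + 2 * g + 2)"
    using eT kT T2 by (intro mult_mono) auto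
  finally show ?thesis unfolding power_add[symmetric] T_def[symmetric] .
qed

text \<open>The inequality A^(n+g) \<noteq> A^n says that A^g is not the identity on the image of
  A^n, the stable image of a possibly singular A. All numerical data are measured by the single
  number \<open>H\<close>.\<close>

definition exponent_bounded :: "nat \<Rightarrow> nat \<Rightarrow> (real \<Rightarrow> real) \<Rightarrow> bool" where
  "exponent_bounded n g F \<longleftrightarrow> (\<forall>(A :: complex mat) d D H k. A \<in> carrier_mat n n \<longrightarrow> A ^\<^sub>m (n + g) \<noteq> A ^\<^sub>m n \<longrightarrow>
     integral_mat (of_int d \<cdot>\<^sub>m A) \<longrightarrow> d \<noteq> 0 \<longrightarrow> \<bar>of_int d\<bar> \<le> H \<longrightarrow>
     integral_mat (of_int (int D) \<cdot>\<^sub>m (A ^\<^sub>m k)) \<longrightarrow> D > 0 \<longrightarrow> real D \<le> H \<longrightarrow>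
     (\<forall>i<n. \<forall>j<n. cmod (A $$ (i, j)) \<le> H \<and> cmod ((A ^\<^sub>m k) $$ (i, j)) \<le> H) \<longrightarrow> real k \<le> F H)"

lemma exponent_bounded_exists:
  "\<exists>g>0. \<exists>C c. exponent_bounded n g (\<lambda>H. C * (H + real n + 1) ^ c)"
proof -
  obtain g :: nat where g: "g > 0"
    "\<And>f as a. of_int_poly f = lin_prod as \<Longrightarrow> length as = n \<Longrightarrow> \<forall>b\<in>set as. cmod b \<le> 1 \<Longrightarrow> a \<in> set as \<Longrightarrow> a ^ Suc g = a"
    using kronecker by blast
  obtain r :: real where r: "r > 1"
    "\<And>f as. of_int_poly f = lin_prod as \<Longrightarrow> length as = n \<Longrightarrow> \<exists>a\<in>set as. cmod a > 1 \<Longrightarrow> \<exists>a\<in>set as. cmod a \<ge> r"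
    using root_gap by blast
  \<comment> \<open>The exponent of the unipotent case, the largest of the three cases. In
    \<open>C\<close>, the 2 comes from the bound 2 D^n for nonintegral characteristic polynomials
    and n/(r - 1) from the case of an eigenvalue outside the unit disc.\<close>
  define c where "c = n + g * n + (2 * n + (2 * g + 2) * n + 1 + 2 * g + 2)"
  define C where "C = 2 + real n / (r - 1)"
  have C: "C \<ge> 2" "C \<ge> real n / (r - 1)" using r by (auto simp: C_def)
  have "exponent_bounded n g (\<lambda>H. C * (H + real n + 1) ^ c)"
    unfolding exponent_bounded_def
  proof (intro allI impI)
    fix A :: "complex mat" and d D H k
    assume A: "A \<in> carrier_mat n n" "A ^\<^sub>m (n + g) \<noteq> A ^\<^sub>m n"
      and d: "integral_mat (of_int d \<cdot>\<^sub>m A)" "d \<noteq> 0" "\<bar>of_int d\<bar> \<le> H"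
      and D: "integral_mat (of_int (int D) \<cdot>\<^sub>m (A ^\<^sub>m k))" "D > 0" "real D \<le> H"
      and "\<forall>i<n. \<forall>j<n. cmod (A $$ (i, j)) \<le> H \<and> cmod ((A ^\<^sub>m k) $$ (i, j)) \<le> H"
    then have H: "\<And>i j. i < n \<Longrightarrow> j < n \<Longrightarrow> cmod (A $$ (i, j)) \<le> H"
      "\<And>i j. i < n \<Longrightarrow> j < n \<Longrightarrow> cmod ((A ^\<^sub>m k) $$ (i, j)) \<le> H" by blast+
    define T where "T = H + real n + 1"
    have H1: "H \<ge> 1" using D by linarith
    have T1: "T \<ge> 1" "T \<ge> H" using H1 by (auto simp: T_def)
    obtain as where as: "length as = n" "\<And>c k. char_poly (c \<cdot>\<^sub>m (A ^\<^sub>m k)) = lin_prod (map (\<lambda>a. c * a ^ k) as)"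
      "\<And>a. a \<in> set as \<Longrightarrow> eigenvalue A a"
      "\<And>g. \<forall>a\<in>set as. a ^ Suc g = a \<Longrightarrow> (A ^\<^sub>m Suc g - A) ^\<^sub>m n = 0\<^sub>m n n"
      using eigenvalue_list[OF A(1)] by blast
    have fin: "real k \<le> C * T ^ c" if "real k \<le> C * T ^ c'" "c' \<le> c" for c'
    proof -
      have "T ^ c' \<le> T ^ c" using T1 that by (intro power_increasing) auto
      then have "C * T ^ c' \<le> C * T ^ c" using C by (intro mult_left_mono) auto
      then show ?thesis using that by linarith
    qed
    show "real k \<le> C * (H + real n + 1) ^ c"
    proof (cases "\<exists>f. of_int_poly f = lin_prod as")
      case False
      have "2 ^ k < 2 * D ^ n" by (rule nonintegral_exponent_bound[OF A(1) d(1,2) as(1,2) False refl D(1,2)])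
      moreover have "k < 2 ^ k" by simp
      ultimately have "real k \<le> real (2 * D ^ n)" by (intro of_nat_mono) linarith
      also have "\<dots> \<le> 2 * T ^ n" using D T1 by (auto intro!: power_mono)
      also have "\<dots> \<le> C * T ^ n" using C T1 by (intro mult_right_mono) auto
      finally show ?thesis using fin[of n] by (simp add: c_def T_def)
    next
      case True
      then obtain f where f: "of_int_poly f = lin_prod as" by blast
      show ?thesis
      proof (cases "\<exists>a\<in>set as. cmod a > 1")
        case True
        then obtain a where a: "a \<in> set as" "cmod a \<ge> r" using r(2)[OF f as(1)] by blast
        then obtain v where v: "eigenvector A v a" using as(3) by (auto simp: eigenvalue_def)
        have "eigenvector (A ^\<^sub>m k) v (a ^ k)"
          using v eigenvector_pow[OF A(1) v, of k] A by (auto simp: eigenvector_def)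
        from eigenvalue_norm_le[OF _ this H(2)] A have "cmod a ^ k \<le> real n * H" by (auto simp: norm_power)
        moreover have "r ^ k \<le> cmod a ^ k" using a r(1) by (intro power_mono) auto
        \<comment> \<open>Linear growth of r^k is enough here and avoids logarithms, as the
          unipotent case forces a polynomial bound anyway.\<close>
        moreover have "1 + real k * (r - 1) \<le> (1 + (r - 1)) ^ k" using r(1) by (intro Bernoulli_inequality) auto
        ultimately have "real k * (r - 1) \<le> real n * H" by simp
        then have "real k \<le> real n / (r - 1) * H" using r(1) by (simp add: field_simps)
        also have "\<dots> \<le> C * T" using C T1 H1 r(1) by (intro mult_mono) auto
        finally show ?thesis using fin[of 1] by (simp add: c_def T_def)
      next
        case False
        then have "\<forall>b\<in>set as. cmod b \<le> 1" by force
        then have "(A ^\<^sub>m Suc g - A) ^\<^sub>m n = 0\<^sub>m n n" using g(2)[OF f as(1)] by (intro as(4)) blast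
        from unipotent_exponent_bound[OF A(1) refl this A(2) d H1 H]
        have "real k \<le> T ^ c" by (simp add: T_def c_def)
        also have "\<dots> \<le> C * T ^ c" using C T1 mult_right_mono[of 1 C "T ^ c"] by simp
        finally show ?thesis by (simp add: T_def)
      qed
    qed
  qed
  then show ?thesis using g(1) by blast
qed

section \<open>Integer matrices over a common denominator\<close>

lemma abs_det_le:
  fixes M :: "int mat"
  assumes "M \<in> carrier_mat m m" "\<And>i j. i < m \<Longrightarrow> j < m \<Longrightarrow> \<bar>M $$ (i, j)\<bar> \<le> h"
  shows "\<bar>det M\<bar> \<le> fact m * h ^ m"
proof -
  have "\<bar>det M\<bar> \<le> (\<Sum>p | p permutes {0..<m}. \<bar>signof p * (\<Prod>i = 0..<m. M $$ (i, p i))\<bar>)"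
    unfolding det_def'[OF assms(1)] by (rule sum_abs)
  also have "\<dots> \<le> (\<Sum>p | p permutes {0..<m}. h ^ m)"
  proof (rule sum_mono)
    fix p assume "p \<in> {p. p permutes {0..<m}}"
    then have p: "p i < m" if "i < m" for i using that permutes_in_image[of p "{0..<m}" i] by auto
    have "\<bar>signof p * (\<Prod>i = 0..<m. M $$ (i, p i))\<bar> = (\<Prod>i = 0..<m. \<bar>M $$ (i, p i)\<bar>)"
      by (simp add: abs_mult abs_prod sign_def)
    also have "\<dots> \<le> (\<Prod>i = 0..<m. h)" using assms(2) p by (intro prod_mono) auto
    finally show "\<bar>signof p * (\<Prod>i = 0..<m. M $$ (i, p i))\<bar> \<le> h ^ m" by simp
  qed
  also have "\<dots> = fact m * h ^ m" by (simp add: card_permutations)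
  finally show ?thesis .
qed

lemma abs_adj_mat_le:
  fixes M :: "int mat"
  assumes "M \<in> carrier_mat n n" "\<And>i j. i < n \<Longrightarrow> j < n \<Longrightarrow> \<bar>M $$ (i, j)\<bar> \<le> h" "h \<ge> 1" "i < n" "j < n"
  shows "\<bar>adj_mat M $$ (i, j)\<bar> \<le> fact n * h ^ n"
proof -
  have c: "mat_delete M j i \<in> carrier_mat (n - 1) (n - 1)" using assms(1) by (intro mat_delete_carrier)
  have "\<bar>det (mat_delete M j i)\<bar> \<le> fact (n - 1) * h ^ (n - 1)"
  proof (rule abs_det_le[OF c])
    fix k l assume kl: "k < n - 1" "l < n - 1"
    then show "\<bar>mat_delete M j i $$ (k, l)\<bar> \<le> h"
      using assms(1) by (auto simp: mat_delete_def intro!: assms(2))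
  qed
  also have "\<dots> \<le> fact n * h ^ n"
    using assms(3) by (intro mult_mono fact_mono power_increasing) auto
  finally show ?thesis using assms by (simp add: adj_mat_def cofactor_def abs_mult power_abs)
qed

text \<open>The matrix whose power is taken is A/d; \<open>L\<close> and \<open>R\<close> have been
  scaled by a common factor. Only \<open>L\<close> has to be invertible, \<open>A\<close> may be
  singular.\<close>

definition int_exponent_bounded :: "nat \<Rightarrow> nat \<Rightarrow> (nat \<Rightarrow> nat) \<Rightarrow> bool" where
  "int_exponent_bounded n g F \<longleftrightarrow> (\<forall>(A :: int mat) L R d k h.
     A \<in> carrier_mat n n \<longrightarrow> L \<in> carrier_mat n n \<longrightarrow> R \<in> carrier_mat n n \<longrightarrow>
     A ^\<^sub>m k * L = d ^ k \<cdot>\<^sub>m R \<longrightarrow> A ^\<^sub>m (n + g) \<noteq> d ^ g \<cdot>\<^sub>m (A ^\<^sub>m n) \<longrightarrow> d \<noteq> 0 \<longrightarrow> det L \<noteq> 0 \<longrightarrow> \<bar>d\<bar> \<le> int h \<longrightarrow>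
     (\<forall>i<n. \<forall>j<n. \<bar>A $$ (i, j)\<bar> \<le> int h \<and> \<bar>L $$ (i, j)\<bar> \<le> int h \<and> \<bar>R $$ (i, j)\<bar> \<le> int h) \<longrightarrow> k \<le> F h)"

text \<open>Cramer's rule: (A/d)^k = R L^(-1) = R adj(L) / det L, so |det L| is a denominator of the
  power, and its entries are at most those of R adj(L).\<close>

theorem int_exponent_bounded_exists:
  "\<exists>g>0. \<exists>C c. int_exponent_bounded n g (\<lambda>h. C * (fact (n + 1) * h ^ (n + 1) + n + 1) ^ c)"
proof -
  obtain g c C where g: "g > 0" and bound: "exponent_bounded n g (\<lambda>H. C * (H + real n + 1) ^ c)"
    using exponent_bounded_exists by blast
  have "int_exponent_bounded n g (\<lambda>h. nat \<lceil>C\<rceil> * (fact (n + 1) * h ^ (n + 1) + n + 1) ^ c)"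
    unfolding int_exponent_bounded_def
  proof (intro allI impI)
    fix A L R :: "int mat" and d k h
    assume A: "A \<in> carrier_mat n n" and L: "L \<in> carrier_mat n n" and R: "R \<in> carrier_mat n n"
      and eq: "A ^\<^sub>m k * L = d ^ k \<cdot>\<^sub>m R" and ne: "A ^\<^sub>m (n + g) \<noteq> d ^ g \<cdot>\<^sub>m (A ^\<^sub>m n)"
      and d: "d \<noteq> 0" "\<bar>d\<bar> \<le> int h" and det: "det L \<noteq> 0"
      and "\<forall>i<n. \<forall>j<n. \<bar>A $$ (i, j)\<bar> \<le> int h \<and> \<bar>L $$ (i, j)\<bar> \<le> int h \<and> \<bar>R $$ (i, j)\<bar> \<le> int h"
    then have le: "\<bar>A $$ (i, j)\<bar> \<le> int h \<and> \<bar>L $$ (i, j)\<bar> \<le> int h \<and> \<bar>R $$ (i, j)\<bar> \<le> int h"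
      if "i < n" "j < n" for i j using that by blast
    have h1: "h \<ge> 1" using d by linarith
    let ?c = "of_int_hom.mat_hom :: int mat \<Rightarrow> complex mat"
    let ?d = "of_int d :: complex"
    define A0 where "A0 = inverse ?d \<cdot>\<^sub>m ?c A"
    have cA: "?c A \<in> carrier_mat n n" using A by simp
    have A0: "A0 \<in> carrier_mat n n" using A by (simp add: A0_def)
    have pow: "?d ^ m \<cdot>\<^sub>m (A0 ^\<^sub>m m) = ?c (A ^\<^sub>m m)" for m
    proof (induction m)
      case (Suc m)
      have "?d ^ Suc m \<cdot>\<^sub>m (A0 ^\<^sub>m Suc m) = (?d ^ m \<cdot>\<^sub>m (A0 ^\<^sub>m m)) * (?d \<cdot>\<^sub>m A0)"
        using mult_smult_assoc_mat[OF pow_carrier_mat[OF A0, of m] smult_carrier_mat[OF A0], of "?d ^ m" ?d]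
          mult_smult_distrib[OF pow_carrier_mat[OF A0, of m] A0, of ?d]
        by (simp add: smult_smult_mat mult.commute)
      also have "?d \<cdot>\<^sub>m A0 = ?c A" using d by (simp add: A0_def smult_smult_mat)
      finally show ?case
        unfolding Suc by (simp add: of_int_hom.mat_hom_mult[OF pow_carrier_mat[OF A, of m] A])
    qed (use A A0 in \<open>simp add: of_int_hom.mat_hom_one\<close>)
    have inj: "x = y" if "?d ^ m \<cdot>\<^sub>m x = ?d ^ m \<cdot>\<^sub>m y" for x y m
    proof -
      have "inverse (?d ^ m) \<cdot>\<^sub>m (?d ^ m \<cdot>\<^sub>m x) = inverse (?d ^ m) \<cdot>\<^sub>m (?d ^ m \<cdot>\<^sub>m y)" using that by simp
      then show ?thesis using d by (simp add: smult_smult_mat)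
    qed
    define B where "B = A0 ^\<^sub>m k"
    have Bc: "B \<in> carrier_mat n n" using A0 by (simp add: B_def)
    note adj = adj_mat[OF L]
    have BL: "B * ?c L = ?c R"
    proof (rule inj)
      have "?d ^ k \<cdot>\<^sub>m (B * ?c L) = ?c (A ^\<^sub>m k) * ?c L"
        using mult_smult_assoc_mat[OF Bc, of "?c L" n "?d ^ k"] L pow[of k] by (simp add: B_def)
      also have "\<dots> = ?c (A ^\<^sub>m k * L)"
        by (rule of_int_hom.mat_hom_mult[OF pow_carrier_mat[OF A] L, symmetric])
      also have "\<dots> = ?d ^ k \<cdot>\<^sub>m ?c R" unfolding eq using R by (intro eq_matI) auto
      finally show "?d ^ k \<cdot>\<^sub>m (B * ?c L) = ?d ^ k \<cdot>\<^sub>m ?c R" .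
    qed
    have Badj: "of_int (det L) \<cdot>\<^sub>m B = ?c (R * adj_mat L)"
    proof -
      have "?c (R * adj_mat L) = B * ?c L * ?c (adj_mat L)"
        unfolding BL by (rule of_int_hom.mat_hom_mult[OF R adj(1)])
      also have "\<dots> = B * ?c (L * adj_mat L)"
        unfolding of_int_hom.mat_hom_mult[OF L adj(1)]
        by (rule assoc_mult_mat[of _ n n _ n _ n]) (use Bc L adj(1) in auto)
      also have "?c (L * adj_mat L) = of_int (det L) \<cdot>\<^sub>m 1\<^sub>m n"
        unfolding adj(2) by (intro eq_matI) auto
      also have "B * (of_int (det L) \<cdot>\<^sub>m 1\<^sub>m n) = of_int (det L) \<cdot>\<^sub>m B"
        using mult_smult_distrib[OF Bc one_carrier_mat, of "of_int (det L)"] Bc by simp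
      finally show ?thesis by simp
    qed
    define D where "D = nat \<bar>det L\<bar>"
    have D0: "D > 0" using det by (simp add: D_def)
    \<comment> \<open>Dominates |d| \<le> h, |det L| \<le> n! h^n, and the entries of R adj(L),
      which are at most n h n! h^n.\<close>
    define H where "H = (fact (n + 1) * h ^ (n + 1) :: nat)"
    have hH: "fact n * h ^ n \<le> H" "h \<le> H" "n * (h * (fact n * h ^ n)) \<le> H"
    proof -
      have "fact n * h ^ n * 1 \<le> fact n * h ^ n * ((n + 1) * h)" using h1 by (intro mult_le_mono) auto
      then show "fact n * h ^ n \<le> H" by (simp add: H_def algebra_simps)
      have "h ^ 1 \<le> h ^ (n + 1)" using h1 by (intro power_increasing) auto
      moreover have "1 * h ^ (n + 1) \<le> H" unfolding H_def by (intro mult_le_mono) (simp_all only: fact_ge_1 order_refl)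
      ultimately show "h \<le> H" by (simp only: power_one_right mult_1)
      show "n * (h * (fact n * h ^ n)) \<le> H" by (simp add: H_def algebra_simps)
    qed
    have intB: "integral_mat (of_int (int D) \<cdot>\<^sub>m B)"
    proof -
      have i: "integral_mat (of_int (det L) \<cdot>\<^sub>m B)"
        unfolding Badj using R adj(1) by (auto simp: integral_mat_def intro!: exI[of _ "R * adj_mat L"])
      have "of_int (int D) \<cdot>\<^sub>m B = of_int (sgn (det L)) \<cdot>\<^sub>m (of_int (det L) \<cdot>\<^sub>m B)"
        by (simp add: D_def smult_smult_mat sgn_mult_abs mult.commute flip: of_int_mult) (simp add: abs_sgn)
      then show ?thesis using integral_mat_smult[OF i] by simp
    qed
    have entB: "cmod (B $$ (i, j)) \<le> real H" if ij: "i < n" "j < n" for i j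
    proof -
      have "of_int (det L) * B $$ (i, j) = of_int ((R * adj_mat L) $$ (i, j))"
        using arg_cong[OF Badj, of "\<lambda>M. M $$ (i, j)"] ij Bc R adj(1) by simp
      then have "\<bar>of_int (det L)\<bar> * cmod (B $$ (i, j)) = \<bar>of_int ((R * adj_mat L) $$ (i, j))\<bar>"
        by (metis norm_mult norm_of_int)
      moreover have "1 * cmod (B $$ (i, j)) \<le> \<bar>of_int (det L)\<bar> * cmod (B $$ (i, j))"
        using det by (intro mult_right_mono) auto
      moreover have "\<bar>(R * adj_mat L) $$ (i, j)\<bar> \<le> int H"
      proof -
        have "(R * adj_mat L) $$ (i, j) = (\<Sum>l<n. R $$ (i, l) * adj_mat L $$ (l, j))"
          using R adj(1) ij by (simp add: scalar_prod_def atLeast0LessThan)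
        also have "\<bar>\<dots>\<bar> \<le> (\<Sum>l<n. \<bar>R $$ (i, l) * adj_mat L $$ (l, j)\<bar>)" by (rule sum_abs)
        also have "\<dots> \<le> (\<Sum>l<n. int h * (fact n * int h ^ n))"
          using le ij h1 by (intro sum_mono) (auto simp: abs_mult intro!: mult_mono abs_adj_mat_le[OF L])
        also have "\<dots> = int (n * (h * (fact n * h ^ n)))" by simp
        also have "\<dots> \<le> int H" using hH(3) by (simp only: of_nat_le_iff)
        finally show ?thesis .
      qed
      then have "\<bar>of_int ((R * adj_mat L) $$ (i, j))\<bar> \<le> real H" by linarith
      ultimately show ?thesis by linarith
    qed
    have entA: "cmod (A0 $$ (i, j)) \<le> real H" if ij: "i < n" "j < n" for i j
    proof -
      have "?d * A0 $$ (i, j) = of_int (A $$ (i, j))" using ij A d by (simp add: A0_def)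
      then have "\<bar>of_int d\<bar> * cmod (A0 $$ (i, j)) = \<bar>of_int (A $$ (i, j))\<bar>"
        by (metis norm_mult norm_of_int)
      moreover have "1 * cmod (A0 $$ (i, j)) \<le> \<bar>of_int d\<bar> * cmod (A0 $$ (i, j))"
        using d by (intro mult_right_mono) auto
      moreover have "\<bar>A $$ (i, j)\<bar> \<le> int H" using le[OF ij] hH(2) by linarith
      then have "\<bar>of_int (A $$ (i, j))\<bar> \<le> real H" by linarith
      ultimately show ?thesis by linarith
    qed
    have DH: "real D \<le> real H"
    proof -
      have "\<bar>det L\<bar> \<le> fact n * int h ^ n" using abs_det_le[OF L, of "int h"] le by blast
      also have "\<dots> = int (fact n * h ^ n)" by simp
      also have "\<dots> \<le> int H" using hH(1) by (simp only: of_nat_le_iff)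
      finally show ?thesis by (simp add: D_def)
    qed
    have neA: "A0 ^\<^sub>m (n + g) \<noteq> A0 ^\<^sub>m n"
    proof
      assume *: "A0 ^\<^sub>m (n + g) = A0 ^\<^sub>m n"
      have "?c (A ^\<^sub>m (n + g)) = ?d ^ g \<cdot>\<^sub>m (?d ^ n \<cdot>\<^sub>m (A0 ^\<^sub>m n))"
        using pow[of "n + g"] unfolding * by (simp add: smult_smult_mat power_add mult.commute)
      also have "\<dots> = ?c (d ^ g \<cdot>\<^sub>m (A ^\<^sub>m n))" unfolding pow by (intro eq_matI) auto
      finally have "A ^\<^sub>m (n + g) = d ^ g \<cdot>\<^sub>m (A ^\<^sub>m n)" by (rule of_int_hom.mat_hom_inj)
      then show False using ne by blast
    qed
    have intA: "integral_mat (?d \<cdot>\<^sub>m A0)"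
      using d A by (auto simp: A0_def smult_smult_mat integral_mat_def)
    have "real k \<le> C * (real H + real n + 1) ^ c"
      using bound[unfolded exponent_bounded_def, rule_format, OF A0 neA intA d(1) _ intB[unfolded B_def] D0 DH]
        entA entB[unfolded B_def] d(2) hH(2) by fastforce
    also have "\<dots> \<le> real (nat \<lceil>C\<rceil>) * (real H + real n + 1) ^ c"
      by (intro mult_right_mono) (auto simp: real_nat_ceiling_ge)
    also have "\<dots> = real (nat \<lceil>C\<rceil> * (H + n + 1) ^ c)" by (simp add: ac_simps)
    finally show "k \<le> nat \<lceil>C\<rceil> * (fact (n + 1) * h ^ (n + 1) + n + 1) ^ c"
      unfolding H_def by (simp only: of_nat_le_iff)
  qed
  then show ?thesis using g by blast
qed

section \<open>Evaluating encoded matrices\<close>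

definition evalc :: "nat \<Rightarrow> nat \<Rightarrow> nat \<Rightarrow> int" where
  "evalc E y c = (\<Sum>t\<leftarrow>list_decode c. int_decode (pfst t) *
     int (y ^ (\<Sum>s\<leftarrow>list_decode (psnd t). psnd s * E ^ pfst s)))"

lemma pfst_encode [simp]: "pfst (prod_encode x) = fst x" and psnd_encode [simp]: "psnd (prod_encode x) = snd x"
  by (simp_all add: pfst_def psnd_def)

lemma evalc_encode: "of_int (evalc E y (encode_poly ts)) = ev E y (poly_of ts)"
  unfolding evalc_def encode_poly_def ev_poly_of by (simp add: comp_def split_def)

lemma PRI_evalc:
  assumes "PR E" "PR y" "PR c"
  shows "PRI (\<lambda>\<sigma>. evalc (E \<sigma>) (y \<sigma>) (c \<sigma>))"
  unfolding evalc_def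
  by (intro PRI_sum_list PRI_mult PRI_decode PRI_int PR_power PR_sum_list PR_mult PR_pfst PR_psnd PR_var
      PR_shift[OF assms(2)] PR_shift2[OF assms(1)] assms(3))

definition pairs :: "nat \<Rightarrow> (nat \<times> nat) set" where "pairs n = {..<n} \<times> {..<n}"

definition ent :: "nat \<Rightarrow> nat \<Rightarrow> nat \<Rightarrow> nat" where "ent a i j = lnth (lnth a i) j"

text \<open>The matrix over its common denominator, which is the product of the denominators of all entries.\<close>

definition num :: "nat \<Rightarrow> nat \<Rightarrow> nat \<Rightarrow> nat \<Rightarrow> nat \<Rightarrow> nat \<Rightarrow> int" where
  "num n E y a i j = evalc E y (pfst (ent a i j)) *
     (\<Prod>x\<in>pairs n - {(i, j)}. evalc E y (psnd (ent a (fst x) (snd x))))"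

definition den :: "nat \<Rightarrow> nat \<Rightarrow> nat \<Rightarrow> nat \<Rightarrow> int" where
  "den n E y a = (\<Prod>x\<in>pairs n. evalc E y (psnd (ent a (fst x) (snd x))))"

text \<open>For s = False the relation is A^k = B, for s = True it is A^k B = 1; both have the form A^k L = R.\<close>

definition lft :: "nat \<Rightarrow> bool \<Rightarrow> nat \<Rightarrow> nat \<Rightarrow> nat \<Rightarrow> nat \<Rightarrow> nat \<Rightarrow> int" where
  "lft n s E y b i j = (if s then num n E y b i j else if i = j then den n E y b else 0)"

definition rgt :: "nat \<Rightarrow> bool \<Rightarrow> nat \<Rightarrow> nat \<Rightarrow> nat \<Rightarrow> nat \<Rightarrow> nat \<Rightarrow> int" where
  "rgt n s E y b i j = lft n (\<not> s) E y b i j"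

text \<open>Any common bound of the entries and denominators can serve as \<open>h\<close>; a sum is
  easier to compute than a maximum.\<close>

definition height :: "nat \<Rightarrow> nat \<Rightarrow> nat \<Rightarrow> nat \<Rightarrow> nat \<Rightarrow> nat" where
  "height n E y a b = nat \<bar>den n E y a\<bar> + nat \<bar>den n E y b\<bar> +
     (\<Sum>x\<in>pairs n. nat \<bar>num n E y a (fst x) (snd x)\<bar> + nat \<bar>num n E y b (fst x) (snd x)\<bar>)"

definition related :: "nat \<Rightarrow> bool \<Rightarrow> nat \<Rightarrow> nat \<Rightarrow> nat \<Rightarrow> nat \<Rightarrow> nat \<Rightarrow> bool" where
  "related n s E y a b k \<longleftrightarrow> (\<forall>x\<in>pairs n.
     (\<Sum>l<n. mpow n (\<lambda>i j. num n E y a i j) k (fst x) l * lft n s E y b l (snd x)) =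
       den n E y a ^ k * rgt n s E y b (fst x) (snd x))"

text \<open>For polynomial relations with at most m factors, kbase is a Kronecker base exceeding all exponents, and ybound is a
  bound for the degree after the substitution.\<close>

definition wbound :: "nat \<Rightarrow> nat \<Rightarrow> nat \<Rightarrow> nat \<Rightarrow> nat \<Rightarrow> nat" where
  "wbound n m K a b = m * ((n * n + 1) * ((a + b) * K))"

definition kbase :: "nat \<Rightarrow> nat \<Rightarrow> nat \<Rightarrow> nat \<Rightarrow> nat" where
  "kbase n m a b = wbound n m 1 a b + 1"

definition ybound :: "nat \<Rightarrow> nat \<Rightarrow> nat \<Rightarrow> nat \<Rightarrow> nat" where
  "ybound n m a b = wbound n m (kbase n m a b ^ (a + b)) a b"

text \<open>Each side has \<open>Suc k\<close> factors: \<open>k\<close> entries or denominators of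
  the first matrix and one of the second. Agreement at all \<open>y\<close> up to the degree bound
  is agreement as polynomials.\<close>

definition holds :: "nat \<Rightarrow> bool \<Rightarrow> nat \<Rightarrow> nat \<Rightarrow> nat \<Rightarrow> bool" where
  "holds n s a b k \<longleftrightarrow> (\<forall>y\<le>ybound n (Suc k) a b. related n s (kbase n (Suc k) a b) y a b k)"

text \<open>The summand g serves the case A^g = 1. Otherwise a product must stay nonzero: an entry
  of A^(n+g) - A^n (n + g factors), the denominator of A (one) and det L (n), in total 2n + g + 1.
  Summing over all \<open>y\<close> dominates the bound at the unknown good one.\<close>

definition expbound :: "nat \<Rightarrow> nat \<Rightarrow> nat \<Rightarrow> nat \<Rightarrow> nat \<Rightarrow> nat \<Rightarrow> nat" where
  "expbound n g c C a b = g + (\<Sum>y<Suc (ybound n (2 * n + g + 1) a b).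
     C * (fact (n + 1) * height n (kbase n (2 * n + g + 1) a b) y a b ^ (n + 1) + n + 1) ^ c)"

text \<open>The flag \<open>z\<close> admits negative exponents, by way of the relation A^k B =
  1.\<close>

definition orbit_dec :: "nat \<Rightarrow> nat \<Rightarrow> nat \<Rightarrow> nat \<Rightarrow> bool \<Rightarrow> nat \<Rightarrow> nat \<Rightarrow> nat" where
  "orbit_dec n g c C z a b =
     of_bool (\<exists>k\<le>expbound n g c C a b. holds n False a b k \<or> z \<and> holds n True a b k)"

section \<open>Primitive recursiveness of the decision function\<close>

lemma PR_ent: "PR a \<Longrightarrow> PR (\<lambda>\<sigma>. ent (a \<sigma>) i j)"
  unfolding ent_def by (intro PR_lnth PR_const)

lemma PRI_num: "PR E \<Longrightarrow> PR y \<Longrightarrow> PR a \<Longrightarrow> PRI (\<lambda>\<sigma>. num n (E \<sigma>) (y \<sigma>) (a \<sigma>) i j)"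
  unfolding num_def by (intro PRI_mult PRI_prod_const PRI_evalc PR_pfst PR_psnd PR_ent)

lemma PRI_den: "PR E \<Longrightarrow> PR y \<Longrightarrow> PR a \<Longrightarrow> PRI (\<lambda>\<sigma>. den n (E \<sigma>) (y \<sigma>) (a \<sigma>))"
  unfolding den_def by (intro PRI_prod_const PRI_evalc PR_psnd PR_ent)

lemma PRI_lft: "PR E \<Longrightarrow> PR y \<Longrightarrow> PR a \<Longrightarrow> PRI (\<lambda>\<sigma>. lft n s (E \<sigma>) (y \<sigma>) (a \<sigma>) i j)"
  unfolding lft_def by (intro PRI_if_const PRI_num PRI_den PRI_const)

lemma PR_height: "PR E \<Longrightarrow> PR y \<Longrightarrow> PR a \<Longrightarrow> PR b \<Longrightarrow> PR (\<lambda>\<sigma>. height n (E \<sigma>) (y \<sigma>) (a \<sigma>) (b \<sigma>))"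
  unfolding height_def by (intro PR_add PR_sum_const PR_nat_abs PRI_num PRI_den)

lemma PRP_related:
  assumes "PR E" "PR y" "PR a" "PR b" "PR k"
  shows "PRP (\<lambda>\<sigma>. related n s (E \<sigma>) (y \<sigma>) (a \<sigma>) (b \<sigma>) (k \<sigma>))"
  unfolding related_def rgt_def
  by (intro PRP_all_const PRP_eq_int PRI_sum_const PRI_mult PRI_power PRI_lft PRI_den
      PRI_mpow[where A = "\<lambda>i j \<sigma>. num n (E \<sigma>) (y \<sigma>) (a \<sigma>) i j"] PRI_num assms)
    (auto simp: pairs_def)

lemma PR_wbound: "PR m \<Longrightarrow> PR K \<Longrightarrow> PR a \<Longrightarrow> PR b \<Longrightarrow> PR (\<lambda>\<sigma>. wbound n (m \<sigma>) (K \<sigma>) (a \<sigma>) (b \<sigma>))"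
  unfolding wbound_def by (intro PR_mult PR_add PR_const)

lemma PR_kbase: "PR m \<Longrightarrow> PR a \<Longrightarrow> PR b \<Longrightarrow> PR (\<lambda>\<sigma>. kbase n (m \<sigma>) (a \<sigma>) (b \<sigma>))"
  unfolding kbase_def by (intro PR_add PR_wbound PR_const)

lemma PR_ybound: "PR m \<Longrightarrow> PR a \<Longrightarrow> PR b \<Longrightarrow> PR (\<lambda>\<sigma>. ybound n (m \<sigma>) (a \<sigma>) (b \<sigma>))"
  unfolding ybound_def by (intro PR_wbound PR_power PR_kbase PR_add)

lemma PRP_holds:
  assumes "PR a" "PR b" "PR k"
  shows "PRP (\<lambda>\<sigma>. holds n s (a \<sigma>) (b \<sigma>) (k \<sigma>))"
  unfolding holds_def
  by (intro PRP_ball PRP_related PR_ybound PR_kbase PR_Suc PR_var PR_shift[OF assms(1)] PR_shift[OF assms(2)]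
      PR_shift[OF assms(3)] assms)

lemma PR_expbound:
  assumes "PR a" "PR b"
  shows "PR (\<lambda>\<sigma>. expbound n g c C (a \<sigma>) (b \<sigma>))"
  unfolding expbound_def
  by (intro PR_add PR_sum PR_mult PR_power PR_height PR_kbase PR_ybound PR_Suc PR_const PR_var
      PR_shift[OF assms(1)] PR_shift[OF assms(2)] assms)

lemma PR_orbit_dec: "PR (\<lambda>\<sigma>. orbit_dec n g c C z (\<sigma> 0) (\<sigma> 1))"
  unfolding orbit_dec_def
  by (intro PRP_bex PRP_disj PRP_conj PRP_const PRP_holds PR_expbound PR_var)

section \<open>Matrix powers under homomorphisms and inverses\<close>

lemma mat_mpow:
  fixes f :: "nat \<Rightarrow> nat \<Rightarrow> 'a::comm_ring_1"
  shows "mat n n (\<lambda>(i, j). f i j) ^\<^sub>m k = mat n n (\<lambda>(i, j). mpow n f k i j)"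
proof (induction k)
  case 0
  show ?case by (intro eq_matI) auto
next
  case (Suc k)
  show ?case
    unfolding pow_mat.simps Suc
    by (intro eq_matI) (auto simp: scalar_prod_def atLeast0LessThan)
qed

lemma (in comm_ring_hom) hom_mpow:
  assumes "\<And>i j. i < n \<Longrightarrow> j < n \<Longrightarrow> hom (f i j) = f' i j" "i < n" "j < n"
  shows "hom (mpow n f k i j) = mpow n f' k i j"
  using assms(2,3)
proof (induction k arbitrary: j)
  case (Suc k)
  then show ?case using assms(1) by (simp add: hom_sum hom_mult)
qed simp

lemma pow_mat_invertible:
  fixes A A' :: "'b::comm_ring_1 mat"
  assumes "A \<in> carrier_mat n n" "A' \<in> carrier_mat n n" "A' * A = 1\<^sub>m n"
  shows "A' ^\<^sub>m k * A ^\<^sub>m k = 1\<^sub>m n"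
proof (induction k)
  case (Suc k)
  let ?a = "A ^\<^sub>m k" and ?b = "A' ^\<^sub>m k"
  have c: "?a \<in> carrier_mat n n" "?b \<in> carrier_mat n n" using assms by auto
  have "A ^\<^sub>m Suc k = A * ?a" using pow_mat_add[OF assms(1), of 1 k] assms(1) by simp
  then have "A' ^\<^sub>m Suc k * A ^\<^sub>m Suc k = ?b * (A' * A * ?a)"
    using assoc_mult_mat[OF c(2) assms(2), of "A * ?a" n] assoc_mult_mat[OF assms(2,1) c(1)] assms c by simp
  then show ?case using Suc assms c by simp
qed (use assms in simp)

lemma smult_mat_cancel: "c \<noteq> 0 \<Longrightarrow> c \<cdot>\<^sub>m M = c \<cdot>\<^sub>m N \<longleftrightarrow> M = (N :: 'a::field mat)"
proof
  assume c: "c \<noteq> 0" "c \<cdot>\<^sub>m M = c \<cdot>\<^sub>m N"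
  have "inverse c \<cdot>\<^sub>m (c \<cdot>\<^sub>m M) = inverse c \<cdot>\<^sub>m (c \<cdot>\<^sub>m N)" using c(2) by simp
  then show "M = N" using c(1) by (simp add: smult_smult_mat)
qed simp

lemma mat_eq_iff_entries:
  assumes "M \<in> carrier_mat n n" "N \<in> carrier_mat n n"
  shows "M = N \<longleftrightarrow> (\<forall>i<n. \<forall>j<n. M $$ (i, j) = N $$ (i, j))"
  using eq_matI[of N M] assms by (metis carrier_matD)

locale coded_matrix =
  fixes n :: nat and A :: "rat_fun mat" and a :: nat and P Q :: "nat \<Rightarrow> nat \<Rightarrow> poly_expr"
  assumes carrier: "A \<in> carrier_mat n n"
    and nonzero: "\<And>i j. i < n \<Longrightarrow> j < n \<Longrightarrow> poly_of (Q i j) \<noteq> 0"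
    and entry: "\<And>i j. i < n \<Longrightarrow> j < n \<Longrightarrow> A $$ (i, j) = Fraction_Field.Fract (poly_of (P i j)) (poly_of (Q i j))"
    and code: "a = list_encode (map (\<lambda>i. list_encode
        (map (\<lambda>j. prod_encode (encode_poly (P i j), encode_poly (Q i j))) [0..<n])) [0..<n])"
begin

definition pnum :: "nat \<Rightarrow> nat \<Rightarrow> rat_poly" where
  "pnum i j = poly_of (P i j) * (\<Prod>x\<in>pairs n - {(i, j)}. poly_of (Q (fst x) (snd x)))"

definition pden :: rat_poly where
  "pden = (\<Prod>x\<in>pairs n. poly_of (Q (fst x) (snd x)))"

lemma ent: "i < n \<Longrightarrow> j < n \<Longrightarrow> ent a i j = prod_encode (encode_poly (P i j), encode_poly (Q i j))"
  unfolding ent_def code by (simp add: lnth_encode)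

lemma ev_num: "i < n \<Longrightarrow> j < n \<Longrightarrow> of_int (num n E y a i j) = ev E y (pnum i j)"
  unfolding num_def pnum_def of_int_mult of_int_prod ev.hom_mult ev.hom_prod
  by (intro arg_cong2[where f = "(*)"] prod.cong refl) (auto simp: ent evalc_encode pairs_def)

lemma ev_den: "of_int (den n E y a) = ev E y pden"
  unfolding den_def pden_def of_int_prod ev.hom_prod
  by (intro prod.cong refl) (auto simp: ent evalc_encode pairs_def)

lemma pden_nonzero: "pden \<noteq> 0"
  unfolding pden_def using nonzero by (auto simp: pairs_def)

lemma pnum_entry:
  assumes "i < n" "j < n"
  shows "to_fract (pnum i j) = to_fract pden * A $$ (i, j)"
proof -
  have "pden = poly_of (Q i j) * (\<Prod>x\<in>pairs n - {(i, j)}. poly_of (Q (fst x) (snd x)))"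
    unfolding pden_def using assms by (subst prod.remove[of _ "(i, j)"]) (auto simp: pairs_def)
  then show ?thesis
    using nonzero[OF assms] by (simp add: entry[OF assms] pnum_def to_fract_def eq_fract)
qed

lemma encode_le:
  assumes "i < n" "j < n"
  shows "encode_poly (P i j) \<le> a" "encode_poly (Q i j) \<le> a"
proof -
  let ?r = "list_encode (map (\<lambda>j. prod_encode (encode_poly (P i j), encode_poly (Q i j))) [0..<n])"
  have "prod_encode (encode_poly (P i j), encode_poly (Q i j)) \<le> ?r"
    using assms by (intro mem_le_encode) auto
  also have "?r \<le> a" unfolding code using assms by (intro mem_le_encode) auto
  finally have "prod_encode (encode_poly (P i j), encode_poly (Q i j)) \<le> a" .
  then show "encode_poly (P i j) \<le> a" "encode_poly (Q i j) \<le> a"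
    using le_prod_encode_1 le_prod_encode_2 order_trans by blast+
qed

text \<open>Numerators and denominator are products of \<open>n * n\<close> coded polynomials;
  counting one more spares the subtraction for the factor left out of a numerator.\<close>

lemma weights:
  assumes "weight \<omega>" and W: "\<And>ts. encode_poly ts \<le> a \<Longrightarrow> wle \<omega> W (poly_of ts)"
  shows "i < n \<Longrightarrow> j < n \<Longrightarrow> wle \<omega> ((n * n + 1) * W) (pnum i j)" "wle \<omega> ((n * n + 1) * W) pden"
proof -
  interpret weight \<omega> by fact
  have Q: "wle \<omega> W (poly_of (Q (fst x) (snd x)))" if "x \<in> pairs n" for x
    using that W encode_le by (auto simp: pairs_def)
  have card: "card (pairs n) = n * n" "finite (pairs n)" by (simp_all add: pairs_def)
  have "wle \<omega> (card (pairs n) * W) pden" unfolding pden_def using Q by (rule wle_prod)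
  then show "wle \<omega> ((n * n + 1) * W) pden" by (rule wle_mono) (simp add: card)
  assume ij: "i < n" "j < n"
  have "wle \<omega> (W + card (pairs n - {(i, j)}) * W) (pnum i j)"
    unfolding pnum_def using Q W encode_le(1)[OF ij] by (intro wle_mult wle_prod) auto
  moreover have "card (pairs n - {(i, j)}) \<le> n * n" using card card_mono[of "pairs n" "pairs n - {(i, j)}"] by auto
  then have "W + card (pairs n - {(i, j)}) * W \<le> (n * n + 1) * W" by (simp add: mult_le_mono1)
  ultimately show "wle \<omega> ((n * n + 1) * W) (pnum i j)" by (rule wle_mono)
qed

end

interpretation to_fract: inj_comm_ring_hom "to_fract :: rat_poly \<Rightarrow> rat_fun"
  by unfold_locales auto

locale coded_pair = A: coded_matrix n A a P Q + B: coded_matrix n B b P' Q'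
  for n A a P Q B b P' Q'
begin

definition plft :: "bool \<Rightarrow> nat \<Rightarrow> nat \<Rightarrow> rat_poly" where
  "plft s i j = (if s then B.pnum i j else if i = j then B.pden else 0)"

text \<open>The two sides after clearing denominators: its specialisations are what
  \<open>related\<close> tests, and its vanishing is the relation itself.\<close>

definition defect :: "bool \<Rightarrow> nat \<Rightarrow> nat \<Rightarrow> nat \<Rightarrow> rat_poly" where
  "defect s k i j = (\<Sum>l<n. mpow n A.pnum k i l * plft s l j) - A.pden ^ k * plft (\<not> s) i j"

definition rel :: "bool \<Rightarrow> nat \<Rightarrow> bool" where
  "rel s k \<longleftrightarrow> A ^\<^sub>m k * (if s then B else 1\<^sub>m n) = (if s then 1\<^sub>m n else B)"

lemma ev_lft: "i < n \<Longrightarrow> j < n \<Longrightarrow> of_int (lft n s E y b i j) = ev E y (plft s i j)"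
  by (simp add: lft_def plft_def B.ev_num B.ev_den)

lemma ev_mpow: "i < n \<Longrightarrow> j < n \<Longrightarrow>
    of_int (mpow n (\<lambda>i j. num n E y a i j) k i j) = ev E y (mpow n A.pnum k i j)"
  using of_int_hom.hom_mpow[of n "\<lambda>i j. num n E y a i j" "\<lambda>i j. ev E y (A.pnum i j)" i j k]
    ev.hom_mpow[of n E y A.pnum "\<lambda>i j. ev E y (A.pnum i j)" i j k] A.ev_num by simp

lemma related_iff: "related n s E y a b k \<longleftrightarrow> (\<forall>i<n. \<forall>j<n. ev E y (defect s k i j) = 0)"
proof -
  have "(\<Sum>l<n. mpow n (\<lambda>i j. num n E y a i j) k i l * lft n s E y b l j) = den n E y a ^ k * rgt n s E y b i j \<longleftrightarrow>
      ev E y (defect s k i j) = 0" if "i < n" "j < n" for i j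
  proof -
    have "of_int ((\<Sum>l<n. mpow n (\<lambda>i j. num n E y a i j) k i l * lft n s E y b l j) - den n E y a ^ k * rgt n s E y b i j) =
        ev E y (defect s k i j)"
      using that by (simp add: defect_def ev.hom_minus ev.hom_sum ev.hom_mult ev.hom_power ev_mpow ev_lft A.ev_den rgt_def)
    then show ?thesis by (metis of_int_eq_0_iff right_minus_eq)
  qed
  then show ?thesis by (auto simp: related_def pairs_def)
qed

abbreviation (input) lift :: "rat_poly mat \<Rightarrow> rat_fun mat" where "lift \<equiv> map_mat to_fract"

abbreviation pA :: "rat_poly mat" where "pA \<equiv> mat n n (\<lambda>(i, j). A.pnum i j)"

abbreviation pL :: "bool \<Rightarrow> rat_poly mat" where "pL s \<equiv> mat n n (\<lambda>(i, j). plft s i j)"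

lemma lift_pA: "lift pA = to_fract A.pden \<cdot>\<^sub>m A"
  using A.carrier A.pnum_entry by (intro eq_matI) auto

lemma lift_pL: "lift (pL s) = to_fract B.pden \<cdot>\<^sub>m (if s then B else 1\<^sub>m n)"
  using B.carrier B.pnum_entry by (intro eq_matI) (auto simp: plft_def)

lemma lift_pow: "lift (pA ^\<^sub>m k) = to_fract A.pden ^ k \<cdot>\<^sub>m (A ^\<^sub>m k)"
proof (induction k)
  case 0
  show ?case using A.carrier by (intro eq_matI) auto
next
  case (Suc k)
  have "lift (pA ^\<^sub>m Suc k) = lift (pA ^\<^sub>m k) * lift pA"
    using to_fract.mat_hom_mult[OF pow_carrier_mat[of pA n k], of pA n] by simp
  also have "\<dots> = to_fract A.pden ^ Suc k \<cdot>\<^sub>m (A ^\<^sub>m Suc k)"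
    unfolding Suc lift_pA
    using mult_smult_assoc_mat[OF pow_carrier_mat[OF A.carrier, of k] smult_carrier_mat[OF A.carrier],
        of "to_fract A.pden ^ k" "to_fract A.pden"]
      mult_smult_distrib[OF pow_carrier_mat[OF A.carrier, of k] A.carrier, of "to_fract A.pden"]
    by (simp add: smult_smult_mat mult.commute)
  finally show ?case .
qed

text \<open>Over the fraction field both sides carry the same nonzero factor, the k-th power of the
  denominator of A times that of B, and it cancels.\<close>

lemma rel_iff_defect: "rel s k \<longleftrightarrow> (\<forall>i<n. \<forall>j<n. defect s k i j = 0)"
proof -
  let ?L = "if s then B else 1\<^sub>m n" and ?R = "if s then 1\<^sub>m n else B"
  let ?d = "to_fract A.pden ^ k * to_fract B.pden"
  have L: "?L \<in> carrier_mat n n" using B.carrier by simp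
  have d: "?d \<noteq> 0" using A.pden_nonzero B.pden_nonzero by simp
  have 1: "lift (pA ^\<^sub>m k * pL s) = ?d \<cdot>\<^sub>m (A ^\<^sub>m k * ?L)"
  proof -
    have "lift (pA ^\<^sub>m k * pL s) = lift (pA ^\<^sub>m k) * lift (pL s)"
      by (rule to_fract.mat_hom_mult[of _ n n _ n]) auto
    also have "\<dots> = ?d \<cdot>\<^sub>m (A ^\<^sub>m k * ?L)"
      unfolding lift_pow lift_pL
      using mult_smult_assoc_mat[OF pow_carrier_mat[OF A.carrier, of k] smult_carrier_mat[OF L],
          of "to_fract A.pden ^ k" "to_fract B.pden"]
        mult_smult_distrib[OF pow_carrier_mat[OF A.carrier, of k] L, of "to_fract B.pden"]
      by (simp add: smult_smult_mat)
    finally show ?thesis .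
  qed
  have 2: "lift (A.pden ^ k \<cdot>\<^sub>m pL (\<not> s)) = ?d \<cdot>\<^sub>m ?R"
  proof -
    have "lift (A.pden ^ k \<cdot>\<^sub>m pL (\<not> s)) = to_fract A.pden ^ k \<cdot>\<^sub>m lift (pL (\<not> s))"
      by (intro eq_matI) (auto simp: to_fract.hom_power)
    then show ?thesis unfolding lift_pL by (simp add: smult_smult_mat)
  qed
  have "rel s k \<longleftrightarrow> lift (pA ^\<^sub>m k * pL s) = lift (A.pden ^ k \<cdot>\<^sub>m pL (\<not> s))"
    unfolding 1 2 rel_def smult_mat_cancel[OF d] ..
  also have "\<dots> \<longleftrightarrow> pA ^\<^sub>m k * pL s = A.pden ^ k \<cdot>\<^sub>m pL (\<not> s)"
    using to_fract.mat_hom_inj by auto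
  also have "\<dots> \<longleftrightarrow> (\<forall>i<n. \<forall>j<n. (pA ^\<^sub>m k * pL s) $$ (i, j) = (A.pden ^ k \<cdot>\<^sub>m pL (\<not> s)) $$ (i, j))"
    by (rule mat_eq_iff_entries) auto
  also have "\<dots> \<longleftrightarrow> (\<forall>i<n. \<forall>j<n. defect s k i j = 0)"
    unfolding mat_mpow by (simp add: defect_def scalar_prod_def atLeast0LessThan)
  finally show ?thesis .
qed

text \<open>\<open>V\<close> bounds one numerator or denominator, and weights add under
  multiplication; the determinant is treated by the Leibniz formula, whose terms have
  \<open>n\<close> factors and a sign of weight 0.\<close>

lemma weight_bounds:
  assumes "weight \<omega>" and W: "\<And>ts. encode_poly ts \<le> a + b \<Longrightarrow> wle \<omega> ((a + b) * K) (poly_of ts)"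
  defines "V \<equiv> (n * n + 1) * ((a + b) * K)"
  shows "i < n \<Longrightarrow> j < n \<Longrightarrow> wle \<omega> (k * V) (mpow n A.pnum k i j)" "wle \<omega> V A.pden"
    "i < n \<Longrightarrow> j < n \<Longrightarrow> wle \<omega> V (plft s i j)" "wle \<omega> (n * V) (det (pL s))"
    "i < n \<Longrightarrow> j < n \<Longrightarrow> wle \<omega> (wbound n (Suc k) K a b) (defect s k i j)"
proof -
  interpret weight \<omega> by fact
  have wA: "wle \<omega> V (A.pnum i j)" if "i < n" "j < n" for i j
    unfolding V_def using that W by (intro A.weights[OF assms(1)]) auto
  have wB: "wle \<omega> V (B.pnum i j)" if "i < n" "j < n" for i j
    unfolding V_def using that W by (intro B.weights[OF assms(1)]) auto
  have dA: "wle \<omega> V A.pden" unfolding V_def using W by (intro A.weights[OF assms(1)]) auto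
  have dB: "wle \<omega> V B.pden" unfolding V_def using W by (intro B.weights[OF assms(1)]) auto
  have pw: "wle \<omega> (k * V) (mpow n A.pnum k i j)" if "i < n" "j < n" for i j
    using that
  proof (induction k arbitrary: j)
    case (Suc k)
    have "wle \<omega> (k * V + V) (mpow n A.pnum (Suc k) i j)"
      unfolding mpow.simps using Suc wA by (intro wle_sum wle_mult) auto
    then show ?case by (simp add: add.commute)
  qed (simp add: wle_0 wle_1)
  have lw: "wle \<omega> V (plft s i j)" if "i < n" "j < n" for i j s
    using that wB dB by (simp add: plft_def wle_0)
  show "wle \<omega> V A.pden" by (rule dA)
  show "wle \<omega> (k * V) (mpow n A.pnum k i j)" "wle \<omega> V (plft s i j)" if "i < n" "j < n"
    using pw lw that by blast+
  show "wle \<omega> (n * V) (det (pL s))"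
  proof -
    have "wle \<omega> (0 + n * V) (signof p * (\<Prod>i = 0..<n. pL s $$ (i, p i)))" if "p permutes {0..<n}" for p
    proof (intro wle_mult)
      show "wle \<omega> 0 (signof p)" using wle_1 wle_uminus by (simp add: sign_def)
      have "p i < n" if "i < n" for i using permutes_in_image[OF \<open>p permutes {0..<n}\<close>, of i] that by simp
      then have "wle \<omega> (card {0..<n} * V) (\<Prod>i = 0..<n. pL s $$ (i, p i))"
        using lw by (intro wle_prod) auto
      then show "wle \<omega> (n * V) (\<Prod>i = 0..<n. pL s $$ (i, p i))" by simp
    qed
    then show ?thesis by (subst det_def'[of _ n]) (auto intro!: wle_sum)
  qed
  assume ij: "i < n" "j < n"
  have "wle \<omega> (k * V + V) (defect s k i j)"
    unfolding defect_def using pw lw dA ij by (intro wle_diff wle_sum wle_mult wle_power) auto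
  then show "wle \<omega> (wbound n (Suc k) K a b) (defect s k i j)"
    by (simp add: wbound_def V_def algebra_simps)
qed

lemma weight_hyps:
  "encode_poly ts \<le> a + b \<Longrightarrow> wle (\<lambda>m. mlookup m i) ((a + b) * 1) (poly_of ts)"
  "E > 0 \<Longrightarrow> encode_poly ts \<le> a + b \<Longrightarrow> wle (wt E) ((a + b) * E ^ (a + b)) (poly_of ts)"
  by (rule wle_lookup_poly_of, simp) (rule wle_wt_poly_of)

text \<open>If the relation fails, some defect is a nonzero polynomial within the bounds behind
  \<open>kbase\<close> and \<open>ybound\<close>, so it is nonzero at one of the tested
  \<open>y\<close>.\<close>

lemma holds_iff: "holds n s a b k \<longleftrightarrow> rel s k"
proof
  assume "rel s k"
  then show "holds n s a b k" by (simp add: holds_def related_iff rel_iff_defect)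
next
  assume h: "holds n s a b k"
  let ?E = "kbase n (Suc k) a b"
  show "rel s k"
    unfolding rel_iff_defect
  proof (intro allI impI, rule ccontr)
    fix i j assume ij: "i < n" "j < n" and nz: "defect s k i j \<noteq> 0"
    have "\<exists>y\<le>ybound n (Suc k) a b. ev ?E y (defect s k i j) \<noteq> 0"
    proof (rule ev_nonzero[OF nz])
      show "wle (\<lambda>m. mlookup m l) (wbound n (Suc k) 1 a b) (defect s k i j)" for l
        by (rule weight_bounds(5)[OF lookup_weight.weight_axioms weight_hyps(1) ij])
      show "wle (wt ?E) (ybound n (Suc k) a b) (defect s k i j)"
        unfolding ybound_def
        by (rule weight_bounds(5)[OF wt.weight_axioms weight_hyps(2) ij]) (simp add: kbase_def)
    qed (simp add: kbase_def)
    then show False using h ij by (auto simp: holds_def related_iff)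
  qed
qed

lemma rel_bounded:
  assumes g: "g > 0"
    and bound: "int_exponent_bounded n g (\<lambda>h. C * (fact (n + 1) * h ^ (n + 1) + n + 1) ^ c)"
    and A': "A' \<in> carrier_mat n n" "A' * A = 1\<^sub>m n" and B': "B' \<in> carrier_mat n n" "B' * B = 1\<^sub>m n"
    and rel: "rel s k"
  shows "\<exists>k\<le>expbound n g c C a b. rel s k"
proof (cases "A ^\<^sub>m g = 1\<^sub>m n")
  \<comment> \<open>Specialisation is of no help for a matrix of finite order, but then only the
    exponent modulo g matters.\<close>
  case True
  have one: "1\<^sub>m n ^\<^sub>m m = (1\<^sub>m n :: rat_fun mat)" for m by (induction m) auto
  have "A ^\<^sub>m k = A ^\<^sub>m (g * (k div g) + k mod g)" by simp
  also have "\<dots> = (A ^\<^sub>m g) ^\<^sub>m (k div g) * A ^\<^sub>m (k mod g)"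
    by (simp only: pow_mat_add[OF A.carrier] pow_mat_mult[OF A.carrier])
  also have "\<dots> = A ^\<^sub>m (k mod g)" using A.carrier by (simp add: True one)
  finally have "rel s (k mod g)" using rel by (simp add: rel_def)
  moreover have "k mod g \<le> expbound n g c C a b" using g by (simp add: expbound_def less_imp_le trans_le_add1)
  ultimately show ?thesis by blast
next
  case False
  define m where "m = 2 * n + g + 1"
  define E where "E = kbase n m a b"
  \<comment> \<open>A^(n+g) - A^n after clearing denominators. Before specialisation A is
    invertible, so the vanishing of all entries would give A^g = 1.\<close>
  define U where "U i j = mpow n A.pnum (n + g) i j - A.pden ^ g * mpow n A.pnum n i j" for i j
  have "\<exists>i j. i < n \<and> j < n \<and> U i j \<noteq> 0"
  proof (rule ccontr)
    assume "\<not> (\<exists>i j. i < n \<and> j < n \<and> U i j \<noteq> 0)"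
    then have "pA ^\<^sub>m (n + g) = A.pden ^ g \<cdot>\<^sub>m (pA ^\<^sub>m n)"
      unfolding mat_mpow by (intro eq_matI) (auto simp: U_def)
    then have "lift (pA ^\<^sub>m (n + g)) = to_fract A.pden ^ g \<cdot>\<^sub>m lift (pA ^\<^sub>m n)"
      by (auto intro!: eq_matI simp: to_fract.hom_power)
    then have "to_fract A.pden ^ (n + g) \<cdot>\<^sub>m (A ^\<^sub>m (n + g)) = to_fract A.pden ^ (n + g) \<cdot>\<^sub>m (A ^\<^sub>m n)"
      unfolding lift_pow by (simp add: smult_smult_mat power_add mult.commute)
    then have "A ^\<^sub>m (n + g) = A ^\<^sub>m n" using A.pden_nonzero by (simp add: smult_mat_cancel)
    then have "A' ^\<^sub>m n * (A ^\<^sub>m n * A ^\<^sub>m g) = A' ^\<^sub>m n * A ^\<^sub>m n" by (simp add: pow_mat_add[OF A.carrier])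
    then have "A ^\<^sub>m g = 1\<^sub>m n"
      using assoc_mult_mat[OF pow_carrier_mat[OF A'(1), of n] pow_carrier_mat[OF A.carrier, of n] pow_carrier_mat[OF A.carrier, of g]]
        pow_mat_invertible[OF A.carrier A', of n] A.carrier by simp
    with False show False ..
  qed
  then obtain i j where ij: "i < n" "j < n" "U i j \<noteq> 0" by blast
  have detL: "det (pL s) \<noteq> 0"
  proof
    assume "det (pL s) = 0"
    then have "det (lift (pL s)) = 0" by (simp add: to_fract.hom_det)
    then have "det (if s then B else 1\<^sub>m n) = 0"
      unfolding lift_pL using B.pden_nonzero B.carrier by (auto split: if_splits)
    moreover have "det B' * det B = 1" using det_mult[OF B'(1) B.carrier] B'(2) by simp
    ultimately show False by (auto split: if_splits)
  qed
  \<comment> \<open>One polynomial collects the three conditions on \<open>y\<close>, so that a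
    single value satisfies them all. The determinant of A is not among them: the bound for integer
    matrices allows a singular A.\<close>
  define p where "p = U i j * (A.pden * det (pL s))"
  have p: "p \<noteq> 0" using ij(3) A.pden_nonzero detL by (simp add: p_def)
  have wp: "wle \<omega> (wbound n m K a b) p"
    if w: "weight \<omega>" and W: "\<And>ts. encode_poly ts \<le> a + b \<Longrightarrow> wle \<omega> ((a + b) * K) (poly_of ts)" for \<omega> K
  proof -
    interpret weight \<omega> by fact
    let ?V = "(n * n + 1) * ((a + b) * K)"
    note wb = weight_bounds[OF w W]
    have "wle \<omega> (g * ?V + n * ?V) (A.pden ^ g * mpow n A.pnum n i j)"
      by (intro wle_mult wle_power wb ij)
    then have "wle \<omega> ((n + g) * ?V) (A.pden ^ g * mpow n A.pnum n i j)"
      by (rule wle_mono) (subst add_mult_distrib, simp)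
    then have "wle \<omega> ((n + g) * ?V) (U i j)"
      unfolding U_def by (intro wle_diff wb ij)
    then have "wle \<omega> ((n + g) * ?V + (?V + n * ?V)) p"
      unfolding p_def by (intro wle_mult wb)
    moreover have "(n + g) * ?V + (?V + n * ?V) = wbound n m K a b"
      by (simp add: wbound_def m_def algebra_simps mult_2_right)
    ultimately show ?thesis by simp
  qed
  have "\<exists>y\<le>ybound n m a b. ev E y p \<noteq> 0"
  proof (rule ev_nonzero[OF p])
    show "wle (\<lambda>m. mlookup m l) (wbound n m 1 a b) p" for l
      by (rule wp[OF lookup_weight.weight_axioms weight_hyps(1)])
    show "wle (wt E) (ybound n m a b) p"
      unfolding ybound_def E_def[symmetric]
      by (rule wp[OF wt.weight_axioms weight_hyps(2)]) (simp add: E_def kbase_def)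
  qed (simp add: E_def kbase_def)
  then obtain y where y: "y \<le> ybound n m a b" "ev E y p \<noteq> 0" by blast
  have evs: "ev E y (U i j) \<noteq> 0" "ev E y A.pden \<noteq> 0" "ev E y (det (pL s)) \<noteq> 0"
    using y(2) by (auto simp: p_def ev.hom_mult)
  define h where "h = height n E y a b"
  define iA where "iA = mat n n (\<lambda>(i, j). num n E y a i j)"
  define iL where "iL = (\<lambda>s. mat n n (\<lambda>(i, j). lft n s E y b i j))"
  have num_le: "\<bar>num n E y a i j\<bar> \<le> int h \<and> \<bar>num n E y b i j\<bar> \<le> int h" if "i < n" "j < n" for i j
  proof -
    have "nat \<bar>num n E y a i j\<bar> + nat \<bar>num n E y b i j\<bar> \<le>
        (\<Sum>x\<in>pairs n. nat \<bar>num n E y a (fst x) (snd x)\<bar> + nat \<bar>num n E y b (fst x) (snd x)\<bar>)"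
      using that member_le_sum[of "(i, j)" "pairs n" "\<lambda>x. nat \<bar>num n E y a (fst x) (snd x)\<bar> + nat \<bar>num n E y b (fst x) (snd x)\<bar>"]
      by (simp add: pairs_def)
    then have "nat \<bar>num n E y a i j\<bar> + nat \<bar>num n E y b i j\<bar> \<le> h"
      unfolding h_def height_def by (rule trans_le_add2)
    then show ?thesis by linarith
  qed
  have "nat \<bar>den n E y a\<bar> \<le> h" "nat \<bar>den n E y b\<bar> \<le> h" by (simp_all add: h_def height_def)
  then have den_le: "\<bar>den n E y a\<bar> \<le> int h" "\<bar>den n E y b\<bar> \<le> int h" by linarith+
  have lft_le: "\<bar>lft n s E y b i j\<bar> \<le> int h" if "i < n" "j < n" for i j s
    using num_le[OF that] den_le by (simp add: lft_def)
  have "k \<le> C * (fact (n + 1) * h ^ (n + 1) + n + 1) ^ c"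
  proof (rule bound[unfolded int_exponent_bounded_def, rule_format, of iA "iL s" "iL (\<not> s)" k "den n E y a" h])
    have "related n s E y a b k" using rel by (simp add: related_iff rel_iff_defect)
    then show "iA ^\<^sub>m k * iL s = den n E y a ^ k \<cdot>\<^sub>m iL (\<not> s)"
      unfolding iA_def mat_mpow
      by (intro eq_matI) (auto simp: iL_def related_def rgt_def pairs_def scalar_prod_def atLeast0LessThan)
    show "iA ^\<^sub>m (n + g) \<noteq> den n E y a ^ g \<cdot>\<^sub>m (iA ^\<^sub>m n)"
    proof
      assume "iA ^\<^sub>m (n + g) = den n E y a ^ g \<cdot>\<^sub>m (iA ^\<^sub>m n)"
      from arg_cong[OF this, of "\<lambda>M. M $$ (i, j)"]
      have "mpow n (\<lambda>i j. num n E y a i j) (n + g) i j = den n E y a ^ g * mpow n (\<lambda>i j. num n E y a i j) n i j"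
        unfolding iA_def mat_mpow using ij by simp
      from arg_cong[OF this, of "of_int :: int \<Rightarrow> rat"]
      have "ev E y (U i j) = 0"
        using ij by (simp add: U_def ev_mpow A.ev_den ev.hom_minus ev.hom_mult ev.hom_power)
      with evs(1) show False ..
    qed
    show "den n E y a \<noteq> 0" using A.ev_den[of E y] evs(2) by auto
    show "det (iL s) \<noteq> 0"
    proof
      assume "det (iL s) = 0"
      then have "det (map_mat of_int (iL s)) = (0 :: rat)" by (simp add: of_int_hom.hom_det)
      also have "map_mat of_int (iL s) = map_mat (ev E y) (pL s)"
        by (intro eq_matI) (auto simp: iL_def ev_lft)
      finally show False using evs(3) by (simp add: comm_ring_hom.hom_det[OF ev.comm_ring_hom_axioms])
    qed
  qed (use den_le num_le lft_le in \<open>auto simp: iA_def iL_def\<close>)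
  \<comment> \<open>The chosen \<open>y\<close> is one of the summation indices, and the other terms
    are natural numbers.\<close>
  also have "\<dots> \<le> (\<Sum>y<Suc (ybound n m a b). C * (fact (n + 1) * height n E y a b ^ (n + 1) + n + 1) ^ c)"
    unfolding h_def using y(1)
    by (intro member_le_sum[where f = "\<lambda>y. C * (fact (n + 1) * height n E y a b ^ (n + 1) + n + 1) ^ c"]) auto
  also have "\<dots> \<le> expbound n g c C a b" by (simp add: expbound_def m_def E_def)
  finally show ?thesis using rel by blast
qed

end

section \<open>The decision for the group\<close>

lemma encodes_matrix_coded:
  assumes "encodes_matrix n X w A"
  obtains P Q where "coded_matrix n A (horner_sum of_bool 2 w) P Q"
proof -
  obtain P Q :: "nat \<Rightarrow> nat \<Rightarrow> poly_expr" where
    "\<forall>i<n. \<forall>j<n. indets (poly_of (P i j)) \<subseteq> X \<and> indets (poly_of (Q i j)) \<subseteq> X \<and> poly_of (Q i j) \<noteq> 0 \<and>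
       A $$ (i, j) = Fraction_Field.Fract (poly_of (P i j)) (poly_of (Q i j))"
    "(horner_sum of_bool 2 w :: nat) = list_encode (map (\<lambda>i. list_encode
       (map (\<lambda>j. prod_encode (encode_poly (P i j), encode_poly (Q i j))) [0..<n])) [0..<n])"
    using assms unfolding encodes_matrix_def by blast
  then have "coded_matrix n A (horner_sum of_bool 2 w) P Q"
    using assms by unfold_locales (auto simp: encodes_matrix_def)
  then show ?thesis by (rule that)
qed

theorem corollary2p3:
  fixes G :: "('a, 'b) monoid_scheme"
    and \<nu> :: "bool list \<rightharpoonup> 'a"
    and X :: "nat set"
    and n :: nat
    and \<phi> :: "'a \<Rightarrow> rat_fun mat"
  assumes "group G"
    and "encoding_of G \<nu>"
    and "\<phi> \<in> hom G (GL n X)"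
    and "inj_on \<phi> (carrier G)"
    and "exactly_computable \<nu> n X \<phi>"
  shows "decidable_wrt \<nu> (power_orbit G) \<and> decidable_wrt \<nu> (nonneg_power_orbit G)"
proof -
  interpret group G by fact
  obtain M where M: "turing_machine M"
    and out: "\<And>u g. \<nu> u = Some g \<Longrightarrow> \<exists>w. halts_with M [u] w \<and> encodes_matrix n X w (\<phi> g)"
    using assms(5) unfolding exactly_computable_def by blast
  obtain g c C where g: "g > 0"
    and bound: "int_exponent_bounded n g (\<lambda>h. C * (fact (n + 1) * h ^ (n + 1) + n + 1) ^ c)"
    using int_exponent_bounded_exists by blast
  have in_GL: "\<phi> x \<in> carrier (GL n X)" if "x \<in> carrier G" for x
    using assms(3) that by (auto simp: hom_def)
  have inv: "\<phi> x \<in> carrier_mat n n \<and> (\<exists>B. B \<in> carrier_mat n n \<and> \<phi> x * B = 1\<^sub>m n \<and> B * \<phi> x = 1\<^sub>m n)"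
    if "x \<in> carrier G" for x
    using in_GL[OF that] by (auto simp: GL_def mats_over_def)
  have mult: "\<phi> (x \<otimes>\<^bsub>G\<^esub> y) = \<phi> x * \<phi> y" if "x \<in> carrier G" "y \<in> carrier G" for x y
    using assms(3) that by (simp add: hom_def GL_def)
  \<comment> \<open>Only multiplicativity of \<phi> is given; the image of the unit is idempotent
    and has an inverse matrix, so it is the identity.\<close>
  have one: "\<phi> \<one>\<^bsub>G\<^esub> = 1\<^sub>m n"
  proof -
    obtain B where B: "B \<in> carrier_mat n n" "\<phi> \<one>\<^bsub>G\<^esub> * B = 1\<^sub>m n" and c: "\<phi> \<one>\<^bsub>G\<^esub> \<in> carrier_mat n n"
      using inv[of "\<one>\<^bsub>G\<^esub>"] by auto
    have "\<phi> \<one>\<^bsub>G\<^esub> * (\<phi> \<one>\<^bsub>G\<^esub> * B) = \<phi> \<one>\<^bsub>G\<^esub> * B"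
      using assoc_mult_mat[OF c c B(1)] mult[of "\<one>\<^bsub>G\<^esub>" "\<one>\<^bsub>G\<^esub>"] by simp
    then show ?thesis using B c by simp
  qed
  have pow: "\<phi> (x [^]\<^bsub>G\<^esub> k) = \<phi> x ^\<^sub>m k" if "x \<in> carrier G" for x and k :: nat
    by (induction k) (use that inv in \<open>auto simp: one mult\<close>)
  \<comment> \<open>Both problems at once: a negative exponent -k turns x^(-k) = y into x^k y = 1,
    so the flag \<open>z\<close> alone separates them.\<close>
  have dec: "decidable_wrt \<nu> Pr"
    if Pr: "\<And>x y. x \<in> carrier G \<Longrightarrow> y \<in> carrier G \<Longrightarrow>
        Pr x y \<longleftrightarrow> (\<exists>k::nat. x [^]\<^bsub>G\<^esub> k = y \<or> z \<and> x [^]\<^bsub>G\<^esub> k \<otimes>\<^bsub>G\<^esub> y = \<one>\<^bsub>G\<^esub>)" for Pr and z :: bool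
  proof -
    obtain M' where M': "turing_machine M'" "\<And>u v wu wv. halts_with M [u] wu \<Longrightarrow> halts_with M [v] wv \<Longrightarrow>
        halts_with M' [u, v] [orbit_dec n g c C z (horner_sum of_bool 2 wu) (horner_sum of_bool 2 wv) \<noteq> 0]"
      using machine_for_PR[OF M PR_orbit_dec] by metis
    have "halts_with M' [u, v] [Pr x y]" if uv: "\<nu> u = Some x" "\<nu> v = Some y" for u v x y
    proof -
      have xy: "x \<in> carrier G" "y \<in> carrier G"
        using assms(2) uv by (auto simp: encoding_of_def ran_def)
      obtain wu wv where w: "halts_with M [u] wu" "encodes_matrix n X wu (\<phi> x)"
          "halts_with M [v] wv" "encodes_matrix n X wv (\<phi> y)"
        using out uv by blast
      obtain P Q P' Q' where cm: "coded_matrix n (\<phi> x) (horner_sum of_bool 2 wu) P Q"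
          "coded_matrix n (\<phi> y) (horner_sum of_bool 2 wv) P' Q'"
        using encodes_matrix_coded w(2,4) by metis
      let ?a = "horner_sum of_bool 2 wu :: nat" and ?b = "horner_sum of_bool 2 wv :: nat"
      interpret coded_pair n "\<phi> x" ?a P Q "\<phi> y" ?b P' Q' using cm by (simp add: coded_pair_def)
      have inj: "\<phi> v = \<phi> w \<longleftrightarrow> v = w" if "v \<in> carrier G" "w \<in> carrier G" for v w
        using assms(4) that by (auto simp: inj_on_def)
      have rel: "rel False k \<longleftrightarrow> x [^]\<^bsub>G\<^esub> k = y" "rel True k \<longleftrightarrow> x [^]\<^bsub>G\<^esub> k \<otimes>\<^bsub>G\<^esub> y = \<one>\<^bsub>G\<^esub>" for k
      proof -
        have "rel False k \<longleftrightarrow> \<phi> (x [^]\<^bsub>G\<^esub> k) = \<phi> y" using xy A.carrier by (simp add: rel_def pow)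
        then show "rel False k \<longleftrightarrow> x [^]\<^bsub>G\<^esub> k = y" using xy by (simp add: inj)
        have "rel True k \<longleftrightarrow> \<phi> (x [^]\<^bsub>G\<^esub> k \<otimes>\<^bsub>G\<^esub> y) = \<phi> \<one>\<^bsub>G\<^esub>"
          using xy by (simp add: rel_def pow mult one)
        then show "rel True k \<longleftrightarrow> x [^]\<^bsub>G\<^esub> k \<otimes>\<^bsub>G\<^esub> y = \<one>\<^bsub>G\<^esub>"
          using xy by (subst (asm) inj) auto
      qed
      obtain A' B' where A': "A' \<in> carrier_mat n n" "A' * \<phi> x = 1\<^sub>m n"
        and B': "B' \<in> carrier_mat n n" "B' * \<phi> y = 1\<^sub>m n"
        using inv xy by meson
      \<comment> \<open>By faithfulness matrix relations are relations in G, so an unbounded search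
        for k in G reduces to the bounded one performed by \<open>orbit_dec\<close>.\<close>
      have bd: "rel s k \<Longrightarrow> \<exists>k\<le>expbound n g c C ?a ?b. rel s k" for s k
        by (rule rel_bounded[OF g bound A' B'])
      have "orbit_dec n g c C z ?a ?b \<noteq> 0 \<longleftrightarrow> (\<exists>k\<le>expbound n g c C ?a ?b. rel False k \<or> z \<and> rel True k)"
        by (simp add: orbit_dec_def holds_iff)
      also have "\<dots> \<longleftrightarrow> (\<exists>k. rel False k \<or> z \<and> rel True k)" using bd by blast
      also have "\<dots> \<longleftrightarrow> Pr x y" by (simp add: Pr[OF xy] rel)
      finally show ?thesis using M'(2)[OF w(1,3)] by simp
    qed
    then show ?thesis using M'(1) by (auto simp: decidable_wrt_def)
  qed
  have "decidable_wrt \<nu> (nonneg_power_orbit G)"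
    by (rule dec[of _ False]) (simp add: nonneg_power_orbit_def)
  moreover have "decidable_wrt \<nu> (power_orbit G)"
  proof (rule dec[of _ True])
    fix x y assume xy: "x \<in> carrier G" "y \<in> carrier G"
    show "power_orbit G x y \<longleftrightarrow> (\<exists>k::nat. x [^]\<^bsub>G\<^esub> k = y \<or> True \<and> x [^]\<^bsub>G\<^esub> k \<otimes>\<^bsub>G\<^esub> y = \<one>\<^bsub>G\<^esub>)"
    proof
      assume "power_orbit G x y"
      then obtain m :: int where m: "x [^]\<^bsub>G\<^esub> m = y" by (auto simp: power_orbit_def)
      show "\<exists>k::nat. x [^]\<^bsub>G\<^esub> k = y \<or> True \<and> x [^]\<^bsub>G\<^esub> k \<otimes>\<^bsub>G\<^esub> y = \<one>\<^bsub>G\<^esub>"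
      proof (cases "m \<ge> 0")
        case True
        then have "x [^]\<^bsub>G\<^esub> nat m = y" using m int_pow_int[of G x "nat m"] by simp
        then show ?thesis by blast
      next
        case False
        then have "x [^]\<^bsub>G\<^esub> nat (- m) \<otimes>\<^bsub>G\<^esub> y = x [^]\<^bsub>G\<^esub> (- m + m)"
          unfolding m[symmetric] using xy int_pow_mult[of x "- m" m] int_pow_int[of G x "nat (- m)"] by simp
        then have "x [^]\<^bsub>G\<^esub> nat (- m) \<otimes>\<^bsub>G\<^esub> y = \<one>\<^bsub>G\<^esub>" by simp
        then show ?thesis by blast
      qed
    next
      assume "\<exists>k::nat. x [^]\<^bsub>G\<^esub> k = y \<or> True \<and> x [^]\<^bsub>G\<^esub> k \<otimes>\<^bsub>G\<^esub> y = \<one>\<^bsub>G\<^esub>"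
      then obtain k :: nat where "x [^]\<^bsub>G\<^esub> k = y \<or> x [^]\<^bsub>G\<^esub> k \<otimes>\<^bsub>G\<^esub> y = \<one>\<^bsub>G\<^esub>" by blast
      then show "power_orbit G x y"
      proof
        assume "x [^]\<^bsub>G\<^esub> k = y"
        then have "x [^]\<^bsub>G\<^esub> int k = y" by (simp add: int_pow_int)
        then show ?thesis by (auto simp: power_orbit_def)
      next
        assume "x [^]\<^bsub>G\<^esub> k \<otimes>\<^bsub>G\<^esub> y = \<one>\<^bsub>G\<^esub>"
        then have "y = inv\<^bsub>G\<^esub> (x [^]\<^bsub>G\<^esub> k)" using xy by (metis inv_comm inv_equality nat_pow_closed)
        then have "x [^]\<^bsub>G\<^esub> (- int k) = y" using xy by (simp add: int_pow_neg int_pow_int)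
        then show ?thesis by (auto simp: power_orbit_def)
      qed
    qed
  qed
  ultimately show ?thesis by blast
qed

end
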